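(* Assume in addition $\mathbb E Y_0^3<\infty$ and $\mathbb E\varepsilon_1^3<\infty$. Then $\sqrt n(\tilde\alpha_n-\alpha)\to\mathcal N(0,\sigma_{\alpha,\varepsilon}^2)$ in distribution. Moreover, conditionally on the values $(Y_{s_1-1},Y_{s_2-1})$, $$\begin{bmatrix}\sqrt n\big(\tilde\theta_{1,n}-(Y_{s_1}-\alpha Y_{s_1-1}-\mu_\varepsilon)\big)\\ \sqrt n\big(\tilde\theta_{2,n}-(Y_{s_2}-\alpha Y_{s_2-1}-\mu_\varepsilon)\big)\end{bmatrix}\to\mathcal N\Big(\begin{bmatrix}0\\0\end{bmatrix},\sigma_{\alpha,\varepsilon}^2\begin{bmatrix}Y_{s_1-1}^2&Y_{s_1-1}Y_{s_2-1}\\ Y_{s_1-1}Y_{s_2-1}&Y_{s_2-1}^2\end{bmatrix}\Big).$$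
   Context: Let $\alpha\in(0,1)$. Let $(\varepsilon_k)_{k\in\mathbb N}$ be i.i.d. non-negative integer-valued random variables with $\mathbb E\varepsilon_1^2<\infty$ and $\mathbb P(\varepsilon_1\ne 0)>0$; write $\mu_\varepsilon=\mathbb E\varepsilon_1$ (assumed known), $\sigma_\varepsilon^2=\operatorname{Var}\varepsilon_1$. For each $k\in\mathbb N$ let $(\xi_{k,j})_{j\in\mathbb N}$ be i.i.d. Bernoulli random variables with mean $\alpha$, these sequences being mutually independent and independent of $(\varepsilon_k)$. The INAR(1) Markov chain $X_k=\sum_{j=1}^{X_{k-1}}\xi_{k,j}+\varepsilon_k$ has a unique stationary distribution; $\tilde X$ denotes a random variable with it, and $\sigma_{\alpha,\varepsilon}^2=\frac{\alpha(1-\alpha)\mathbb E\tilde X^3+\sigma_\varepsilon^2\mathbb E\tilde X^2}{(\mathbb E\tilde X^2)^2}$. Two innovational outliers: fix known $s_1\ne s_2$ in $\mathbb N$ and $\theta_1,\theta_2\in\mathbb N$; $Y_0$ non-negative integer-valued, independent of all $\xi_{k,j},\varepsilon_k$; $Y_k=\sum_{j=1}^{Y_{k-1}}\xi_{k,j}+\varepsilon_k+\delta_{k,s_1}\theta_1+\delta_{k,s_2}\theta_2$. Define $\tilde\alpha_n=\frac{\sum_{k=1,k\notin\{s_1,s_2\}}^n(Y_k-\mu_\varepsilon)Y_{k-1}}{\sum_{k=1,k\notin\{s_1,s_2\}}^nY_{k-1}^2}$ when the denominator is positive (and $0$ otherwise), and $\tilde\theta_{i,n}=Y_{s_i}-\tilde\alpha_nY_{s_i-1}-\mu_\varepsilon$,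 $i=1,2$. Conditional convergence: for random vectors $\zeta_n$ and a random vector $\eta$ with values in $\mathbb Z_+^d$, "conditionally on the values $\eta$, $\zeta_n\to\mathcal N(0,\Sigma(\eta))$" means: for every $m$ with $\mathbb P(\eta=m)>0$, the conditional distribution of $\zeta_n$ given $\{\eta=m\}$ converges weakly to $\mathcal N(0,\Sigma(m))$. *)

theory Defs
  imports "HOL-Probability.Probability"
begin

type_synonym inar_idx = "nat + (nat \<times> nat) + unit"

definition inar_index :: "inar_idx set" where
  "inar_index = Inl ` {1..} \<union> Inr ` Inl ` ({1..} \<times> {1..}) \<union> {Inr (Inr ())}"

fun inar_family :: "(nat \<Rightarrow> 'a \<Rightarrow> nat) \<Rightarrow> (nat \<Rightarrow> nat \<Rightarrow> 'a \<Rightarrow> nat) \<Rightarrow> ('a \<Rightarrow> nat)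
    \<Rightarrow> inar_idx \<Rightarrow> 'a \<Rightarrow> nat" where
  "inar_family eps xi Y0 (Inl k) = eps k"
| "inar_family eps xi Y0 (Inr (Inl (k, j))) = xi k j"
| "inar_family eps xi Y0 (Inr (Inr u)) = Y0"

text \<open>The INAR(1) process with two innovational outliers theta1, theta2 at times s1, s2.\<close>

fun Yproc :: "(nat \<Rightarrow> 'a \<Rightarrow> nat) \<Rightarrow> (nat \<Rightarrow> nat \<Rightarrow> 'a \<Rightarrow> nat) \<Rightarrow> ('a \<Rightarrow> nat)
    \<Rightarrow> nat \<Rightarrow> nat \<Rightarrow> nat \<Rightarrow> nat \<Rightarrow> nat \<Rightarrow> 'a \<Rightarrow> nat" where
  "Yproc eps xi Y0 s1 s2 th1 th2 0 \<omega> = Y0 \<omega>"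
| "Yproc eps xi Y0 s1 s2 th1 th2 (Suc k) \<omega> =
     (\<Sum>j = 1..Yproc eps xi Y0 s1 s2 th1 th2 k \<omega>. xi (Suc k) j \<omega>) + eps (Suc k) \<omega>
     + (if Suc k = s1 then th1 else 0) + (if Suc k = s2 then th2 else 0)"

text \<open>CLS-type estimator of alpha, leaving out the outlier times.\<close>

definition alpha_tilde :: "(nat \<Rightarrow> 'a \<Rightarrow> nat) \<Rightarrow> real \<Rightarrow> nat \<Rightarrow> nat \<Rightarrow> nat \<Rightarrow> 'a \<Rightarrow> real" where
  "alpha_tilde Y mu s1 s2 n \<omega> =
     (let D = (\<Sum>k \<in> {1..n} - {s1, s2}. (real (Y (k - 1) \<omega>))\<^sup>2) in
      if D > 0 then (\<Sum>k \<in> {1..n} - {s1, s2}. (real (Y k \<omega>) - mu) * real (Y (k - 1) \<omega>)) / D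
      else 0)"

definition theta_tilde :: "(nat \<Rightarrow> 'a \<Rightarrow> nat) \<Rightarrow> real \<Rightarrow> nat \<Rightarrow> nat \<Rightarrow> nat \<Rightarrow> nat \<Rightarrow> 'a \<Rightarrow> real" where
  "theta_tilde Y mu s1 s2 n s \<omega> =
     real (Y s \<omega>) - alpha_tilde Y mu s1 s2 n \<omega> * real (Y (s - 1) \<omega>) - mu"

definition inar_step :: "real \<Rightarrow> nat pmf \<Rightarrow> nat \<Rightarrow> nat pmf" where
  "inar_step \<alpha> epsd x = bind_pmf (binomial_pmf x \<alpha>) (\<lambda>b. map_pmf (\<lambda>e. b + e) epsd)"

definition inar_stationary :: "real \<Rightarrow> nat pmf \<Rightarrow> nat pmf \<Rightarrow> bool" where
  "inar_stationary \<alpha> epsd p \<longleftrightarrow> bind_pmf p (inar_step \<alpha> epsd) = p"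

definition inar_stat_dist :: "real \<Rightarrow> nat pmf \<Rightarrow> nat pmf" where
  "inar_stat_dist \<alpha> epsd = (THE p. inar_stationary \<alpha> epsd p)"

definition sigma2_alpha_eps :: "real \<Rightarrow> nat pmf \<Rightarrow> real" where
  "sigma2_alpha_eps \<alpha> epsd =
     (let p = inar_stat_dist \<alpha> epsd;
          m2 = measure_pmf.expectation p (\<lambda>x. real x ^ 2);
          m3 = measure_pmf.expectation p (\<lambda>x. real x ^ 3);
          v = measure_pmf.variance epsd real
      in (\<alpha> * (1 - \<alpha>) * m3 + v * m2) / m2\<^sup>2)"

definition weak_conv2 :: "(nat \<Rightarrow> (real \<times> real) measure) \<Rightarrow> (real \<times> real) measure \<Rightarrow> bool" where
  "weak_conv2 Ms N \<longleftrightarrow>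
     (\<forall>f :: real \<times> real \<Rightarrow> real. continuous_on UNIV f \<and> bounded (range f) \<longrightarrow>
        (\<lambda>n. integral\<^sup>L (Ms n) f) \<longlonglongrightarrow> integral\<^sup>L N f)"

text \<open>Centered bivariate normal law with rank-one covariance sigma2 * v v^T, v = (a,b):
  the law of (a Z, b Z) with Z ~ N(0, sigma2).\<close>

definition normal2_rank1 :: "real \<Rightarrow> real \<Rightarrow> real \<Rightarrow> (real \<times> real) measure" where
  "normal2_rank1 sigma2 a b =
     distr (density lborel (normal_density 0 (sqrt sigma2))) borel (\<lambda>z. (a * z, b * z))"

end

theory Submission
  imports Defs
begin

text \<open>
  Write \<open>D\<^sub>k = Y\<^sub>k - \<alpha> Y\<^sub>k\<^sub>-\<^sub>1 - \<mu>\<close>, \<open>S\<^sub>n = \<Sum> D\<^sub>k Y\<^sub>k\<^sub>-\<^sub>1\<close> and \<open>Q\<^sub>n = \<Sum> (Y\<^sub>k\<^sub>-\<^sub>1)\<^sup>2\<close>, the sums running over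
  the times without outlier. Then \<open>sqrt n (\<alpha>\<^sub>n - \<alpha>) \<le> x\<close> means \<open>S\<^sub>n / sqrt n - x Q\<^sub>n / n \<le> 0\<close>, so it is
  enough to find, given any event of positive probability in the past of a fixed time, the limit of
  the characteristic functions of these linear combinations.

  Conditionally on \<open>Y\<^sub>k\<^sub>-\<^sub>1 = y\<close>, one step multiplies \<open>exp (i (t S\<^sub>n / sqrt n + u Q\<^sub>n / n))\<close> on average by
  \<open>1 + g y / n\<close> to first order, where \<open>g\<close> is a cubic polynomial. The transition operator \<open>P\<close> preserves
  cubic polynomials, so \<open>g = \<lambda> + h - P h\<close> with \<open>h\<close> cubic and \<open>\<lambda>\<close> the stationary mean of \<open>g\<close>. The corrected
  expectation of \<open>exp (\<dots>) (1 + h Y\<^sub>k / n)\<close> is therefore multiplied by \<open>1 + \<lambda> / n\<close> in each step up to an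
  error \<open>o(1 / n)\<close>, and the limit is \<open>exp \<lambda>\<close>. The errors are controlled uniformly in time with
  third moments only, because \<open>Y\<^sub>k\<close> is stochastically dominated by the sum of its initial value and an
  independent stationary variable.
\<close>

section \<open>Expectations of compound distributions\<close>

text \<open>Third moments leave no room: given the previous value \<open>y\<close>, the summand of
  the score \<open>S\<close> has variance \<open>y^2 (\<alpha> (1 - \<alpha>) y + Var eps)\<close>,
  already cubic in \<open>y\<close>. The one-step error is \<open>o(1 / n)\<close> for each fixed
  \<open>y\<close> and otherwise only of order \<open>(1 + y^3) / n\<close>, so adding up
  \<open>n\<close> errors requires uniform integrability of the cubes over all times; domination by
  one integrable law gives exactly that. Treating the scaled \<open>S\<close> and \<open>Q\<close>
  together turns a central limit theorem and a law of large numbers into one statement: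
  \<open>exp \<lambda>\<close> belongs to a centered normal variable paired with a constant. The
  values conditioned on also enter the sums. The chain is therefore started at time
  \<open>N = max s1 s2\<close> from the conditional law of the value, \<open>S\<close> and
  \<open>Q\<close> at that time; the initial sums vanish after scaling. The outlier statement
  follows because the scaled error of \<open>theta_tilde\<close> is exactly minus that of
  \<open>alpha_tilde\<close> times \<open>Y\<close> at time \<open>s - 1\<close>, a constant on the
  conditioning event. Hence the rank-one covariance; the sign is absorbed by the symmetry of the
  normal law.\<close>

lemma integrable_bind_pmf_iff:
  fixes f :: "'b \<Rightarrow> 'c::{banach, second_countable_topology}"
  shows "integrable (measure_pmf (bind_pmf p k)) f \<longleftrightarrow>
    (\<integral>\<^sup>+x. (\<integral>\<^sup>+y. ennreal (norm (f y)) \<partial>measure_pmf (k x)) \<partial>measure_pmf p) < \<infinity>"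
  by (simp add: integrable_iff_bounded)

lemma integrable_pmf_nn:
  fixes f :: "'b \<Rightarrow> 'c::{banach, second_countable_topology}"
  shows "integrable (measure_pmf p) f \<longleftrightarrow> (\<integral>\<^sup>+y. ennreal (norm (f y)) \<partial>measure_pmf p) < \<infinity>"
  by (simp add: integrable_iff_bounded)

lemma AE_integrable_bind_pmf:
  fixes f :: "'b \<Rightarrow> 'c::{banach, second_countable_topology}"
  assumes "integrable (measure_pmf (bind_pmf p k)) f"
  shows "AE x in measure_pmf p. integrable (measure_pmf (k x)) f"
proof -
  have "AE x in measure_pmf p. (\<integral>\<^sup>+y. ennreal (norm (f y)) \<partial>measure_pmf (k x)) \<noteq> \<infinity>"
    using assms by (intro nn_integral_PInf_AE) (auto simp: integrable_bind_pmf_iff)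
  then show ?thesis
    by eventually_elim (simp add: integrable_pmf_nn less_top)
qed

lemma integrable_bind_pmf_inner:
  fixes f :: "'b \<Rightarrow> 'c::{banach, second_countable_topology}"
  assumes "integrable (measure_pmf (bind_pmf p k)) f"
  shows "integrable (measure_pmf p) (\<lambda>x. measure_pmf.expectation (k x) f)"
  unfolding integrable_pmf_nn
proof -
  have "(\<integral>\<^sup>+x. ennreal (norm (measure_pmf.expectation (k x) f)) \<partial>measure_pmf p)
      \<le> (\<integral>\<^sup>+x. (\<integral>\<^sup>+y. ennreal (norm (f y)) \<partial>measure_pmf (k x)) \<partial>measure_pmf p)"
  proof (intro nn_integral_mono)
    fix x
    show "ennreal (norm (measure_pmf.expectation (k x) f)) \<le> (\<integral>\<^sup>+y. ennreal (norm (f y)) \<partial>measure_pmf (k x))"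
      \<comment> \<open>Where \<open>f\<close> is not integrable under \<open>k x\<close>, its
        Bochner integral is 0 by convention, so the bound holds for every \<open>x\<close>.\<close>
      by (cases "integrable (measure_pmf (k x)) f")
         (auto intro: integral_norm_bound_ennreal simp: not_integrable_integral_eq)
  qed
  also have "\<dots> < \<infinity>" using assms by (simp add: integrable_bind_pmf_iff)
  finally show "(\<integral>\<^sup>+x. ennreal (norm (measure_pmf.expectation (k x) f)) \<partial>measure_pmf p) < \<infinity>" .
qed

lemma integral_bind_pmf_nonneg:
  fixes f :: "'b \<Rightarrow> real"
  assumes "integrable (measure_pmf (bind_pmf p k)) f" and nn: "\<And>x. f x \<ge> 0"
  shows "measure_pmf.expectation (bind_pmf p k) f = measure_pmf.expectation p (\<lambda>x. measure_pmf.expectation (k x) f)"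
proof -
  have "ennreal (measure_pmf.expectation (bind_pmf p k) f) = (\<integral>\<^sup>+x. (\<integral>\<^sup>+y. ennreal (f y) \<partial>measure_pmf (k x)) \<partial>measure_pmf p)"
    using nn_integral_eq_integral[OF assms(1)] nn by simp
  also have "\<dots> = (\<integral>\<^sup>+x. ennreal (measure_pmf.expectation (k x) f) \<partial>measure_pmf p)"
    using AE_integrable_bind_pmf[OF assms(1)]
    by (intro nn_integral_cong_AE) (auto elim!: eventually_mono intro!: nn_integral_eq_integral simp: nn)
  also have "\<dots> = ennreal (measure_pmf.expectation p (\<lambda>x. measure_pmf.expectation (k x) f))"
    by (intro nn_integral_eq_integral integrable_bind_pmf_inner assms AE_I2 Bochner_Integration.integral_nonneg nn)
  finally show ?thesis
    by (subst (asm) ennreal_inj) (auto intro!: Bochner_Integration.integral_nonneg nn)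
qed

text \<open>Splits into positive and negative parts. The integrands met along the chain grow like
  cubics, so a version for bounded functions would not do.\<close>

lemma integral_bind_pmf_real:
  fixes f :: "'b \<Rightarrow> real"
  assumes "integrable (measure_pmf (bind_pmf p k)) f"
  shows "measure_pmf.expectation (bind_pmf p k) f = measure_pmf.expectation p (\<lambda>x. measure_pmf.expectation (k x) f)"
proof -
  define g where "g = (\<lambda>x. max 0 (f x))"
  define h where "h = (\<lambda>x. max 0 (- f x))"
  have g: "integrable (measure_pmf (bind_pmf p k)) g" and h: "integrable (measure_pmf (bind_pmf p k)) h"
    using assms unfolding g_def h_def by auto
  have f: "f = (\<lambda>x. g x - h x)" by (auto simp: g_def h_def)
  have "measure_pmf.expectation (bind_pmf p k) f = measure_pmf.expectation (bind_pmf p k) g - measure_pmf.expectation (bind_pmf p k) h"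
    unfolding f using g h by simp
  also have "\<dots> = measure_pmf.expectation p (\<lambda>x. measure_pmf.expectation (k x) g) - measure_pmf.expectation p (\<lambda>x. measure_pmf.expectation (k x) h)"
    by (subst (1 2) integral_bind_pmf_nonneg) (use g h in \<open>auto simp: g_def h_def\<close>)
  also have "\<dots> = measure_pmf.expectation p (\<lambda>x. measure_pmf.expectation (k x) g - measure_pmf.expectation (k x) h)"
    using integrable_bind_pmf_inner[OF g] integrable_bind_pmf_inner[OF h] by simp
  also have "\<dots> = measure_pmf.expectation p (\<lambda>x. measure_pmf.expectation (k x) f)"
    using AE_integrable_bind_pmf[OF g] AE_integrable_bind_pmf[OF h]
    by (intro integral_cong_AE) (auto elim!: eventually_elim2 simp: f)
  finally show ?thesis .
qed

lemma integral_bind_pmf_complex: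
  fixes f :: "'b \<Rightarrow> complex"
  assumes f: "integrable (measure_pmf (bind_pmf p k)) f"
  shows "measure_pmf.expectation (bind_pmf p k) f = measure_pmf.expectation p (\<lambda>x. measure_pmf.expectation (k x) f)"
proof (rule complex_eqI)
  note i = integrable_bind_pmf_inner[OF f]
  have "Re (measure_pmf.expectation (bind_pmf p k) f) = measure_pmf.expectation p (\<lambda>x. measure_pmf.expectation (k x) (\<lambda>y. Re (f y)))"
    using f by (subst integral_bind_pmf_real[symmetric]) auto
  also have "\<dots> = measure_pmf.expectation p (\<lambda>x. Re (measure_pmf.expectation (k x) f))"
    using AE_integrable_bind_pmf[OF f] by (intro integral_cong_AE) (auto elim!: eventually_mono)
  also have "\<dots> = Re (measure_pmf.expectation p (\<lambda>x. measure_pmf.expectation (k x) f))"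
    using i by simp
  finally show "Re (measure_pmf.expectation (bind_pmf p k) f) = Re (measure_pmf.expectation p (\<lambda>x. measure_pmf.expectation (k x) f))" .
  have "Im (measure_pmf.expectation (bind_pmf p k) f) = measure_pmf.expectation p (\<lambda>x. measure_pmf.expectation (k x) (\<lambda>y. Im (f y)))"
    using f by (subst integral_bind_pmf_real[symmetric]) auto
  also have "\<dots> = measure_pmf.expectation p (\<lambda>x. Im (measure_pmf.expectation (k x) f))"
    using AE_integrable_bind_pmf[OF f] by (intro integral_cong_AE) (auto elim!: eventually_mono)
  also have "\<dots> = Im (measure_pmf.expectation p (\<lambda>x. measure_pmf.expectation (k x) f))"
    using i by simp
  finally show "Im (measure_pmf.expectation (bind_pmf p k) f) = Im (measure_pmf.expectation p (\<lambda>x. measure_pmf.expectation (k x) f))" .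
qed

lemma inar_step_0: "inar_step \<alpha> epsd 0 = epsd" if "0 \<le> \<alpha>" "\<alpha> \<le> 1"
proof -
  have "(+) (0::nat) = id" by auto
  then show ?thesis
    using that by (simp add: inar_step_def binomial_pmf_0 bind_return_pmf)
qed

text \<open>One individual is split off; it survives with probability \<alpha>, independently of the
  others. Monotonicity, contraction and all moment formulas below are inductions on the population
  size through this recursion.\<close>

lemma inar_step_Suc:
  assumes "0 \<le> \<alpha>" "\<alpha> \<le> 1"
  shows "inar_step \<alpha> epsd (Suc x) =
    bind_pmf (bernoulli_pmf \<alpha>) (\<lambda>b. map_pmf (\<lambda>y. of_bool b + y) (inar_step \<alpha> epsd x))"
  using assms unfolding inar_step_def
  by (subst binomial_pmf_Suc)
     (auto simp: bind_assoc_pmf bind_return_pmf map_bind_pmf pmf.map_comp o_def of_bool_def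
        intro!: bind_pmf_cong map_pmf_cong)

lemma nn_integral_inar_step_Suc:
  assumes "0 \<le> \<alpha>" "\<alpha> \<le> 1"
  shows "(\<integral>\<^sup>+y. f y \<partial>inar_step \<alpha> epsd (Suc x)) =
    ennreal \<alpha> * (\<integral>\<^sup>+y. f (Suc y) \<partial>inar_step \<alpha> epsd x) + ennreal (1 - \<alpha>) * (\<integral>\<^sup>+y. f y \<partial>inar_step \<alpha> epsd x)"
  using assms by (simp add: inar_step_Suc mult.commute)

lemma integrable_inar_step_Suc:
  fixes f :: "nat \<Rightarrow> 'c::{banach, second_countable_topology}"
  assumes "0 \<le> \<alpha>" "\<alpha> \<le> 1"
    and "integrable (inar_step \<alpha> epsd x) f" "integrable (inar_step \<alpha> epsd x) (\<lambda>y. f (Suc y))"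
  shows "integrable (inar_step \<alpha> epsd (Suc x)) f"
  unfolding integrable_pmf_nn nn_integral_inar_step_Suc[OF assms(1,2)]
  using assms(3,4) unfolding integrable_pmf_nn by (auto simp: ennreal_mult_less_top)

lemma expectation_inar_step_Suc:
  fixes f :: "nat \<Rightarrow> real"
  assumes "0 \<le> \<alpha>" "\<alpha> \<le> 1"
    and "integrable (inar_step \<alpha> epsd x) f" "integrable (inar_step \<alpha> epsd x) (\<lambda>y. f (Suc y))"
  shows "measure_pmf.expectation (inar_step \<alpha> epsd (Suc x)) f =
    \<alpha> * measure_pmf.expectation (inar_step \<alpha> epsd x) (\<lambda>y. f (Suc y)) + (1 - \<alpha>) * measure_pmf.expectation (inar_step \<alpha> epsd x) f"
proof -
  have "measure_pmf.expectation (inar_step \<alpha> epsd (Suc x)) f =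
    measure_pmf.expectation (bernoulli_pmf \<alpha>) (\<lambda>b. measure_pmf.expectation (map_pmf (\<lambda>y. of_bool b + y) (inar_step \<alpha> epsd x)) f)"
    using integrable_inar_step_Suc[OF assms] unfolding inar_step_Suc[OF assms(1,2)]
    by (rule integral_bind_pmf_real)
  then show ?thesis using assms(1,2) by simp
qed

section \<open>The transition operator and the stationary law\<close>

lemma integrable_pmf_bounded:
  fixes f :: "'b \<Rightarrow> 'c::{banach, second_countable_topology}"
  assumes "\<And>x. norm (f x) \<le> B"
  shows "integrable (measure_pmf p) f"
  by (rule measure_pmf.integrable_const_bound[where B = B]) (use assms in auto)

text \<open>Integrals against a pmf are sums over the counting measure, so convergence of point
  masses is enough for Fatou. It yields both the stationarity of the limit law and its finite third
  moment.\<close>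

lemma nn_integral_pmf_Fatou:
  assumes "\<And>x. (\<lambda>k. pmf (q k) x) \<longlonglongrightarrow> pmf p x"
  shows "(\<integral>\<^sup>+x. ennreal (f x) \<partial>measure_pmf p) \<le> liminf (\<lambda>k. \<integral>\<^sup>+x. ennreal (f x) \<partial>measure_pmf (q k))"
proof -
  have "(\<integral>\<^sup>+x. ennreal (f x) \<partial>measure_pmf p) = (\<integral>\<^sup>+x. liminf (\<lambda>k. ennreal (pmf (q k) x) * ennreal (f x)) \<partial>count_space UNIV)"
    unfolding nn_integral_measure_pmf
  proof (intro nn_integral_cong)
    fix x
    have "(\<lambda>k. ennreal (pmf (q k) x) * ennreal (f x)) \<longlonglongrightarrow> ennreal (pmf p x) * ennreal (f x)"
      by (intro tendsto_mult_ennreal tendsto_ennrealI assms tendsto_const) auto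
    from lim_imp_Liminf[OF _ this] show "ennreal (pmf p x) * ennreal (f x) = liminf (\<lambda>k. ennreal (pmf (q k) x) * ennreal (f x))"
      by simp
  qed
  also have "\<dots> \<le> liminf (\<lambda>k. \<integral>\<^sup>+x. ennreal (pmf (q k) x) * ennreal (f x) \<partial>count_space UNIV)"
    by (intro nn_integral_liminf) auto
  finally show ?thesis by (simp add: nn_integral_measure_pmf)
qed

lemma pow_le_cube: "j \<le> 3 \<Longrightarrow> real x ^ j \<le> 1 + real x ^ 3"
proof (cases "x = 0")
  case True then show ?thesis by (cases j) auto
next
  case False
  assume "j \<le> 3"
  with False have "real x ^ j \<le> real x ^ 3" by (intro power_increasing) auto
  then show ?thesis by simp
qed

locale inar_chain =
  fixes \<alpha> :: real and epsd :: "nat pmf"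
  assumes \<alpha>_pos: "0 < \<alpha>" and \<alpha>_less: "\<alpha> < 1"
    and eps_cube: "integrable (measure_pmf epsd) (\<lambda>x. real x ^ 3)"
    and eps_nondeg: "pmf epsd 0 < 1"
begin

abbreviation step :: "nat \<Rightarrow> nat pmf" where "step \<equiv> inar_step \<alpha> epsd"

text \<open>The transition operator in two versions: on \<open>ennreal\<close> functions for order
  arguments free of integrability conditions, and as \<open>trans\<close> on real functions for the
  contraction estimates.\<close>

definition trans_nn :: "(nat \<Rightarrow> ennreal) \<Rightarrow> nat \<Rightarrow> ennreal" where
  "trans_nn f x = (\<integral>\<^sup>+y. f y \<partial>step x)"

definition trans :: "(nat \<Rightarrow> real) \<Rightarrow> nat \<Rightarrow> real" where
  "trans f x = measure_pmf.expectation (step x) f"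

definition iter :: "nat \<Rightarrow> nat pmf \<Rightarrow> nat pmf" where
  "iter k = (\<lambda>q. bind_pmf q step) ^^ k"

lemma iter_0 [simp]: "iter 0 q = q"
  by (simp add: iter_def)

lemma iter_Suc [simp]: "iter (Suc k) q = bind_pmf (iter k q) step"
  by (simp add: iter_def)

lemma \<alpha>_le: "0 \<le> \<alpha>" "\<alpha> \<le> 1"
  using \<alpha>_pos \<alpha>_less by auto

lemma trans_nn_Suc: "trans_nn f (Suc x) = ennreal \<alpha> * trans_nn (\<lambda>y. f (Suc y)) x + ennreal (1 - \<alpha>) * trans_nn f x"
  unfolding trans_nn_def by (rule nn_integral_inar_step_Suc[OF \<alpha>_le])

lemma trans_nn_mono: "(\<And>y. f y \<le> g y) \<Longrightarrow> trans_nn f x \<le> trans_nn g x"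
  unfolding trans_nn_def by (intro nn_integral_mono) auto

lemma convex_combination_same: "ennreal \<alpha> * a + ennreal (1 - \<alpha>) * a = a"
proof -
  have "ennreal \<alpha> + ennreal (1 - \<alpha>) = 1"
    using \<alpha>_le by (subst ennreal_plus[symmetric]) auto
  then show ?thesis by (metis distrib_right mult_1)
qed

text \<open>By the splitting recursion, the value at \<open>Suc x\<close> is a convex combination of
  two numbers, each at least the value at \<open>x\<close>.\<close>

lemma mono_trans_nn: "mono f \<Longrightarrow> mono (trans_nn f)"
proof (subst mono_iff_le_Suc, intro allI)
  fix x assume f: "mono f"
  have "trans_nn f x \<le> trans_nn (\<lambda>y. f (Suc y)) x"
    by (rule trans_nn_mono) (use f in \<open>simp add: mono_iff_le_Suc\<close>)
  then have "ennreal \<alpha> * trans_nn f x + ennreal (1 - \<alpha>) * trans_nn f x \<le> trans_nn f (Suc x)"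
    unfolding trans_nn_Suc by (intro add_mono mult_left_mono) auto
  then show "trans_nn f x \<le> trans_nn f (Suc x)" by (simp add: convex_combination_same)
qed

lemma mono_trans_nn_iter: "mono f \<Longrightarrow> mono ((trans_nn ^^ k) f)"
  by (induction k) (auto intro: mono_trans_nn)

text \<open>Stochastic domination: the descendants of \<open>x\<close> extra individuals never exceed \<open>x\<close> in number.\<close>

lemma trans_nn_shift: "mono f \<Longrightarrow> trans_nn f (x + y) \<le> trans_nn (\<lambda>z. f (x + z)) y"
proof (induction x arbitrary: f)
  case (Suc x)
  have "trans_nn f (x + y) \<le> trans_nn (\<lambda>z. f (Suc z)) (x + y)"
    by (rule trans_nn_mono) (use Suc.prems in \<open>simp add: mono_iff_le_Suc\<close>)
  then have "trans_nn f (Suc x + y) \<le> ennreal \<alpha> * trans_nn (\<lambda>z. f (Suc z)) (x + y) + ennreal (1 - \<alpha>) * trans_nn (\<lambda>z. f (Suc z)) (x + y)"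
    by (simp add: trans_nn_Suc add_mono mult_left_mono)
  also have "\<dots> = trans_nn (\<lambda>z. f (Suc z)) (x + y)" by (rule convex_combination_same)
  also have "\<dots> \<le> trans_nn (\<lambda>z. f (Suc (x + z))) y"
    by (rule Suc.IH) (use Suc.prems in \<open>auto simp: mono_def\<close>)
  finally show ?case by simp
qed auto

lemma trans_nn_iter_shift: "mono f \<Longrightarrow> (trans_nn ^^ k) f (x + y) \<le> (trans_nn ^^ k) (\<lambda>z. f (x + z)) y"
proof (induction k arbitrary: y)
  case (Suc k)
  have "trans_nn ((trans_nn ^^ k) f) (x + y) \<le> trans_nn (\<lambda>z. (trans_nn ^^ k) f (x + z)) y"
    by (intro trans_nn_shift mono_trans_nn_iter Suc.prems)
  also have "\<dots> \<le> trans_nn ((trans_nn ^^ k) (\<lambda>z. f (x + z))) y"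
    by (intro trans_nn_mono Suc)
  finally show ?case by simp
qed auto

lemma nn_integral_iter: "(\<integral>\<^sup>+x. f x \<partial>iter k q) = (\<integral>\<^sup>+x. (trans_nn ^^ k) f x \<partial>q)"
proof (induction k arbitrary: f)
  case (Suc k)
  have "(\<integral>\<^sup>+x. f x \<partial>iter (Suc k) q) = (\<integral>\<^sup>+x. trans_nn f x \<partial>iter k q)"
    by (simp add: trans_nn_def)
  also have "\<dots> = (\<integral>\<^sup>+x. (trans_nn ^^ Suc k) f x \<partial>q)"
    by (simp only: Suc funpow_Suc_right o_apply)
  finally show ?case .
qed auto

section \<open>Contraction of the transition operator and convergence from the empty
  population\<close>

lemma trans_bound:
  assumes "\<And>y. \<bar>f y\<bar> \<le> B" shows "\<bar>trans f x\<bar> \<le> B"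
proof -
  have i: "integrable (measure_pmf (step x)) f"
    by (rule integrable_pmf_bounded) (use assms in auto)
  have "\<bar>trans f x\<bar> \<le> measure_pmf.expectation (step x) (\<lambda>y. \<bar>f y\<bar>)"
    unfolding trans_def by (rule integral_abs_bound)
  also have "\<dots> \<le> measure_pmf.expectation (step x) (\<lambda>y. B)"
    using i assms by (intro integral_mono) auto
  finally show ?thesis by simp
qed

text \<open>Populations \<open>x\<close> and \<open>Suc x\<close> differ by one individual, which
  matters only if it survives; hence the contraction factor \<alpha> for the discrete Lipschitz
  constant.\<close>

lemma trans_lipschitz:
  assumes "\<And>y. \<bar>f y\<bar> \<le> B" "\<And>y. \<bar>f (Suc y) - f y\<bar> \<le> c"
  shows "\<bar>trans f (Suc x) - trans f x\<bar> \<le> \<alpha> * c"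
proof -
  have i: "integrable (measure_pmf q) f" "integrable (measure_pmf q) (\<lambda>y. f (Suc y))" for q
    using assms(1) by (auto intro!: integrable_pmf_bounded[where B = B])
  have "trans f (Suc x) - trans f x = \<alpha> * (measure_pmf.expectation (step x) (\<lambda>y. f (Suc y)) - measure_pmf.expectation (step x) f)"
    unfolding trans_def by (subst expectation_inar_step_Suc) (use i \<alpha>_le in \<open>auto simp: algebra_simps\<close>)
  also have "measure_pmf.expectation (step x) (\<lambda>y. f (Suc y)) - measure_pmf.expectation (step x) f = trans (\<lambda>y. f (Suc y) - f y) x"
    unfolding trans_def using i by simp
  finally show ?thesis
    using trans_bound[of "\<lambda>y. f (Suc y) - f y" c x] assms(2) \<alpha>_le by (auto simp: abs_mult intro!: mult_left_mono)
qed

lemma trans_iter: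
  assumes "\<And>y. \<bar>f y\<bar> \<le> B" "\<And>y. \<bar>f (Suc y) - f y\<bar> \<le> c"
  shows "\<bar>(trans ^^ k) f x\<bar> \<le> B" "\<bar>(trans ^^ k) f (Suc x) - (trans ^^ k) f x\<bar> \<le> \<alpha> ^ k * c"
proof -
  have "\<forall>x. \<bar>(trans ^^ k) f x\<bar> \<le> B \<and> \<bar>(trans ^^ k) f (Suc x) - (trans ^^ k) f x\<bar> \<le> \<alpha> ^ k * c"
    using assms by (induction k) (auto simp: mult.assoc intro!: trans_bound trans_lipschitz)
  then show "\<bar>(trans ^^ k) f x\<bar> \<le> B" "\<bar>(trans ^^ k) f (Suc x) - (trans ^^ k) f x\<bar> \<le> \<alpha> ^ k * c" by auto
qed

lemma trans_iter_diff:
  assumes "\<And>y. \<bar>f y\<bar> \<le> B" "\<And>y. \<bar>f (Suc y) - f y\<bar> \<le> c"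
  shows "\<bar>(trans ^^ k) f x - (trans ^^ k) f 0\<bar> \<le> \<alpha> ^ k * c * real x"
proof (induction x)
  case (Suc x)
  have "\<bar>(trans ^^ k) f (Suc x) - (trans ^^ k) f x\<bar> \<le> \<alpha> ^ k * c" by (rule trans_iter) fact+
  then have "\<bar>(trans ^^ k) f (Suc x) - (trans ^^ k) f 0\<bar> \<le> \<alpha> ^ k * c + \<alpha> ^ k * c * real x"
    using Suc by linarith
  then show ?case by (simp add: algebra_simps)
qed auto

lemma expectation_iter:
  assumes "\<And>y. \<bar>f y\<bar> \<le> B"
  shows "measure_pmf.expectation (iter k q) f = measure_pmf.expectation q ((trans ^^ k) f)"
  using assms
proof (induction k arbitrary: f)
  case (Suc k)
  have "measure_pmf.expectation (iter (Suc k) q) f = measure_pmf.expectation (iter k q) (trans f)"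
    unfolding iter_Suc trans_def
    by (rule integral_bind_pmf_real) (use Suc.prems in \<open>auto intro!: integrable_pmf_bounded\<close>)
  also have "\<dots> = measure_pmf.expectation q ((trans ^^ k) (trans f))"
    by (rule Suc.IH) (use trans_bound[of f B] Suc.prems in auto)
  finally show ?case by (simp only: funpow_Suc_right o_apply)
qed auto

lemma eps_pow_integrable: "j \<le> 3 \<Longrightarrow> integrable (measure_pmf epsd) (\<lambda>x. real x ^ j)"
proof (rule Bochner_Integration.integrable_bound)
  show "integrable (measure_pmf epsd) (\<lambda>x. 1 + real x ^ 3)" using eps_cube by auto
  assume "j \<le> 3"
  then show "AE x in measure_pmf epsd. norm (real x ^ j) \<le> norm (1 + real x ^ 3)"
    using pow_le_cube[of j] by auto
qed auto

definition e1 :: real where "e1 = measure_pmf.expectation epsd real"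
definition e2 :: real where "e2 = measure_pmf.expectation epsd (\<lambda>x. real x ^ 2)"
definition e3 :: real where "e3 = measure_pmf.expectation epsd (\<lambda>x. real x ^ 3)"

lemma e_nonneg: "0 \<le> e1" "0 \<le> e2" "0 \<le> e3"
  unfolding e1_def e2_def e3_def by (auto intro!: Bochner_Integration.integral_nonneg)

lemma eps_integrable: "integrable (measure_pmf epsd) real"
  using eps_pow_integrable[of 1] by simp

text \<open>From the empty population one step has law \<open>epsd\<close>. Running one step longer
  thus means starting from an \<open>epsd\<close>-distributed population instead of 0, at average
  distance \<open>e1\<close>.\<close>

lemma trans_iter_step:
  assumes "\<And>y. \<bar>f y\<bar> \<le> B" "\<And>y. \<bar>f (Suc y) - f y\<bar> \<le> c"
  shows "\<bar>(trans ^^ Suc k) f 0 - (trans ^^ k) f 0\<bar> \<le> \<alpha> ^ k * c * e1"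
proof -
  let ?g = "(trans ^^ k) f"
  have i: "integrable (measure_pmf epsd) ?g"
    using trans_iter(1)[of f B c, OF assms] by (intro integrable_pmf_bounded[where B = B]) (metis real_norm_def)
  have "(trans ^^ Suc k) f 0 - ?g 0 = measure_pmf.expectation epsd (\<lambda>x. ?g x - ?g 0)"
    using i by (simp add: trans_def inar_step_0 \<alpha>_le)
  also have "\<bar>\<dots>\<bar> \<le> measure_pmf.expectation epsd (\<lambda>x. \<bar>?g x - ?g 0\<bar>)"
    by (rule integral_abs_bound)
  also have "\<dots> \<le> measure_pmf.expectation epsd (\<lambda>x. \<alpha> ^ k * c * real x)"
  proof (intro integral_mono)
    show "\<bar>?g x - ?g 0\<bar> \<le> \<alpha> ^ k * c * real x" for x by (rule trans_iter_diff) fact+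
  qed (use i eps_integrable in auto)
  finally show ?thesis by (simp add: e1_def)
qed

lemma trans_iter_Cauchy:
  assumes "\<And>y. \<bar>f y\<bar> \<le> B" "\<And>y. \<bar>f (Suc y) - f y\<bar> \<le> 1"
  shows "\<bar>(trans ^^ (k + j)) f 0 - (trans ^^ k) f 0\<bar> \<le> \<alpha> ^ k * (e1 / (1 - \<alpha>))"
proof -
  \<comment> \<open>The exact partial geometric sum is kept so that the induction on
    \<open>j\<close> closes.\<close>
  have "\<bar>(trans ^^ (k + j)) f 0 - (trans ^^ k) f 0\<bar> \<le> (\<alpha> ^ k - \<alpha> ^ (k + j)) * (e1 / (1 - \<alpha>))"
  proof (induction j)
    case (Suc j)
    have "\<bar>(trans ^^ Suc (k + j)) f 0 - (trans ^^ (k + j)) f 0\<bar> \<le> \<alpha> ^ (k + j) * 1 * e1"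
      by (rule trans_iter_step) fact+
    then have "\<bar>(trans ^^ (k + Suc j)) f 0 - (trans ^^ k) f 0\<bar> \<le> \<alpha> ^ (k + j) * e1 + (\<alpha> ^ k - \<alpha> ^ (k + j)) * (e1 / (1 - \<alpha>))"
      using Suc by simp
    also have "\<dots> = (\<alpha> ^ k - \<alpha> ^ (k + Suc j)) * (e1 / (1 - \<alpha>))"
      using \<alpha>_less by (simp add: field_simps)
    finally show ?case .
  qed auto
  also have "\<dots> \<le> \<alpha> ^ k * (e1 / (1 - \<alpha>))"
    using \<alpha>_pos \<alpha>_less e_nonneg by (intro mult_right_mono) auto
  finally show ?thesis .
qed

lemma trans_iter_limit:
  assumes "\<And>y. \<bar>f y\<bar> \<le> B" "\<And>y. \<bar>f (Suc y) - f y\<bar> \<le> 1"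
  obtains l where "(\<lambda>k. (trans ^^ k) f 0) \<longlonglongrightarrow> l" "\<And>k. \<bar>l - (trans ^^ k) f 0\<bar> \<le> \<alpha> ^ k * (e1 / (1 - \<alpha>))"
proof -
  let ?r = "\<lambda>k. (trans ^^ k) f 0"
  note C = trans_iter_Cauchy[of f B, OF assms]
  have z: "(\<lambda>k. \<alpha> ^ k * (e1 / (1 - \<alpha>))) \<longlonglongrightarrow> 0"
    using \<alpha>_pos \<alpha>_less by (intro tendsto_mult_left_zero LIMSEQ_realpow_zero) auto
  have "Cauchy ?r"
  proof (rule metric_CauchyI)
    fix e :: real assume "e > 0"
    then have "\<forall>\<^sub>F k in sequentially. \<alpha> ^ k * (e1 / (1 - \<alpha>)) < e / 2"
      using order_tendstoD(2)[OF z, of "e/2"] by simp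
    then obtain k where k: "\<alpha> ^ k * (e1 / (1 - \<alpha>)) < e / 2"
      unfolding eventually_sequentially by blast
    show "\<exists>M. \<forall>m\<ge>M. \<forall>n\<ge>M. dist (?r m) (?r n) < e"
    proof (intro exI[of _ k] allI impI)
      fix m n assume "m \<ge> k" "n \<ge> k"
      then obtain i j where mn: "m = k + i" "n = k + j" by (metis le_Suc_ex)
      show "dist (?r m) (?r n) < e" unfolding mn using C[of k i] C[of k j] k unfolding dist_real_def by linarith
    qed
  qed
  then obtain l where l: "?r \<longlonglongrightarrow> l" using real_Cauchy_convergent unfolding convergent_def by blast
  have "\<bar>l - ?r k\<bar> \<le> \<alpha> ^ k * (e1 / (1 - \<alpha>))" for k
  proof (rule LIMSEQ_le_const2)
    show "(\<lambda>j. \<bar>?r (k + j) - ?r k\<bar>) \<longlonglongrightarrow> \<bar>l - ?r k\<bar>"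
      using LIMSEQ_ignore_initial_segment[OF l, of k] by (intro tendsto_intros) (simp add: add.commute)
  qed (use C in auto)
  with l show ?thesis using that by blast
qed

text \<open>All indicators have Lipschitz constant 1, so for the chain from 0 the probabilities of
  all sets \<open>S\<close> converge at the common rate \<open>E k\<close>. This uniformity in
  \<open>S\<close> keeps mass from escaping to infinity.\<close>

lemma stationary_exists:
  obtains p where "inar_stationary \<alpha> epsd p" "\<And>x. (\<lambda>k. pmf (iter k (return_pmf 0)) x) \<longlonglongrightarrow> pmf p x"
proof -
  define q where "q = (\<lambda>k. iter k (return_pmf (0::nat)))"
  define E where "E = (\<lambda>k. \<alpha> ^ k * (e1 / (1 - \<alpha>)))"
  have m: "measure (measure_pmf (q k)) S = (trans ^^ k) (indicator S) 0" for k S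
    using expectation_iter[of "indicator S" 1 k "return_pmf 0"] by (simp add: q_def)
  have "\<exists>l. (\<lambda>k. measure (measure_pmf (q k)) S) \<longlonglongrightarrow> l \<and> (\<forall>k. \<bar>l - measure (measure_pmf (q k)) S\<bar> \<le> E k)" for S
    using trans_iter_limit[of "indicator S" 1] unfolding m E_def
    by (metis (no_types, lifting) abs_le_D1 abs_numeral abs_zero diff_0 diff_self diff_zero indicator_simps abs_1 abs_minus_cancel order_refl zero_le_one)
  then obtain a where a: "\<And>S. (\<lambda>k. measure (measure_pmf (q k)) S) \<longlonglongrightarrow> a S" 
      and aE: "\<And>S k. \<bar>a S - measure (measure_pmf (q k)) S\<bar> \<le> E k"
    by metis
  define P where "P = (\<lambda>x. a {x})"
  have P_lim: "(\<lambda>k. pmf (q k) x) \<longlonglongrightarrow> P x" for x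
    using a[of "{x}"] by (simp add: P_def measure_pmf_single)
  have P_nonneg: "P x \<ge> 0" for x
    using P_lim[of x] by (rule LIMSEQ_le_const) auto
  have aF: "a {..<n} = sum P {..<n}" for n
  proof (rule LIMSEQ_unique[OF a])
    show "(\<lambda>k. measure (measure_pmf (q k)) {..<n}) \<longlonglongrightarrow> sum P {..<n}"
      using P_lim by (subst measure_measure_pmf_finite) (auto intro!: tendsto_sum)
  qed
  have E0: "E \<longlonglongrightarrow> 0" unfolding E_def
    using \<alpha>_pos \<alpha>_less by (intro tendsto_mult_left_zero LIMSEQ_realpow_zero) auto
  \<comment> \<open>A fixed \<open>q k\<close> with \<open>E k < r / 2\<close> has nearly all its
    mass on some \<open>{..<n0}\<close>, and the limit differs from it by at most \<open>E k\<close>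
    on every set.\<close>
  have "P sums 1"
    unfolding sums_def aF[symmetric]
  proof (rule LIMSEQ_I)
    fix r :: real assume r: "r > 0"
    obtain k where k: "E k < r / 2"
      using order_tendstoD(2)[OF E0, of "r/2"] r unfolding eventually_sequentially by auto
    have "(\<lambda>n. measure (measure_pmf (q k)) {..<n}) \<longlonglongrightarrow> measure (measure_pmf (q k)) (\<Union>n. {..<n})"
      by (intro measure_pmf.finite_Lim_measure_incseq) (auto simp: incseq_def)
    moreover have "(\<Union>n. {..<n}) = (UNIV :: nat set)" by auto
    ultimately have "(\<lambda>n. measure (measure_pmf (q k)) {..<n}) \<longlonglongrightarrow> 1"
      using measure_pmf.prob_space[of "q k"] by simp
    from order_tendstoD(1)[OF this, of "1 - r/2"] r
    obtain n0 where n0: "\<And>n. n \<ge> n0 \<Longrightarrow> measure (measure_pmf (q k)) {..<n} > 1 - r/2"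
      unfolding eventually_sequentially by auto
    show "\<exists>n0. \<forall>n\<ge>n0. norm (a {..<n} - 1) < r"
    proof (intro exI[of _ n0] allI impI)
      fix n assume "n \<ge> n0"
      have "a {..<n} \<le> 1" by (rule LIMSEQ_le_const2[OF a]) auto
      then show "norm (a {..<n} - 1) < r" using n0[OF \<open>n \<ge> n0\<close>] aE[of "{..<n}" k] k by simp
    qed
  qed
  from suminf_ennreal_eq[OF P_nonneg this] have "(\<integral>\<^sup>+x. ennreal (P x) \<partial>count_space UNIV) = 1"
    unfolding nn_integral_count_space_nat by simp
  then have pmf_P: "pmf (embed_pmf P) x = P x" for x
    using P_nonneg by (intro pmf_embed_pmf) auto
  let ?p = "embed_pmf P"
  have lim: "(\<lambda>k. pmf (q k) x) \<longlonglongrightarrow> pmf ?p x" for x using P_lim pmf_P by simp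
  have "inar_stationary \<alpha> epsd ?p"
    unfolding inar_stationary_def
  \<comment> \<open>Fatou gives only one inequality between point masses. It suffices, because two
    different probability mass functions exceed each other somewhere.\<close>
  proof (rule ccontr)
    assume "bind_pmf ?p step \<noteq> ?p"
    then obtain y where y: "pmf ?p y < pmf (bind_pmf ?p step) y"
      using pmf_neq_exists_less by metis
    have "ennreal (pmf (bind_pmf ?p step) y) \<le> liminf (\<lambda>k. \<integral>\<^sup>+x. ennreal (pmf (step x) y) \<partial>measure_pmf (q k))"
      unfolding ennreal_pmf_bind by (rule nn_integral_pmf_Fatou) (rule lim)
    also have "\<dots> = liminf (\<lambda>k. ennreal (pmf (q (Suc k)) y))"
      unfolding ennreal_pmf_bind[symmetric] q_def iter_Suc ..
    also have "\<dots> = ennreal (pmf ?p y)"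
      by (intro lim_imp_Liminf tendsto_ennrealI LIMSEQ_Suc lim) auto
    finally show False using y by (simp add: ennreal_le_iff)
  qed
  with lim show ?thesis using that unfolding q_def by blast
qed

lemma stationary_iter: "inar_stationary \<alpha> epsd p \<Longrightarrow> iter k p = p"
  by (induction k) (auto simp: inar_stationary_def)

text \<open>A stationary law is the average of the chain over its starting points, and by
  contraction the starting point is forgotten. Every stationary law is therefore the limit from 0,
  which gives uniqueness and makes the \<open>THE\<close> in \<open>inar_stat_dist\<close>
  meaningful.\<close>

lemma stationary_limit:
  assumes p: "inar_stationary \<alpha> epsd p"
  shows "(\<lambda>k. (trans ^^ k) (indicator {x}) 0) \<longlonglongrightarrow> pmf p x"
proof -
  let ?f = "\<lambda>k. (trans ^^ k) (indicator {x})"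
  have b: "\<bar>indicator {x} y\<bar> \<le> (1::real)" "\<bar>indicator {x} (Suc y) - indicator {x} y\<bar> \<le> (1::real)" for y :: nat
    by (auto simp: indicator_def)
  have B: "\<bar>?f k y\<bar> \<le> 1" for k y by (rule trans_iter(1)[of "indicator {x}" 1 1, OF b])
  have i: "integrable (measure_pmf p) (?f k)" for k
    using B by (intro integrable_pmf_bounded[where B = 1]) auto
  have "(\<lambda>k. measure_pmf.expectation p (\<lambda>y. ?f k y - ?f k 0)) \<longlonglongrightarrow> measure_pmf.expectation p (\<lambda>y. 0)"
  proof (rule integral_dominated_convergence[where w = "\<lambda>_. 2"])
    show "AE y in measure_pmf p. (\<lambda>k. ?f k y - ?f k 0) \<longlonglongrightarrow> 0"
    proof (intro AE_I2)
      fix y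
      have "(\<lambda>k. \<alpha> ^ k * 1 * real y) \<longlonglongrightarrow> 0"
        using \<alpha>_pos \<alpha>_less by (intro tendsto_mult_left_zero LIMSEQ_realpow_zero) auto
      then show "(\<lambda>k. ?f k y - ?f k 0) \<longlonglongrightarrow> 0"
      proof (rule Lim_null_comparison[rotated])
        show "\<forall>\<^sub>F k in sequentially. norm (?f k y - ?f k 0) \<le> \<alpha> ^ k * 1 * real y"
          using trans_iter_diff[of "indicator {x}" 1 1, OF b] by (intro always_eventually allI) (metis real_norm_def)
      qed
    qed
    show "AE y in measure_pmf p. norm (?f k y - ?f k 0) \<le> 2" for k
    proof (intro AE_I2)
      fix y
      show "norm (?f k y - ?f k 0) \<le> 2" using B[of k y] B[of k 0] unfolding real_norm_def by linarith
    qed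
  qed auto
  moreover have "measure_pmf.expectation p (\<lambda>y. ?f k y - ?f k 0) = pmf p x - ?f k 0" for k
  proof -
    have "measure_pmf.expectation p (?f k) = measure_pmf.expectation (iter k p) (indicator {x})"
      by (rule expectation_iter[symmetric]) (rule b)
    then show ?thesis using i[of k] by (simp add: stationary_iter[OF p] measure_pmf_single)
  qed
  ultimately have "(\<lambda>k. pmf p x - ?f k 0) \<longlonglongrightarrow> 0" by simp
  from tendsto_diff[OF tendsto_const[of "pmf p x"] this] show ?thesis by simp
qed

lemma stationary_unique: "inar_stationary \<alpha> epsd p \<Longrightarrow> inar_stationary \<alpha> epsd p' \<Longrightarrow> p = p'"
  by (rule pmf_eqI) (blast intro: LIMSEQ_unique stationary_limit)

definition pst :: "nat pmf" where "pst = inar_stat_dist \<alpha> epsd"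

lemma stationary_pst: "inar_stationary \<alpha> epsd pst"
  unfolding pst_def inar_stat_dist_def
  by (rule theI') (metis stationary_exists stationary_unique)

lemma pst_bind: "bind_pmf pst step = pst"
  using stationary_pst by (simp add: inar_stationary_def)

lemma pst_limit: "(\<lambda>k. pmf (iter k (return_pmf 0)) x) \<longlonglongrightarrow> pmf pst x"
  by (metis stationary_exists stationary_unique stationary_pst)

text \<open>The initial \<open>x\<close> is moved outside by the shift inequality; the remaining
  start 0 is raised to a stationary start by monotonicity, and that one stays stationary. The bound
  does not depend on \<open>k\<close>.\<close>

lemma trans_nn_iter_le_pst:
  assumes "mono f" shows "(trans_nn ^^ k) f x \<le> (\<integral>\<^sup>+y. f (x + y) \<partial>pst)"
proof -
  have m: "mono (\<lambda>y. f (x + y))" using assms by (auto simp: mono_def)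
  have "(trans_nn ^^ k) f x \<le> (trans_nn ^^ k) (\<lambda>y. f (x + y)) 0"
    using trans_nn_iter_shift[OF assms, of k x 0] by simp
  also have "\<dots> = (\<integral>\<^sup>+y. (trans_nn ^^ k) (\<lambda>y. f (x + y)) 0 \<partial>pst)" by simp
  also have "\<dots> \<le> (\<integral>\<^sup>+y. (trans_nn ^^ k) (\<lambda>y. f (x + y)) y \<partial>pst)"
    by (intro nn_integral_mono) (use mono_trans_nn_iter[OF m] in \<open>auto simp: mono_def\<close>)
  also have "\<dots> = (\<integral>\<^sup>+y. f (x + y) \<partial>pst)"
    by (simp add: nn_integral_iter[symmetric] stationary_iter[OF stationary_pst])
  finally show ?thesis .
qed

section \<open>Moments\<close>

lemma step_pow_integrable: "j \<le> 3 \<Longrightarrow> integrable (measure_pmf (step x)) (\<lambda>y. real y ^ j)"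
proof (induction x arbitrary: j)
  case 0
  then show ?case using eps_pow_integrable by (simp add: inar_step_0 \<alpha>_le)
next
  case (Suc x)
  have i: "integrable (measure_pmf (step x)) real" "integrable (measure_pmf (step x)) (\<lambda>y. real y ^ 2)"
    "integrable (measure_pmf (step x)) (\<lambda>y. real y ^ 3)"
    using Suc.IH[of 1] Suc.IH[of 2] Suc.IH[of 3] by auto
  have "j = 0 \<or> j = 1 \<or> j = 2 \<or> j = 3" using Suc.prems by auto
  then have "integrable (measure_pmf (step x)) (\<lambda>y. real (Suc y) ^ j)"
  proof (elim disjE)
    assume "j = 2"
    moreover have "real (Suc y) ^ 2 = real y ^ 2 + 2 * real y + 1" for y
      by (simp add: power2_eq_square algebra_simps)
    ultimately show ?thesis using i by simp
  next
    assume "j = 3"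
    moreover have "real (Suc y) ^ 3 = real y ^ 3 + 3 * real y ^ 2 + 3 * real y + 1" for y
      by (simp add: power3_eq_cube power2_eq_square algebra_simps)
    ultimately show ?thesis using i by simp
  qed (use i in auto)
  then show ?case
    using Suc.IH[OF Suc.prems] by (intro integrable_inar_step_Suc \<alpha>_le) auto
qed

lemma step_integrable:
  "integrable (measure_pmf (step x)) real" "integrable (measure_pmf (step x)) (\<lambda>y. real y ^ 2)"
  "integrable (measure_pmf (step x)) (\<lambda>y. real y ^ 3)"
  using step_pow_integrable[of 1] step_pow_integrable[of 2] step_pow_integrable[of 3] by auto

lemma step_mean: "measure_pmf.expectation (step x) real = \<alpha> * real x + e1"
proof (induction x)
  case 0 then show ?case by (simp add: inar_step_0 \<alpha>_le e1_def)
next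
  case (Suc x)
  have "measure_pmf.expectation (step (Suc x)) real = 
    \<alpha> * (measure_pmf.expectation (step x) (\<lambda>y. real y + 1)) + (1 - \<alpha>) * measure_pmf.expectation (step x) real"
    by (subst expectation_inar_step_Suc) (use \<alpha>_le step_integrable[of x] in \<open>auto simp: add.commute\<close>)
  then show ?case using step_integrable[of x] Suc by (simp add: algebra_simps)
qed

definition b1 :: real where "b1 = \<alpha> * (1 - \<alpha>) + 2 * \<alpha> * e1"
definition c2 :: real where "c2 = 3 * \<alpha>\<^sup>2 * (1 - \<alpha>) + 3 * \<alpha>\<^sup>2 * e1"
text \<open>Forced by population 1: \<open>\<alpha> ^ 3 + c2 + c1\<close> must be
  \<open>\<alpha> * (3 * e2 + 3 * e1 + 1)\<close>, the increase of the conditional third moment when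
  the first individual is added.\<close>

definition c1 :: real where "c1 = \<alpha> * (3 * e2 + 3 * e1 + 1) - \<alpha> ^ 3 - c2"

lemma step_moment2: "measure_pmf.expectation (step x) (\<lambda>y. real y ^ 2) = \<alpha>\<^sup>2 * real x ^ 2 + b1 * real x + e2"
proof (induction x)
  case 0 then show ?case by (simp add: inar_step_0 \<alpha>_le e2_def)
next
  case (Suc x)
  have eq: "real (Suc y) ^ 2 = real y ^ 2 + 2 * real y + 1" for y
    by (simp add: power2_eq_square algebra_simps)
  have "measure_pmf.expectation (step (Suc x)) (\<lambda>y. real y ^ 2) = 
    \<alpha> * (measure_pmf.expectation (step x) (\<lambda>y. real y ^ 2 + 2 * real y + 1)) + (1 - \<alpha>) * measure_pmf.expectation (step x) (\<lambda>y. real y ^ 2)"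
    unfolding eq[symmetric]
    by (subst expectation_inar_step_Suc) (use \<alpha>_le step_integrable[of x] eq in auto)
  also have "measure_pmf.expectation (step x) (\<lambda>y. real y ^ 2 + 2 * real y + 1) =
      measure_pmf.expectation (step x) (\<lambda>y. real y ^ 2) + 2 * (\<alpha> * real x + e1) + 1"
    using step_integrable[of x] step_mean[of x] by simp
  finally show ?case unfolding Suc by (simp add: b1_def power2_eq_square algebra_simps)
qed

lemma step_moment3:
  "measure_pmf.expectation (step x) (\<lambda>y. real y ^ 3) = \<alpha> ^ 3 * real x ^ 3 + c2 * real x ^ 2 + c1 * real x + e3"
proof (induction x)
  case 0 then show ?case by (simp add: inar_step_0 \<alpha>_le e3_def)
next
  case (Suc x)
  have eq: "real (Suc y) ^ 3 = real y ^ 3 + 3 * real y ^ 2 + 3 * real y + 1" for y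
    by (simp add: power3_eq_cube power2_eq_square algebra_simps)
  have "measure_pmf.expectation (step (Suc x)) (\<lambda>y. real y ^ 3) = 
    \<alpha> * (measure_pmf.expectation (step x) (\<lambda>y. real y ^ 3 + 3 * real y ^ 2 + 3 * real y + 1)) + (1 - \<alpha>) * measure_pmf.expectation (step x) (\<lambda>y. real y ^ 3)"
    unfolding eq[symmetric]
    by (subst expectation_inar_step_Suc) (use \<alpha>_le step_integrable[of x] eq in auto)
  also have "measure_pmf.expectation (step x) (\<lambda>y. real y ^ 3 + 3 * real y ^ 2 + 3 * real y + 1) =
      measure_pmf.expectation (step x) (\<lambda>y. real y ^ 3) + 3 * (\<alpha>\<^sup>2 * real x ^ 2 + b1 * real x + e2) + 3 * (\<alpha> * real x + e1) + 1"
    using step_integrable[of x] step_mean[of x] step_moment2[of x] by simp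
  finally show ?case unfolding Suc
    by (simp add: b1_def c1_def c2_def power2_eq_square power3_eq_cube algebra_simps)
qed

definition s2 :: real where "s2 = e2 - e1\<^sup>2"

lemma s2_eq_variance: "s2 = measure_pmf.variance epsd real"
  unfolding s2_def e1_def e2_def
  by (subst measure_pmf.variance_eq) (use eps_pow_integrable[of 1] eps_pow_integrable[of 2] in auto)

lemma s2_nonneg: "0 \<le> s2"
  unfolding s2_eq_variance by (intro Bochner_Integration.integral_nonneg) auto

definition step_var :: "nat \<Rightarrow> real" where "step_var x = \<alpha> * (1 - \<alpha>) * real x + s2"

definition residual :: "nat \<Rightarrow> nat \<Rightarrow> real" where "residual x y = real y - \<alpha> * real x - e1"

lemma residual_integrable: "integrable (measure_pmf (step x)) (residual x)"
  unfolding residual_def using step_integrable[of x] by auto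

lemma residual_mean: "measure_pmf.expectation (step x) (residual x) = 0"
  unfolding residual_def using step_integrable[of x] step_mean[of x] by simp

lemma residual_sq: "(residual x y)\<^sup>2 = real y ^ 2 - 2 * (\<alpha> * real x + e1) * real y + (\<alpha> * real x + e1)\<^sup>2"
  unfolding residual_def by (simp add: power2_eq_square algebra_simps)

lemma residual_sq_integrable: "integrable (measure_pmf (step x)) (\<lambda>y. (residual x y)\<^sup>2)"
  unfolding residual_sq using step_integrable[of x] by simp

lemma residual_sq_mean: "measure_pmf.expectation (step x) (\<lambda>y. (residual x y)\<^sup>2) = step_var x"
proof -
  have "measure_pmf.expectation (step x) (\<lambda>y. (residual x y)\<^sup>2) =
      measure_pmf.expectation (step x) (\<lambda>y. real y ^ 2) - 2 * (\<alpha> * real x + e1) * measure_pmf.expectation (step x) real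
      + (\<alpha> * real x + e1)\<^sup>2"
    unfolding residual_sq using step_integrable[of x] by simp
  then show ?thesis
    unfolding step_mean step_moment2 step_var_def s2_def b1_def by (simp add: power2_eq_square algebra_simps)
qed

text \<open>Since \<open>\<alpha> ^ 3 < \<alpha>\<close>, the surplus
  \<open>(\<alpha> - \<alpha> ^ 3) x^3\<close> absorbs the lower terms for large \<open>x\<close>: a
  Foster-Lyapunov condition for the cube.\<close>

lemma cubic_drift: obtains D where "D \<ge> 0" 
  "\<And>x::nat. \<alpha> ^ 3 * real x ^ 3 + c2 * real x ^ 2 + c1 * real x + e3 \<le> \<alpha> * real x ^ 3 + D"
proof -
  define d where "d = \<alpha> - \<alpha> ^ 3"
  define s where "s = \<bar>c2\<bar> + \<bar>c1\<bar>"
  have d: "d > 0" unfolding d_def using \<alpha>_pos \<alpha>_less power_strict_decreasing[of 1 3 \<alpha>] by auto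
  show ?thesis
  \<comment> \<open>\<open>s / d\<close> is the threshold: beyond it \<open>d x^3\<close> exceeds
    \<open>s x^2\<close>, below it \<open>s x^2\<close> is at most
    \<open>s (s / d)^2\<close>.\<close>
  proof (rule that[of "s * (s / d)\<^sup>2 + e3"])
    show "0 \<le> s * (s / d)\<^sup>2 + e3" using e_nonneg by (auto simp: s_def)
    fix x :: nat
    have sx: "c2 * real x ^ 2 + c1 * real x \<le> s * real x ^ 2"
    proof -
      have "real x \<le> real x ^ 2" by (cases x) (auto simp: power2_eq_square)
      then have "c1 * real x \<le> \<bar>c1\<bar> * real x ^ 2" by (intro mult_mono) auto
      moreover have "c2 * real x ^ 2 \<le> \<bar>c2\<bar> * real x ^ 2" by (intro mult_right_mono) auto
      ultimately show ?thesis by (simp add: s_def algebra_simps)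
    qed
    have "s * real x ^ 2 \<le> d * real x ^ 3 + s * (s / d)\<^sup>2"
    proof (cases "s \<le> d * real x")
      case True
      then have "s * real x ^ 2 \<le> (d * real x) * real x ^ 2" by (intro mult_right_mono) auto
      also have "\<dots> = d * real x ^ 3" by (simp add: power2_eq_square power3_eq_cube)
      also have "\<dots> \<le> d * real x ^ 3 + s * (s / d)\<^sup>2" by (simp add: s_def)
      finally show ?thesis .
    next
      case False
      then have "real x \<le> s / d" using d by (simp add: field_simps)
      then have "s * real x ^ 2 \<le> s * (s / d)\<^sup>2" by (intro mult_left_mono power_mono) (auto simp: s_def)
      moreover have "0 \<le> d * real x ^ 3" using d by auto
      ultimately show ?thesis by linarith
    qed
    with sx show "\<alpha> ^ 3 * real x ^ 3 + c2 * real x ^ 2 + c1 * real x + e3 \<le> \<alpha> * real x ^ 3 + (s * (s / d)\<^sup>2 + e3)"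
      by (simp add: d_def algebra_simps)
  qed
qed

text \<open>Stationarity alone could hold with an infinite third moment on both sides. The chain
  from 0 instead stays below \<open>D / (1 - \<alpha>)\<close>, the fixed point of
  \<open>m \<mapsto> \<alpha> m + D\<close>, and Fatou carries this bound to the limit.\<close>

lemma pst_cube: "integrable (measure_pmf pst) (\<lambda>x. real x ^ 3)"
proof -
  obtain D where D: "D \<ge> 0" "\<And>x::nat. \<alpha> ^ 3 * real x ^ 3 + c2 * real x ^ 2 + c1 * real x + e3 \<le> \<alpha> * real x ^ 3 + D"
    using cubic_drift by blast
  have PN3: "trans_nn (\<lambda>x. ennreal (real x ^ 3)) x \<le> ennreal \<alpha> * ennreal (real x ^ 3) + ennreal D" for x
  proof -
    have "trans_nn (\<lambda>x. ennreal (real x ^ 3)) x = ennreal (measure_pmf.expectation (step x) (\<lambda>y. real y ^ 3))"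
      unfolding trans_nn_def using step_integrable[of x] by (intro nn_integral_eq_integral) auto
    also have "\<dots> \<le> ennreal (\<alpha> * real x ^ 3 + D)"
      unfolding step_moment3 using D by (intro ennreal_leI) auto
    finally show ?thesis using \<alpha>_le D by (simp add: ennreal_plus ennreal_mult)
  qed
  define q where "q = (\<lambda>k. iter k (return_pmf (0::nat)))"
  have b: "(\<integral>\<^sup>+x. ennreal (real x ^ 3) \<partial>q k) \<le> ennreal (D / (1 - \<alpha>))" for k
  proof (induction k)
    case 0 then show ?case by (simp add: q_def)
  next
    case (Suc k)
    have "(\<integral>\<^sup>+x. ennreal (real x ^ 3) \<partial>q (Suc k)) = (\<integral>\<^sup>+x. trans_nn (\<lambda>x. ennreal (real x ^ 3)) x \<partial>q k)"
      by (simp add: q_def trans_nn_def)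
    also have "\<dots> \<le> (\<integral>\<^sup>+x. ennreal \<alpha> * ennreal (real x ^ 3) + ennreal D \<partial>q k)"
      by (intro nn_integral_mono PN3)
    also have "\<dots> = ennreal \<alpha> * (\<integral>\<^sup>+x. ennreal (real x ^ 3) \<partial>q k) + ennreal D"
      by (subst nn_integral_add) (auto simp: nn_integral_cmult)
    also have "\<dots> \<le> ennreal \<alpha> * ennreal (D / (1 - \<alpha>)) + ennreal D"
      by (intro add_mono mult_left_mono Suc) auto
    also have "\<dots> = ennreal (\<alpha> * (D / (1 - \<alpha>)) + D)"
      using D \<alpha>_le \<alpha>_less by (simp add: ennreal_plus ennreal_mult[symmetric])
    also have "\<alpha> * (D / (1 - \<alpha>)) + D = D / (1 - \<alpha>)"
      using \<alpha>_less by (simp add: field_simps)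
    finally show ?case .
  qed
  have "(\<integral>\<^sup>+x. ennreal (real x ^ 3) \<partial>pst) \<le> liminf (\<lambda>k. \<integral>\<^sup>+x. ennreal (real x ^ 3) \<partial>q k)"
    unfolding q_def by (rule nn_integral_pmf_Fatou) (rule pst_limit)
  also have "\<dots> \<le> ennreal (D / (1 - \<alpha>))"
    by (rule Liminf_le) (use b in auto)
  finally have "(\<integral>\<^sup>+x. ennreal (norm (real x ^ 3)) \<partial>pst) < \<infinity>"
    by (simp add: le_less_trans[OF _ ennreal_less_top])
  then show ?thesis unfolding integrable_pmf_nn .
qed

definition m2 :: real where "m2 = measure_pmf.expectation pst (\<lambda>x. real x ^ 2)"
definition m3 :: real where "m3 = measure_pmf.expectation pst (\<lambda>x. real x ^ 3)"
definition score_var :: real where "score_var = \<alpha> * (1 - \<alpha>) * m3 + s2 * m2"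

lemma sigma2_eq: "sigma2_alpha_eps \<alpha> epsd = score_var / m2\<^sup>2"
  unfolding sigma2_alpha_eps_def score_var_def m2_def m3_def pst_def s2_eq_variance Let_def ..

text \<open>A stationary law concentrated at 0 would equal the law of one step from 0, which is
  \<open>epsd\<close>. This is where nondegeneracy of the innovations enters; it makes
  \<open>m2\<close> and \<open>score_var\<close> positive.\<close>

lemma pst_nonzero: "pmf pst 0 < 1"
proof (rule ccontr)
  assume "\<not> pmf pst 0 < 1"
  then have "pmf pst 0 = 1" using pmf_le_1[of pst 0] by linarith
  then have "AE x in measure_pmf pst. x \<in> {0}"
    by (intro measure_pmf.AE_prob_1) (simp add: measure_pmf_single)
  then have "pst = return_pmf 0"
    by (simp add: AE_measure_pmf_iff set_pmf_subset_singleton[symmetric] subset_iff)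
  then have "epsd = return_pmf 0"
    using pst_bind by (simp add: bind_return_pmf inar_step_0 \<alpha>_le)
  then show False using eps_nondeg by simp
qed

end

section \<open>The Poisson equation\<close>

lemma iexp_first_order_limit: "(\<lambda>n. of_nat n * (iexp (b / real n) - 1)) \<longlonglongrightarrow> \<i> * complex_of_real b"
proof -
  have "(\<lambda>n. \<i> * complex_of_real b - of_nat n * (iexp (b / real n) - 1)) \<longlonglongrightarrow> 0"
  proof (rule Lim_null_comparison)
    show "(\<lambda>n. b\<^sup>2 / 2 / real n) \<longlonglongrightarrow> 0" by real_asymp
    show "\<forall>\<^sub>F n in sequentially. norm (\<i> * complex_of_real b - of_nat n * (iexp (b / real n) - 1)) \<le> b\<^sup>2 / 2 / real n"
      using eventually_gt_at_top[of 0]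
    proof eventually_elim
      case (elim n)
      have "\<i> * complex_of_real b - of_nat n * (iexp (b / real n) - 1) =
          - (of_nat n * (iexp (b / real n) - (\<Sum>k \<le> 1. (\<i> * (b / real n))^k / fact k)))"
        using elim by (simp add: field_simps)
      then have "norm (\<i> * complex_of_real b - of_nat n * (iexp (b / real n) - 1)) =
          real n * cmod (iexp (b / real n) - (\<Sum>k \<le> 1. (\<i> * (b / real n))^k / fact k))"
        by (simp only: norm_minus_cancel norm_mult norm_of_nat)
      also have "\<dots> \<le> real n * (\<bar>b / real n\<bar> ^ Suc 1 / fact (Suc 1))"
        by (intro mult_left_mono iexp_approx1) auto
      also have "\<dots> = b\<^sup>2 / 2 / real n"
        using elim by (simp add: power2_eq_square field_simps)
      finally show ?case .
    qed
  qed
  from tendsto_diff[OF tendsto_const[of "\<i> * complex_of_real b"] this] show ?thesis by simp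
qed

lemma iexp_second_order_limit: "(\<lambda>n. of_nat n * (iexp (c / sqrt (real n)) - 1 - \<i> * complex_of_real (c / sqrt (real n))))
    \<longlonglongrightarrow> complex_of_real (- c\<^sup>2 / 2)"
proof -
  let ?z = "\<lambda>n. c / sqrt (real n)"
  let ?f = "\<lambda>n. of_nat n * (iexp (?z n) - 1 - \<i> * complex_of_real (?z n))"
  have "(\<lambda>n. complex_of_real (- c\<^sup>2 / 2) - ?f n) \<longlonglongrightarrow> 0"
  proof (rule Lim_null_comparison)
    show "(\<lambda>n. \<bar>c\<bar> ^ 3 / 6 / sqrt (real n)) \<longlonglongrightarrow> 0" by real_asymp
    show "\<forall>\<^sub>F n in sequentially. norm (complex_of_real (- c\<^sup>2 / 2) - ?f n) \<le> \<bar>c\<bar> ^ 3 / 6 / sqrt (real n)"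
      using eventually_gt_at_top[of 0]
    proof eventually_elim
      case (elim n)
      have z2: "real n * (?z n)\<^sup>2 = c\<^sup>2" using elim by (simp add: power_divide)
      have "complex_of_real (- c\<^sup>2 / 2) = complex_of_real (- (real n * (?z n)\<^sup>2) / 2)"
        unfolding z2 ..
      also have "\<dots> = - (of_nat n * ((complex_of_real (?z n))\<^sup>2 / 2))"
        by (simp only: of_real_divide of_real_minus of_real_mult of_real_of_nat_eq of_real_numeral of_real_power) simp
      finally have z: "complex_of_real (- c\<^sup>2 / 2) = - (of_nat n * ((complex_of_real (?z n))\<^sup>2 / 2))" .
      have "(\<Sum>k \<le> 2. (\<i> * complex_of_real (?z n))^k / fact k) = 1 + \<i> * complex_of_real (?z n) - (complex_of_real (?z n))\<^sup>2 / 2"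
        by (simp add: numeral_2_eq_2 mult_ac)
      then have "complex_of_real (- c\<^sup>2 / 2) - ?f n =
          - (of_nat n * (iexp (?z n) - (\<Sum>k \<le> 2. (\<i> * complex_of_real (?z n))^k / fact k)))"
        unfolding z by (simp only: ring_distribs minus_diff_eq) simp
      then have "norm (complex_of_real (- c\<^sup>2 / 2) - ?f n) =
          real n * cmod (iexp (?z n) - (\<Sum>k \<le> 2. (\<i> * complex_of_real (?z n))^k / fact k))"
        by (simp only: norm_minus_cancel norm_mult norm_of_nat)
      also have "\<dots> \<le> real n * (\<bar>?z n\<bar> ^ Suc 2 / fact (Suc 2))"
        by (intro mult_left_mono iexp_approx1) auto
      also have "\<dots> = \<bar>c\<bar> ^ 3 / 6 * (real n / (sqrt (real n))^3)"
        by (simp add: power_divide fact_numeral eval_nat_numeral)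
      also have "real n / (sqrt (real n))^3 = 1 / sqrt (real n)"
        using elim by (simp add: power3_eq_cube field_simps)
      finally show ?case by simp
    qed
  qed
  from tendsto_diff[OF tendsto_const[of "complex_of_real (- c\<^sup>2 / 2)"] this] show ?thesis by simp
qed

text \<open>The remainder used for domination. Applied to \<open>score_phase\<close> it costs
  \<open>x^2 residual^2\<close>, whose mean is cubic in \<open>x\<close>; a third-order remainder
  would bring in \<open>x^3 |residual|^3\<close>, beyond the available moments.\<close>

lemma iexp_bound2: "cmod (iexp x - 1 - \<i> * complex_of_real x) \<le> x\<^sup>2 / 2"
  using iexp_approx1[of x 1] by (simp add: power2_eq_square algebra_simps)

lemma iexp_bound1: "cmod (iexp x - 1) \<le> \<bar>x\<bar>"
  using iexp_approx1[of x 0] by simp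

context inar_chain
begin

lemma pst_square: "integrable (measure_pmf pst) (\<lambda>x. real x ^ 2)"
proof (rule Bochner_Integration.integrable_bound)
  show "integrable (measure_pmf pst) (\<lambda>x. 1 + real x ^ 3)" using pst_cube by auto
  show "AE x in measure_pmf pst. norm (real x ^ 2) \<le> norm (1 + real x ^ 3)"
    using pow_le_cube[of 2] by auto
qed auto

lemma pst_pow_pos:
  assumes "integrable (measure_pmf pst) (\<lambda>x. real x ^ j)" "j > 0"
  shows "measure_pmf.expectation pst (\<lambda>x. real x ^ j) > 0"
proof -
  have "measure_pmf.expectation pst (\<lambda>x. real x ^ j) \<noteq> 0"
  proof
    assume "measure_pmf.expectation pst (\<lambda>x. real x ^ j) = 0"
    then have "AE x in measure_pmf pst. real x ^ j = 0"
      by (subst (asm) integral_nonneg_eq_0_iff_AE) (use assms in auto)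
    then have "set_pmf pst \<subseteq> {0}"
      using assms(2) by (auto simp: AE_measure_pmf_iff)
    then have "pst = return_pmf 0" by (simp add: set_pmf_subset_singleton)
    then show False using pst_nonzero by simp
  qed
  moreover have "measure_pmf.expectation pst (\<lambda>x. real x ^ j) \<ge> 0"
    by (intro Bochner_Integration.integral_nonneg) auto
  ultimately show ?thesis by linarith
qed

lemma m2_pos: "m2 > 0" and score_var_pos: "score_var > 0"
proof -
  show "m2 > 0" unfolding m2_def by (intro pst_pow_pos pst_square) auto
  moreover have "m3 > 0" unfolding m3_def by (intro pst_pow_pos pst_cube) auto
  ultimately show "score_var > 0" unfolding score_var_def
    using \<alpha>_pos \<alpha>_less s2_nonneg by (intro add_pos_nonneg mult_pos_pos) auto
qed

lemma step_cube_bound: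
  obtains K where "K \<ge> 0" "\<And>x. measure_pmf.expectation (step x) (\<lambda>y. 1 + real y ^ 3) \<le> K * (1 + real x ^ 3)"
proof -
  define K where "K = 1 + \<alpha> ^ 3 + \<bar>c2\<bar> + \<bar>c1\<bar> + e3"
  show ?thesis
  proof (rule that[of K])
    show "K \<ge> 0" unfolding K_def using \<alpha>_pos e_nonneg by auto
    fix x
    have "measure_pmf.expectation (step x) (\<lambda>y. 1 + real y ^ 3) = 1 + (\<alpha> ^ 3 * real x ^ 3 + c2 * real x ^ 2 + c1 * real x + e3)"
      using step_integrable[of x] by (simp add: step_moment3)
    also have "\<dots> \<le> 1 * (1 + real x ^ 3) + (\<alpha> ^ 3 * (1 + real x ^ 3) + \<bar>c2\<bar> * (1 + real x ^ 3) + \<bar>c1\<bar> * (1 + real x ^ 3) + e3 * (1 + real x ^ 3))"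
      using pow_le_cube[of 2 x] pow_le_cube[of 1 x] \<alpha>_pos e_nonneg
      by (intro add_mono mult_mono mult_left_mono) (auto simp: mult_le_cancel_left1)
    also have "\<dots> = K * (1 + real x ^ 3)" unfolding K_def by (simp only: distrib_right)
    finally show "measure_pmf.expectation (step x) (\<lambda>y. 1 + real y ^ 3) \<le> K * (1 + real x ^ 3)" .
  qed
qed

definition incr_var :: "nat \<Rightarrow> real" where "incr_var x = real x ^ 2 * step_var x"

text \<open>The cubic \<open>g\<close> of the overview; \<open>drift_mean\<close> is its stationary
  mean \<lambda>.\<close>

definition drift :: "real \<Rightarrow> real \<Rightarrow> nat \<Rightarrow> complex" where
  "drift t u x = complex_of_real (- t\<^sup>2 / 2 * incr_var x) + \<i> * complex_of_real (u * real x ^ 2)"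

definition drift_mean :: "real \<Rightarrow> real \<Rightarrow> complex" where
  "drift_mean t u = complex_of_real (- t\<^sup>2 / 2 * score_var) + \<i> * complex_of_real (u * m2)"

text \<open>A constant term is left out because constants are invariant under the transition
  operator and cancel in \<open>h - P h\<close>.\<close>

definition cubic :: "complex \<Rightarrow> complex \<Rightarrow> complex \<Rightarrow> nat \<Rightarrow> complex" where
  "cubic a b c x = a * complex_of_real (real x ^ 3) + b * complex_of_real (real x ^ 2) + c * complex_of_real (real x)"

lemma cubic_bound: "cmod (cubic a b c x) \<le> (cmod a + cmod b + cmod c) * (1 + real x ^ 3)"
proof -
  have "cmod (cubic a b c x) \<le> cmod a * real x ^ 3 + cmod b * real x ^ 2 + cmod c * real x"
    unfolding cubic_def by (intro norm_triangle_mono) (auto simp: norm_mult norm_power)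
  also have "\<dots> \<le> cmod a * (1 + real x ^ 3) + cmod b * (1 + real x ^ 3) + cmod c * (1 + real x ^ 3)"
    using pow_le_cube[of 2 x] pow_le_cube[of 1 x] by (intro add_mono mult_left_mono) auto
  finally show ?thesis by (simp add: algebra_simps)
qed

lemma cubic_integrable:
  assumes "integrable (measure_pmf q) (\<lambda>x. real x ^ 3)"
  shows "integrable (measure_pmf q) (cubic a b c)"
proof (rule Bochner_Integration.integrable_bound)
  show "integrable (measure_pmf q) (\<lambda>x. (cmod a + cmod b + cmod c) * (1 + real x ^ 3))" using assms by auto
  show "AE x in measure_pmf q. norm (cubic a b c x) \<le> norm ((cmod a + cmod b + cmod c) * (1 + real x ^ 3))"
    using cubic_bound by (intro AE_I2) (auto simp: abs_mult intro: order_trans)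
qed auto

lemma integral_lincomb3:
  fixes f g h :: "'b \<Rightarrow> complex"
  assumes "integrable M f" "integrable M g" "integrable M h"
  shows "integral\<^sup>L M (\<lambda>x. a * f x + b * g x + c * h x) = a * integral\<^sup>L M f + b * integral\<^sup>L M g + c * integral\<^sup>L M h"
  using assms by simp

lemma cubic_step:
  "measure_pmf.expectation (step x) (cubic a b c) =
    a * complex_of_real (\<alpha> ^ 3 * real x ^ 3 + c2 * real x ^ 2 + c1 * real x + e3) +
    b * complex_of_real (\<alpha>\<^sup>2 * real x ^ 2 + b1 * real x + e2) + c * complex_of_real (\<alpha> * real x + e1)"
proof -
  have "measure_pmf.expectation (step x) (cubic a b c) =
    a * complex_of_real (measure_pmf.expectation (step x) (\<lambda>y. real y ^ 3)) +
    b * complex_of_real (measure_pmf.expectation (step x) (\<lambda>y. real y ^ 2)) + c * complex_of_real (measure_pmf.expectation (step x) real)"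
    unfolding cubic_def integral_complex_of_real[symmetric]
    by (intro integral_lincomb3 integrable_of_real step_integrable)
  then show ?thesis unfolding step_mean step_moment2 step_moment3 .
qed

text \<open>The transition operator maps cubic polynomials to cubic polynomials, triangularly and with
  diagonal \<open>1, \<alpha>, \<alpha>\<^sup>2, \<alpha>\<^sup>3\<close>, so the Poisson equation for \<open>drift t u\<close> has a cubic solution.\<close>

lemma poisson:
  obtains a b c where
    "\<And>x. drift t u x = drift_mean t u + cubic a b c x - measure_pmf.expectation (step x) (cubic a b c)"
proof -
  define T where "T = - t\<^sup>2 / 2"
  define A where "A = \<alpha> * (1 - \<alpha>)"
  define g3 where "g3 = complex_of_real (T * A)"
  define g2 where "g2 = complex_of_real (T * s2) + \<i> * complex_of_real u"
  have incr_var: "incr_var x = A * real x ^ 3 + s2 * real x ^ 2" for x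
    unfolding incr_var_def step_var_def A_def by (simp add: power2_eq_square power3_eq_cube algebra_simps)
  have drift: "drift t u x = cubic g3 g2 0 x" for x
    unfolding drift_def cubic_def incr_var T_def[symmetric] g3_def g2_def by (simp add: algebra_simps)
  \<comment> \<open>Back substitution from the top degree: each coefficient is fixed by comparing
    one power of \<open>x\<close>, given the higher ones.\<close>
  define a where "a = g3 / complex_of_real (1 - \<alpha> ^ 3)"
  define b where "b = (g2 + a * complex_of_real c2) / complex_of_real (1 - \<alpha>\<^sup>2)"
  define c where "c = (a * complex_of_real c1 + b * complex_of_real b1) / complex_of_real (1 - \<alpha>)"
  define h where "h = cubic a b c"
  have ne: "complex_of_real (1 - \<alpha> ^ 3) \<noteq> 0" "complex_of_real (1 - \<alpha>\<^sup>2) \<noteq> 0" "complex_of_real (1 - \<alpha>) \<noteq> 0"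
    using power_strict_decreasing[of 0 3 \<alpha>] power_strict_decreasing[of 0 2 \<alpha>] \<alpha>_pos \<alpha>_less
    unfolding of_real_eq_0_iff by auto
  have Aa: "a * complex_of_real (1 - \<alpha> ^ 3) = g3"
    and B: "b * complex_of_real (1 - \<alpha>\<^sup>2) = g2 + a * complex_of_real c2"
    and C: "c * complex_of_real (1 - \<alpha>) = a * complex_of_real c1 + b * complex_of_real b1"
    unfolding a_def b_def c_def using ne by auto
  \<comment> \<open>What is left in degree 0. It is identified with \<open>drift_mean t u\<close> by
    integrating the equation against \<open>pst\<close>, under which \<open>h\<close> and
    \<open>P h\<close> have the same mean; the stationary moments need not be computed.\<close>
  define l where "l = a * complex_of_real e3 + b * complex_of_real e2 + c * complex_of_real e1"
  have eq: "drift t u x = l + h x - measure_pmf.expectation (step x) h" for x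
  proof -
    have "h x - measure_pmf.expectation (step x) h = 
        (a * complex_of_real (1 - \<alpha> ^ 3)) * complex_of_real (real x ^ 3)
        + (b * complex_of_real (1 - \<alpha>\<^sup>2) - a * complex_of_real c2) * complex_of_real (real x ^ 2)
        + (c * complex_of_real (1 - \<alpha>) - (a * complex_of_real c1 + b * complex_of_real b1)) * complex_of_real (real x) - l"
      unfolding h_def cubic_step by (simp add: cubic_def l_def algebra_simps)
    also have "\<dots> = drift t u x - l" unfolding Aa B C drift cubic_def by simp
    finally show ?thesis by (simp add: algebra_simps)
  qed
  have ih: "integrable (measure_pmf pst) h" unfolding h_def by (intro cubic_integrable pst_cube)
  have ihs: "integrable (measure_pmf (bind_pmf pst step)) h" unfolding pst_bind by (rule ih)
  have "measure_pmf.expectation pst (drift t u) = l + measure_pmf.expectation pst h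
      - measure_pmf.expectation pst (\<lambda>x. measure_pmf.expectation (step x) h)"
    using ih integrable_bind_pmf_inner[OF ihs] unfolding eq by simp
  also have "measure_pmf.expectation pst (\<lambda>x. measure_pmf.expectation (step x) h) = measure_pmf.expectation pst h"
    using integral_bind_pmf_complex[OF ihs] by (simp add: pst_bind)
  finally have l: "l = measure_pmf.expectation pst (drift t u)" by simp
  have "incr_var = (\<lambda>x. \<alpha> * (1 - \<alpha>) * real x ^ 3 + s2 * real x ^ 2)"
    unfolding incr_var A_def ..
  then have "integrable (measure_pmf pst) incr_var" "measure_pmf.expectation pst incr_var = score_var"
    using pst_square pst_cube by (auto simp: score_var_def m2_def m3_def)
  then have "measure_pmf.expectation pst (drift t u) = drift_mean t u"
    unfolding drift_def drift_mean_def m2_def using pst_square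
    by (subst Bochner_Integration.integral_add) (auto simp del: of_real_mult)
  with l eq show ?thesis using that[of a b c] unfolding h_def by metis
qed

end

section \<open>Expansion of one transition\<close>

lemma integral_norm_le_integral:
  fixes f :: "'b \<Rightarrow> 'c::{banach, second_countable_topology}"
  assumes f: "integrable M f" and g: "integrable M g" and le: "\<And>x. norm (f x) \<le> g x"
  shows "norm (integral\<^sup>L M f) \<le> integral\<^sup>L M g"
proof -
  have "norm (integral\<^sup>L M f) \<le> integral\<^sup>L M (\<lambda>x. norm (f x))" by (rule integral_norm_bound)
  also have "\<dots> \<le> integral\<^sup>L M g" by (rule integral_mono[OF integrable_norm[OF f] g le])
  finally show ?thesis .
qed

context inar_chain
begin

definition score_phase :: "real \<Rightarrow> nat \<Rightarrow> nat \<Rightarrow> nat \<Rightarrow> real" where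
  "score_phase t n x y = t * residual x y * real x / sqrt (real n)"

definition phase :: "real \<Rightarrow> real \<Rightarrow> nat \<Rightarrow> nat \<Rightarrow> nat \<Rightarrow> real" where
  "phase t u n x y = score_phase t n x y + u * real x ^ 2 / real n"

lemma iexp_integrable: "integrable (measure_pmf q) (\<lambda>y. iexp (f y))"
  by (rule integrable_pmf_bounded[where B = 1]) simp

lemma score_phase_integrable: "integrable (measure_pmf (step x)) (\<lambda>y. complex_of_real (score_phase t n x y))"
proof -
  have "integrable (measure_pmf (step x)) (score_phase t n x)"
    unfolding score_phase_def using residual_integrable[of x] by auto
  then show ?thesis by simp
qed

lemma score_phase_mean: "measure_pmf.expectation (step x) (\<lambda>y. complex_of_real (score_phase t n x y)) = 0"
proof -
  have "measure_pmf.expectation (step x) (score_phase t n x) = 0"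
    unfolding score_phase_def using residual_integrable[of x] residual_mean[of x] by simp
  then show ?thesis by (simp add: integral_complex_of_real)
qed

lemma score_phase_sq: "n > 0 \<Longrightarrow> real n * (score_phase t n x y)\<^sup>2 = t\<^sup>2 * real x ^ 2 * (residual x y)\<^sup>2"
  by (simp add: score_phase_def power_divide power_mult_distrib)

text \<open>The residual has conditional mean zero, so the term of order \<open>1 / sqrt n\<close>
  can be subtracted for free and only a remainder of order \<open>1 / n\<close> is left.\<close>

lemma iexp_score_phase_center:
  "measure_pmf.expectation (step x) (\<lambda>y. iexp (score_phase t n x y)) - 1 =
    measure_pmf.expectation (step x) (\<lambda>y. iexp (score_phase t n x y) - 1 - \<i> * complex_of_real (score_phase t n x y))"
  using iexp_integrable[of "step x" "score_phase t n x"] score_phase_integrable[of x t n] score_phase_mean[of x t n] by simp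

lemma iexp_score_phase_dominated: "n > 0 \<Longrightarrow> cmod (of_nat n * (iexp (score_phase t n x y) - 1 - \<i> * complex_of_real (score_phase t n x y)))
    \<le> t\<^sup>2 * real x ^ 2 * (residual x y)\<^sup>2 / 2"
proof -
  assume n: "n > 0"
  have "cmod (of_nat n * (iexp (score_phase t n x y) - 1 - \<i> * complex_of_real (score_phase t n x y)))
      = real n * cmod (iexp (score_phase t n x y) - 1 - \<i> * complex_of_real (score_phase t n x y))"
    by (simp only: norm_mult norm_of_nat)
  also have "\<dots> \<le> real n * ((score_phase t n x y)\<^sup>2 / 2)"
    by (intro mult_left_mono iexp_bound2) auto
  finally show ?thesis using score_phase_sq[OF n, of t x y] by simp
qed

lemma dominating_integrable: "integrable (measure_pmf (step x)) (\<lambda>y. t\<^sup>2 * real x ^ 2 * (residual x y)\<^sup>2 / 2)"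
  using residual_sq_integrable[of x] by simp

lemma dominating_expectation: "measure_pmf.expectation (step x) (\<lambda>y. t\<^sup>2 * real x ^ 2 * (residual x y)\<^sup>2 / 2) = t\<^sup>2 / 2 * incr_var x"
  using residual_sq_integrable[of x] residual_sq_mean[of x] by (simp add: incr_var_def)

lemma iexp_score_phase_bound:
  assumes "n > 0"
  shows "cmod (of_nat n * (measure_pmf.expectation (step x) (\<lambda>y. iexp (score_phase t n x y)) - 1)) \<le> t\<^sup>2 / 2 * incr_var x"
proof -
  have "cmod (of_nat n * (measure_pmf.expectation (step x) (\<lambda>y. iexp (score_phase t n x y)) - 1)) =
    cmod (measure_pmf.expectation (step x) (\<lambda>y. of_nat n * (iexp (score_phase t n x y) - 1 - \<i> * complex_of_real (score_phase t n x y))))"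
    unfolding iexp_score_phase_center by simp
  also have "\<dots> \<le> measure_pmf.expectation (step x) (\<lambda>y. t\<^sup>2 * real x ^ 2 * (residual x y)\<^sup>2 / 2)"
  proof (rule integral_norm_le_integral[OF _ dominating_integrable iexp_score_phase_dominated[OF assms]])
    show "integrable (measure_pmf (step x)) (\<lambda>y. of_nat n * (iexp (score_phase t n x y) - 1 - \<i> * complex_of_real (score_phase t n x y)))"
      by (intro integrable_mult_right Bochner_Integration.integrable_diff iexp_integrable score_phase_integrable) auto
  qed
  finally show ?thesis unfolding dominating_expectation .
qed

lemma iexp_score_phase_limit:
  "(\<lambda>n. of_nat n * (measure_pmf.expectation (step x) (\<lambda>y. iexp (score_phase t n x y)) - 1)) \<longlonglongrightarrow> complex_of_real (- t\<^sup>2 / 2 * incr_var x)"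
proof -
  have "(\<lambda>n. measure_pmf.expectation (step x) (\<lambda>y. of_nat n * (iexp (score_phase t n x y) - 1 - \<i> * complex_of_real (score_phase t n x y))))
     \<longlonglongrightarrow> measure_pmf.expectation (step x) (\<lambda>y. complex_of_real (- (t * residual x y * real x)\<^sup>2 / 2))"
  proof (rule integral_dominated_convergence[OF _ _ dominating_integrable[of x t]])
    show "AE y in measure_pmf (step x). (\<lambda>n. of_nat n * (iexp (score_phase t n x y) - 1 - \<i> * complex_of_real (score_phase t n x y)))
        \<longlonglongrightarrow> complex_of_real (- (t * residual x y * real x)\<^sup>2 / 2)"
      unfolding score_phase_def by (intro AE_I2 iexp_second_order_limit)
    show "AE y in measure_pmf (step x). cmod (of_nat n * (iexp (score_phase t n x y) - 1 - \<i> * complex_of_real (score_phase t n x y)))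
        \<le> t\<^sup>2 * real x ^ 2 * (residual x y)\<^sup>2 / 2" for n
      using iexp_score_phase_dominated[of n t x] by (cases "n = 0") auto
  qed auto
  moreover have "measure_pmf.expectation (step x) (\<lambda>y. complex_of_real (- (t * residual x y * real x)\<^sup>2 / 2)) = complex_of_real (- t\<^sup>2 / 2 * incr_var x)"
  proof -
    have "measure_pmf.expectation (step x) (\<lambda>y. - (t * residual x y * real x)\<^sup>2 / 2) = 
      measure_pmf.expectation (step x) (\<lambda>y. - (t\<^sup>2 * real x ^ 2 * (residual x y)\<^sup>2 / 2))"
      by (intro Bochner_Integration.integral_cong) (auto simp: power_mult_distrib)
    also have "\<dots> = - (t\<^sup>2 / 2 * incr_var x)"
      unfolding Bochner_Integration.integral_minus dominating_expectation ..
    finally show ?thesis unfolding integral_complex_of_real by simp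
  qed
  ultimately show ?thesis unfolding iexp_score_phase_center by simp
qed

text \<open>The defect, from state \<open>x\<close>, in the claim that one step multiplies the
  corrected expectation by \<open>1 + drift_mean t u / n\<close>.\<close>

definition step_error :: "real \<Rightarrow> real \<Rightarrow> (nat \<Rightarrow> complex) \<Rightarrow> nat \<Rightarrow> nat \<Rightarrow> complex" where
  "step_error t u h n x = measure_pmf.expectation (step x) (\<lambda>y. iexp (phase t u n x y) * (1 + h y / of_nat n))
     - (1 + drift_mean t u / of_nat n) * (1 + h x / of_nat n)"

text \<open>The Poisson equation trades the term \<open>P h\<close> for \<open>drift t u x\<close>,
  which is the limit of the first two summands; the last two summands vanish on their own. The same
  decomposition serves the pointwise limit and the uniform bound.\<close>

lemma step_error_split:
  assumes h: "\<And>x. integrable (measure_pmf (step x)) h"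
    and P: "drift t u x = drift_mean t u + h x - measure_pmf.expectation (step x) h" and n: "n > 0"
  shows "of_nat n * step_error t u h n x =
     iexp (u * real x ^ 2 / real n) * (of_nat n * (measure_pmf.expectation (step x) (\<lambda>y. iexp (score_phase t n x y)) - 1))
     + of_nat n * (iexp (u * real x ^ 2 / real n) - 1) - drift t u x
     + measure_pmf.expectation (step x) (\<lambda>y. (iexp (phase t u n x y) - 1) * h y) - drift_mean t u * h x / of_nat n"
proof -
  let ?E = "measure_pmf.expectation (step x)"
  let ?b = "iexp (u * real x ^ 2 / real n)"
  have iX: "integrable (measure_pmf (step x)) (\<lambda>y. iexp (phase t u n x y) * h y)"
    by (rule Bochner_Integration.integrable_bound[OF h[of x]]) (auto simp: norm_mult)
  have iX1: "?E (\<lambda>y. (iexp (phase t u n x y) - 1) * h y) = ?E (\<lambda>y. iexp (phase t u n x y) * h y) - ?E h"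
    using iX h[of x] by (simp add: left_diff_distrib)
  have "?E (\<lambda>y. iexp (phase t u n x y) * (1 + h y / of_nat n)) =
      ?E (\<lambda>y. iexp (phase t u n x y) + (iexp (phase t u n x y) * h y) / of_nat n)"
    by (simp add: distrib_left)
  also have "\<dots> = ?E (\<lambda>y. iexp (phase t u n x y)) + ?E (\<lambda>y. iexp (phase t u n x y) * h y) / of_nat n"
    using iX iexp_integrable[of "step x" "phase t u n x"] by simp
  also have "?E (\<lambda>y. iexp (phase t u n x y)) = ?E (\<lambda>y. ?b * iexp (score_phase t n x y))"
    unfolding phase_def by (simp add: distrib_left exp_add mult.commute)
  also have "\<dots> = ?b * ?E (\<lambda>y. iexp (score_phase t n x y))"
    using iexp_integrable[of "step x" "score_phase t n x"] by simp
  finally have eq: "?E (\<lambda>y. iexp (phase t u n x y) * (1 + h y / of_nat n)) =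
    ?b * ?E (\<lambda>y. iexp (score_phase t n x y)) + (?E (\<lambda>y. (iexp (phase t u n x y) - 1) * h y) + ?E h) / of_nat n"
    unfolding iX1 by simp
  have alg: "c * ((b * e + (i + eh) / c) - (1 + l / c) * (1 + hx / c)) =
      b * (c * (e - 1)) + c * (b - 1) - (l + hx - eh) + i - l * hx / c" if "c \<noteq> 0"
    for b c e i eh l hx :: complex
    using that by (simp add: field_simps)
  show ?thesis unfolding step_error_def eq P by (rule alg) (use n in simp)
qed

lemma step_error_limit:
  assumes h: "\<And>x. integrable (measure_pmf (step x)) h"
    and P: "\<And>x. drift t u x = drift_mean t u + h x - measure_pmf.expectation (step x) h"
  shows "(\<lambda>n. of_nat n * step_error t u h n x) \<longlonglongrightarrow> 0"
proof -
  let ?E = "measure_pmf.expectation (step x)"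
  let ?b = "\<lambda>n. iexp (u * real x ^ 2 / real n)"
  have b: "?b \<longlonglongrightarrow> 1"
  proof -
    have "(\<lambda>n. u * real x ^ 2 / real n) \<longlonglongrightarrow> 0" by real_asymp
    then have "?b \<longlonglongrightarrow> iexp 0" by (intro tendsto_intros)
    then show ?thesis by simp
  qed
  have X: "(\<lambda>n. ?E (\<lambda>y. (iexp (phase t u n x y) - 1) * h y)) \<longlonglongrightarrow> ?E (\<lambda>y. 0)"
  proof (rule integral_dominated_convergence[where w = "\<lambda>y. 2 * cmod (h y)"])
    show "integrable (measure_pmf (step x)) (\<lambda>y. 2 * cmod (h y))" using h[of x] by simp
    show "AE y in measure_pmf (step x). (\<lambda>n. (iexp (phase t u n x y) - 1) * h y) \<longlonglongrightarrow> 0"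
    proof (intro AE_I2)
      fix y
      have "(\<lambda>n. phase t u n x y) \<longlonglongrightarrow> 0" unfolding phase_def score_phase_def by real_asymp
      then have "(\<lambda>n. (iexp (phase t u n x y) - 1) * h y) \<longlonglongrightarrow> (iexp 0 - 1) * h y" by (intro tendsto_intros)
      then show "(\<lambda>n. (iexp (phase t u n x y) - 1) * h y) \<longlonglongrightarrow> 0" by simp
    qed
    show "AE y in measure_pmf (step x). cmod ((iexp (phase t u n x y) - 1) * h y) \<le> 2 * cmod (h y)" for n
      using norm_triangle_ineq4[of "iexp (phase t u n x y)" 1 for y]
      by (intro AE_I2) (auto simp: norm_mult intro!: mult_right_mono)
  qed auto
  have L: "(\<lambda>n. drift_mean t u * h x / of_nat n) \<longlonglongrightarrow> 0"
    by (intro tendsto_divide_0[OF tendsto_const] tendsto_of_nat)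
  have "(\<lambda>n. ?b n * (of_nat n * (?E (\<lambda>y. iexp (score_phase t n x y)) - 1))
     + of_nat n * (?b n - 1) - drift t u x + ?E (\<lambda>y. (iexp (phase t u n x y) - 1) * h y) - drift_mean t u * h x / of_nat n)
    \<longlonglongrightarrow> 1 * complex_of_real (- t\<^sup>2 / 2 * incr_var x) + \<i> * complex_of_real (u * real x ^ 2) - drift t u x + ?E (\<lambda>y. 0) - 0"
    by (intro tendsto_intros b iexp_score_phase_limit iexp_first_order_limit X L)
  moreover have "1 * complex_of_real (- t\<^sup>2 / 2 * incr_var x) + \<i> * complex_of_real (u * real x ^ 2) - drift t u x + ?E (\<lambda>y. 0) - 0 = 0"
    by (simp add: drift_def)
  ultimately have "(\<lambda>n. ?b n * (of_nat n * (?E (\<lambda>y. iexp (score_phase t n x y)) - 1))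
     + of_nat n * (?b n - 1) - drift t u x + ?E (\<lambda>y. (iexp (phase t u n x y) - 1) * h y) - drift_mean t u * h x / of_nat n) \<longlonglongrightarrow> 0"
    by (simp only:)
  then show ?thesis
    by (rule Lim_transform_eventually)
       (use eventually_gt_at_top[of 0] in eventually_elim, rule step_error_split[symmetric, OF h P], simp)
qed

lemma step_var_nonneg: "step_var x \<ge> 0"
  unfolding step_var_def using \<alpha>_le s2_nonneg by auto

lemma incr_var_bound: "0 \<le> incr_var x" "incr_var x \<le> (\<alpha> * (1 - \<alpha>) + s2) * (1 + real x ^ 3)"
proof -
  show "0 \<le> incr_var x" unfolding incr_var_def using step_var_nonneg[of x] by auto
  have "incr_var x = \<alpha> * (1 - \<alpha>) * real x ^ 3 + s2 * real x ^ 2"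
    unfolding incr_var_def step_var_def by (simp add: power2_eq_square power3_eq_cube algebra_simps)
  also have "\<dots> \<le> \<alpha> * (1 - \<alpha>) * (1 + real x ^ 3) + s2 * (1 + real x ^ 3)"
    using pow_le_cube[of 2 x] \<alpha>_le s2_nonneg by (intro add_mono mult_left_mono) auto
  finally show "incr_var x \<le> (\<alpha> * (1 - \<alpha>) + s2) * (1 + real x ^ 3)" by (simp add: algebra_simps)
qed

text \<open>Each of the five summands of \<open>step_error_split\<close> is bounded by a multiple of
  \<open>1 + x^3\<close> independently of \<open>n\<close>; \<open>C\<close> collects the five
  multiples. Cubic growth is the most that the moment assumptions can integrate.\<close>

lemma step_error_bound:
  assumes h: "h = cubic a b c"
    and P: "\<And>x. drift t u x = drift_mean t u + h x - measure_pmf.expectation (step x) h"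
  obtains C where "C \<ge> 0" "\<And>n x. n > 0 \<Longrightarrow> real n * cmod (step_error t u h n x) \<le> C * (1 + real x ^ 3)"
proof -
  obtain K where K: "K \<ge> 0" "\<And>x. measure_pmf.expectation (step x) (\<lambda>y. 1 + real y ^ 3) \<le> K * (1 + real x ^ 3)"
    by (rule step_cube_bound) blast
  define H where "H = cmod a + cmod b + cmod c"
  define W where "W = \<alpha> * (1 - \<alpha>) + s2"
  have H: "H \<ge> 0" unfolding H_def by auto
  have W: "W \<ge> 0" unfolding W_def using \<alpha>_le s2_nonneg by auto
  have hb: "cmod (h x) \<le> H * (1 + real x ^ 3)" for x unfolding h H_def by (rule cubic_bound)
  have ih: "integrable (measure_pmf (step x)) h" for x
    unfolding h by (intro cubic_integrable step_integrable)
  define C where "C = t\<^sup>2 / 2 * W + \<bar>u\<bar> + (t\<^sup>2 / 2 * W + \<bar>u\<bar>) + 2 * H * K + cmod (drift_mean t u) * H"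
  show ?thesis
  proof (rule that[of C])
    show "C \<ge> 0" unfolding C_def using H W K(1) by auto
    fix n x :: nat assume n: "n > 0"
    define c3 where "c3 = 1 + real x ^ 3"
    have c3: "c3 \<ge> 0" unfolding c3_def by auto
    let ?E = "measure_pmf.expectation (step x)"
    let ?b = "iexp (u * real x ^ 2 / real n)"
    have incr_var: "t\<^sup>2 / 2 * incr_var x \<le> t\<^sup>2 / 2 * W * c3"
      using incr_var_bound(2)[of x] unfolding W_def c3_def by (simp only: mult.assoc) (intro mult_left_mono, auto)
    have x2: "\<bar>u\<bar> * real x ^ 2 \<le> \<bar>u\<bar> * c3"
      unfolding c3_def using pow_le_cube[of 2 x] by (intro mult_left_mono) auto
    have 1: "cmod (?b * (of_nat n * (?E (\<lambda>y. iexp (score_phase t n x y)) - 1))) \<le> t\<^sup>2 / 2 * W * c3"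
      using iexp_score_phase_bound[OF n, of x t] incr_var by (simp add: norm_mult)
    have 2: "cmod (of_nat n * (?b - 1)) \<le> \<bar>u\<bar> * c3"
    proof -
      have "cmod (of_nat n * (?b - 1)) \<le> real n * \<bar>u * real x ^ 2 / real n\<bar>"
        unfolding norm_mult norm_of_nat by (intro mult_left_mono iexp_bound1) auto
      also have "\<dots> = \<bar>u\<bar> * real x ^ 2" using n by (simp add: abs_mult)
      finally show ?thesis using x2 by linarith
    qed
    have 3: "cmod (drift t u x) \<le> (t\<^sup>2 / 2 * W + \<bar>u\<bar>) * c3"
    proof -
      have "cmod (drift t u x) \<le> \<bar>- t\<^sup>2 / 2 * incr_var x\<bar> + \<bar>u * real x ^ 2\<bar>"
        unfolding drift_def by (rule norm_triangle_le) (simp del: of_real_mult of_real_power add: norm_mult)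
      also have "\<dots> = t\<^sup>2 / 2 * incr_var x + \<bar>u\<bar> * real x ^ 2"
        using incr_var_bound(1)[of x] by (simp add: abs_mult)
      finally show ?thesis using incr_var x2 unfolding distrib_right by linarith
    qed
    have 4: "cmod (?E (\<lambda>y. (iexp (phase t u n x y) - 1) * h y)) \<le> 2 * H * K * c3"
    proof -
      have i: "integrable (measure_pmf (step x)) (\<lambda>y. 1 + real y ^ 3)" using step_integrable[of x] by simp
      have "cmod (?E (\<lambda>y. (iexp (phase t u n x y) - 1) * h y)) \<le> ?E (\<lambda>y. 2 * H * (1 + real y ^ 3))"
      proof (rule integral_norm_le_integral)
        have "integrable (measure_pmf (step x)) (\<lambda>y. iexp (phase t u n x y) * h y)"
          by (rule Bochner_Integration.integrable_bound[OF ih[of x]]) (auto simp: norm_mult)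
        then show "integrable (measure_pmf (step x)) (\<lambda>y. (iexp (phase t u n x y) - 1) * h y)"
          using ih[of x] by (simp add: left_diff_distrib)
        show "integrable (measure_pmf (step x)) (\<lambda>y. 2 * H * (1 + real y ^ 3))" using i by simp
        fix y
        have "cmod (iexp (phase t u n x y) - 1) \<le> 2"
          using norm_triangle_ineq4[of "iexp (phase t u n x y)" 1] by simp
        then have "cmod ((iexp (phase t u n x y) - 1) * h y) \<le> 2 * (H * (1 + real y ^ 3))"
          unfolding norm_mult by (intro mult_mono hb) auto
        then show "cmod ((iexp (phase t u n x y) - 1) * h y) \<le> 2 * H * (1 + real y ^ 3)" by simp
      qed
      also have "\<dots> = 2 * H * ?E (\<lambda>y. 1 + real y ^ 3)" using i by simp
      also have "\<dots> \<le> 2 * H * (K * c3)"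
        unfolding c3_def using H by (intro mult_left_mono K) auto
      finally show ?thesis by simp
    qed
    have 5: "cmod (drift_mean t u * h x / of_nat n) \<le> cmod (drift_mean t u) * H * c3"
    proof -
      have "cmod (drift_mean t u * h x / of_nat n) = cmod (drift_mean t u) * cmod (h x) / real n"
        by (simp add: norm_mult norm_divide)
      also have "\<dots> \<le> cmod (drift_mean t u) * cmod (h x) / 1"
        using n by (intro divide_left_mono) auto
      also have "\<dots> \<le> cmod (drift_mean t u) * (H * c3)"
        using hb[of x] unfolding c3_def by (simp add: mult_left_mono)
      finally show ?thesis by simp
    qed
    have "real n * cmod (step_error t u h n x) = cmod (of_nat n * step_error t u h n x)" by (simp add: norm_mult)
    also have "\<dots> \<le> t\<^sup>2 / 2 * W * c3 + \<bar>u\<bar> * c3 + (t\<^sup>2 / 2 * W + \<bar>u\<bar>) * c3 + 2 * H * K * c3 + cmod (drift_mean t u) * H * c3"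
      unfolding step_error_split[OF ih P n]
      by (intro norm_triangle_le norm_triangle_le_diff add_mono 1 2 3 4 5)
    also have "\<dots> = C * c3" unfolding C_def by (simp only: distrib_right)
    finally show "real n * cmod (step_error t u h n x) \<le> C * (1 + real x ^ 3)" unfolding c3_def .
  qed
qed

end

section \<open>Characteristic functions along the chain\<close>

lemma exp_over_n_limit: "(\<lambda>n. of_nat n * (exp (l / of_nat n) - 1)) \<longlonglongrightarrow> (l::complex)"
proof -
  have "((\<lambda>x. exp (l * x)) has_field_derivative l) (at 0)"
    by (auto intro!: derivative_eq_intros)
  then have D: "((\<lambda>h. (exp (l * (0 + h)) - exp (l * 0)) / h) \<longlongrightarrow> l) (at 0)"
    by (simp add: DERIV_def)
  have "filterlim (\<lambda>n. 1 / of_nat n :: complex) (at 0) sequentially"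
    unfolding filterlim_at
    by (auto intro!: lim_1_over_n eventually_mono[OF eventually_gt_at_top[of 0]])
  from filterlim_compose[OF D this] show ?thesis
    by (simp add: mult.commute)
qed

text \<open>Because \<open>cmod w \<le> 1\<close>, earlier errors are not amplified and simply add
  up. The factor \<open>1 + drift_mean t u / n\<close> may have modulus above 1, which is why it is
  later replaced by \<open>exp (drift_mean t u / n)\<close>.\<close>

lemma approx_recursion:
  fixes a :: "nat \<Rightarrow> complex"
  assumes w: "cmod w \<le> 1" and a: "\<And>k. cmod (a (Suc k) - w * a k) \<le> \<delta>"
  shows "cmod (a m - w ^ m * a 0) \<le> real m * \<delta>"
proof (induction m)
  case (Suc m)
  have "a (Suc m) - w ^ Suc m * a 0 = (a (Suc m) - w * a m) + w * (a m - w ^ m * a 0)"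
    by (simp add: algebra_simps)
  also have "cmod \<dots> \<le> \<delta> + cmod w * cmod (a m - w ^ m * a 0)"
    by (intro norm_triangle_le add_mono a) (simp add: norm_mult)
  also have "\<dots> \<le> \<delta> + 1 * (real m * \<delta>)"
    by (intro add_mono mult_mono Suc w) auto
  finally show ?case by (simp add: algebra_simps)
qed auto

context inar_chain
begin

text \<open>Current value, accumulated score \<open>S\<close> and accumulated sum of squares
  \<open>Q\<close>. Carrying the sums along makes them part of a homogeneous Markov chain and lets
  the initial law contain the past.\<close>

type_synonym state = "nat \<times> real \<times> real"

definition next_state :: "state \<Rightarrow> nat \<Rightarrow> state" where
  "next_state c y = (y, fst (snd c) + residual (fst c) y * real (fst c), snd (snd c) + real (fst c) ^ 2)"

definition kern :: "state \<Rightarrow> state pmf" where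
  "kern c = map_pmf (next_state c) (step (fst c))"

definition chain :: "nat \<Rightarrow> state pmf \<Rightarrow> state pmf" where
  "chain k = (\<lambda>L. bind_pmf L kern) ^^ k"

lemma chain_0 [simp]: "chain 0 \<nu> = \<nu>"
  by (simp add: chain_def)

lemma chain_Suc: "chain (Suc k) \<nu> = bind_pmf (chain k \<nu>) kern"
  by (simp add: chain_def)

lemma map_fst_chain: "map_pmf fst (chain k \<nu>) = iter k (map_pmf fst \<nu>)"
proof (induction k)
  case (Suc k)
  have "map_pmf fst (kern c) = step (fst c)" for c
    by (simp add: kern_def pmf.map_comp o_def next_state_def)
  then have "map_pmf fst (chain (Suc k) \<nu>) = bind_pmf (map_pmf fst (chain k \<nu>)) step"
    by (simp add: chain_Suc map_bind_pmf bind_map_pmf)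
  then show ?case using Suc by simp
qed simp

definition dominating :: "nat pmf \<Rightarrow> nat pmf" where
  "dominating q = bind_pmf q (\<lambda>x. map_pmf (\<lambda>y. x + y) pst)"

lemma chain_nn_dom:
  assumes "mono f"
  shows "(\<integral>\<^sup>+c. f (fst c) \<partial>chain k \<nu>) \<le> (\<integral>\<^sup>+y. f y \<partial>dominating (map_pmf fst \<nu>))"
proof -
  have "(\<integral>\<^sup>+c. f (fst c) \<partial>chain k \<nu>) = (\<integral>\<^sup>+y. f y \<partial>iter k (map_pmf fst \<nu>))"
    by (simp flip: map_fst_chain)
  also have "\<dots> = (\<integral>\<^sup>+y. (trans_nn ^^ k) f y \<partial>map_pmf fst \<nu>)"
    by (rule nn_integral_iter)
  also have "\<dots> \<le> (\<integral>\<^sup>+x. (\<integral>\<^sup>+y. f (x + y) \<partial>pst) \<partial>map_pmf fst \<nu>)"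
    by (intro nn_integral_mono trans_nn_iter_le_pst assms)
  finally show ?thesis by (simp add: dominating_def)
qed

lemma chain_dom:
  fixes f :: "nat \<Rightarrow> real"
  assumes f: "mono f" "\<And>y. 0 \<le> f y" and dominating_law: "integrable (measure_pmf (dominating (map_pmf fst \<nu>))) f"
  shows "integrable (measure_pmf (chain k \<nu>)) (\<lambda>c. f (fst c))"
    "measure_pmf.expectation (chain k \<nu>) (\<lambda>c. f (fst c)) \<le> measure_pmf.expectation (dominating (map_pmf fst \<nu>)) f"
proof -
  have "(\<integral>\<^sup>+c. ennreal (f (fst c)) \<partial>chain k \<nu>) \<le> (\<integral>\<^sup>+y. ennreal (f y) \<partial>dominating (map_pmf fst \<nu>))"
    using f by (intro chain_nn_dom) (auto simp: mono_def intro: ennreal_leI)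
  also have "\<dots> = ennreal (measure_pmf.expectation (dominating (map_pmf fst \<nu>)) f)"
    by (intro nn_integral_eq_integral dominating_law) (use f in auto)
  finally have le: "(\<integral>\<^sup>+c. ennreal (f (fst c)) \<partial>chain k \<nu>) \<le> ennreal (measure_pmf.expectation (dominating (map_pmf fst \<nu>)) f)" .
  show i: "integrable (measure_pmf (chain k \<nu>)) (\<lambda>c. f (fst c))"
    unfolding integrable_pmf_nn using le f(2) by (simp add: le_less_trans[OF _ ennreal_less_top])
  have "(\<integral>\<^sup>+c. ennreal (f (fst c)) \<partial>chain k \<nu>) = ennreal (measure_pmf.expectation (chain k \<nu>) (\<lambda>c. f (fst c)))"
    by (intro nn_integral_eq_integral i) (use f in auto)
  moreover have "0 \<le> measure_pmf.expectation (dominating (map_pmf fst \<nu>)) f"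
    by (intro Bochner_Integration.integral_nonneg f)
  ultimately show "measure_pmf.expectation (chain k \<nu>) (\<lambda>c. f (fst c)) \<le> measure_pmf.expectation (dominating (map_pmf fst \<nu>)) f"
    using le by (simp add: ennreal_le_iff)
qed

lemma dominating_cube:
  assumes "integrable (measure_pmf q) (\<lambda>x. real x ^ 3)"
  shows "integrable (measure_pmf (dominating q)) (\<lambda>x. real x ^ 3)"
proof -
  have le: "real (x + y) ^ 3 \<le> 8 * real x ^ 3 + 8 * real y ^ 3" for x y :: nat
  proof -
    have "real (x + y) ^ 3 \<le> (2 * max (real x) (real y)) ^ 3" by (intro power_mono) auto
    also have "\<dots> = 8 * max (real x) (real y) ^ 3" by (simp add: power_mult_distrib)
    also have "\<dots> \<le> 8 * real x ^ 3 + 8 * real y ^ 3" by (auto simp: max_def)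
    finally show ?thesis .
  qed
  have "(\<integral>\<^sup>+z. ennreal (real z ^ 3) \<partial>dominating q) = (\<integral>\<^sup>+x. (\<integral>\<^sup>+y. ennreal (real (x + y) ^ 3) \<partial>pst) \<partial>q)"
    by (simp add: dominating_def)
  also have "\<dots> \<le> (\<integral>\<^sup>+x. (\<integral>\<^sup>+y. ennreal (8 * real x ^ 3) + ennreal (8 * real y ^ 3) \<partial>pst) \<partial>q)"
    by (intro nn_integral_mono) (auto simp flip: ennreal_plus intro!: ennreal_leI le[simplified])
  also have "\<dots> = (\<integral>\<^sup>+x. ennreal (8 * real x ^ 3) \<partial>q) + (\<integral>\<^sup>+y. ennreal (8 * real y ^ 3) \<partial>pst)"
    by (simp add: nn_integral_add)
  also have "\<dots> < \<infinity>"
  proof -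
    have "integrable (measure_pmf q) (\<lambda>x. 8 * real x ^ 3)" "integrable (measure_pmf pst) (\<lambda>x. 8 * real x ^ 3)"
      using assms pst_cube by auto
    then show ?thesis unfolding integrable_pmf_nn by (simp add: ennreal_add_less_top)
  qed
  finally show ?thesis unfolding integrable_pmf_nn by simp
qed

definition weight :: "real \<Rightarrow> real \<Rightarrow> nat \<Rightarrow> state \<Rightarrow> complex" where
  "weight t u n c = iexp (t * fst (snd c) / sqrt (real n) + u * snd (snd c) / real n)"

lemma weight_next_state: "weight t u n (next_state c y) = weight t u n c * iexp (phase t u n (fst c) y)"
proof -
  have "t * fst (snd (next_state c y)) / sqrt (real n) + u * snd (snd (next_state c y)) / real n =
    (t * fst (snd c) / sqrt (real n) + u * snd (snd c) / real n) + phase t u n (fst c) y"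
    by (simp add: next_state_def phase_def score_phase_def add_divide_distrib distrib_left)
  then show ?thesis unfolding weight_def by (simp only: of_real_add distrib_left exp_add)
qed

lemma cmod_weight [simp]: "cmod (weight t u n c) = 1"
  by (simp add: weight_def)

text \<open>Cutting off below \<open>K\<close> leaves the function increasing, so stochastic
  domination bounds its mean at every time by its mean under one fixed law. This is the uniform
  integrability in time.\<close>

definition cube_tail :: "nat \<Rightarrow> nat \<Rightarrow> real" where
  "cube_tail K y = (1 + real y ^ 3) * indicator {K<..} y"

lemma mono_cube_tail: "mono (cube_tail K)"
proof (rule monoI)
  fix x y :: nat assume "x \<le> y"
  then have "(1 + real x ^ 3) \<le> (1 + real y ^ 3)" by (simp add: power_mono)
  then show "cube_tail K x \<le> cube_tail K y" using \<open>x \<le> y\<close> unfolding cube_tail_def by (auto simp: indicator_def)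
qed

lemma cube_tail_nonneg: "0 \<le> cube_tail K y"
  by (simp add: cube_tail_def)

context
  fixes \<nu> :: "state pmf" and t u :: real and a b c :: complex and h :: "nat \<Rightarrow> complex"
  assumes nu: "integrable (measure_pmf \<nu>) (\<lambda>c. real (fst c) ^ 3)"
    and h: "h = cubic a b c"
    and P: "\<And>x. drift t u x = drift_mean t u + h x - measure_pmf.expectation (step x) h"
begin

abbreviation dominating_law where "dominating_law \<equiv> dominating (map_pmf fst \<nu>)"

lemma dominating_law_cube: "integrable (measure_pmf dominating_law) (\<lambda>x. real x ^ 3)"
  by (rule dominating_cube) (use nu in simp)

lemma dominating_law_tail: "integrable (measure_pmf dominating_law) (cube_tail K)"
  by (rule Bochner_Integration.integrable_bound[of _ "\<lambda>x. 1 + real x ^ 3"])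
     (use dominating_law_cube in \<open>auto simp: cube_tail_def indicator_def\<close>)

lemma tail_limit: "(\<lambda>K. measure_pmf.expectation dominating_law (cube_tail K)) \<longlonglongrightarrow> 0"
proof -
  have "(\<lambda>K. measure_pmf.expectation dominating_law (cube_tail K)) \<longlonglongrightarrow> measure_pmf.expectation dominating_law (\<lambda>x. 0)"
  proof (rule integral_dominated_convergence[where w = "\<lambda>x. 1 + real x ^ 3"])
    show "AE y in measure_pmf dominating_law. (\<lambda>K. cube_tail K y) \<longlonglongrightarrow> 0"
    proof (intro AE_I2 tendsto_eventually)
      fix y show "\<forall>\<^sub>F K in sequentially. cube_tail K y = 0"
        using eventually_ge_at_top[of y] by eventually_elim (simp add: cube_tail_def)
    qed
  qed (use dominating_law_cube in \<open>auto simp: cube_tail_def indicator_def\<close>)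
  then show ?thesis by simp
qed

lemma mono_one_plus_cube: "mono (\<lambda>y::nat. 1 + real y ^ 3)"
  by (auto simp: mono_def power_mono)

lemma chain_cube: "integrable (measure_pmf (chain k \<nu>)) (\<lambda>c. 1 + real (fst c) ^ 3)"
  "measure_pmf.expectation (chain k \<nu>) (\<lambda>c. 1 + real (fst c) ^ 3) \<le> measure_pmf.expectation dominating_law (\<lambda>y. 1 + real y ^ 3)"
  by (rule chain_dom[OF mono_one_plus_cube]; use dominating_law_cube in simp)+

definition cubic_bound :: real where "cubic_bound = cmod a + cmod b + cmod c"

lemma h_bound: "cmod (h y) \<le> cubic_bound * (1 + real y ^ 3)"
  unfolding h cubic_bound_def by (rule cubic_bound)

lemma h_integrable: "integrable (measure_pmf (step x)) h"
  unfolding h by (intro cubic_integrable step_integrable)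

lemma corrected_weight_norm:
  assumes "n > 0" shows "cmod (weight t u n s * (1 + h (fst s) / of_nat n)) \<le> (1 + cubic_bound) * (1 + real (fst s) ^ 3)"
proof -
  have "cmod (h (fst s)) / real n \<le> cmod (h (fst s)) / 1" using assms by (intro divide_left_mono) auto
  then have "cmod (weight t u n s * (1 + h (fst s) / of_nat n)) \<le> 1 + cubic_bound * (1 + real (fst s) ^ 3)"
    using norm_triangle_ineq[of 1 "h (fst s) / of_nat n"] h_bound[of "fst s"]
    by (simp only: norm_mult cmod_weight) (simp add: norm_divide)
  also have "\<dots> \<le> (1 + cubic_bound) * (1 + real (fst s) ^ 3)" by (simp add: algebra_simps)
  finally show ?thesis .
qed

lemma corrected_weight_integrable:
  assumes "n > 0"
  shows "integrable (measure_pmf (chain k \<nu>)) (\<lambda>s. weight t u n s * (1 + h (fst s) / of_nat n))"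
proof (rule Bochner_Integration.integrable_bound)
  show "integrable (measure_pmf (chain k \<nu>)) (\<lambda>s. (1 + cubic_bound) * (1 + real (fst s) ^ 3))"
    using chain_cube(1)[of k] by simp
  show "AE s in measure_pmf (chain k \<nu>). cmod (weight t u n s * (1 + h (fst s) / of_nat n)) \<le> norm ((1 + cubic_bound) * (1 + real (fst s) ^ 3))"
    using corrected_weight_norm[OF assms] by (intro AE_I2) (metis abs_ge_self order_trans real_norm_def)
qed auto

definition corrected :: "nat \<Rightarrow> nat \<Rightarrow> complex" where
  "corrected n k = measure_pmf.expectation (chain k \<nu>) (\<lambda>s. weight t u n s * (1 + h (fst s) / of_nat n))"

lemma corrected_bound:
  assumes "n > 0"
  shows "cmod (corrected n k) \<le> (1 + cubic_bound) * measure_pmf.expectation dominating_law (\<lambda>y. 1 + real y ^ 3)"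
proof -
  have "cmod (corrected n k) \<le> measure_pmf.expectation (chain k \<nu>) (\<lambda>s. (1 + cubic_bound) * (1 + real (fst s) ^ 3))"
    unfolding corrected_def
    by (rule integral_norm_le_integral[OF corrected_weight_integrable[OF assms] _ corrected_weight_norm[OF assms]])
       (use chain_cube(1)[of k] in simp)
  also have "\<dots> = (1 + cubic_bound) * measure_pmf.expectation (chain k \<nu>) (\<lambda>s. 1 + real (fst s) ^ 3)"
    by (rule Bochner_Integration.integral_mult_right_zero)
  also have "\<dots> \<le> (1 + cubic_bound) * measure_pmf.expectation dominating_law (\<lambda>y. 1 + real y ^ 3)"
    by (intro mult_left_mono chain_cube(2)) (auto simp: cubic_bound_def)
  finally show ?thesis .
qed

text \<open>The weight accumulated so far factors out of the step. Since it has modulus 1, the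
  defect of the recursion is at most the mean of \<open>cmod (step_error ...)\<close> over the
  current value.\<close>

lemma corrected_Suc:
  assumes n: "n > 0"
  shows "corrected n (Suc k) - (1 + drift_mean t u / of_nat n) * corrected n k =
    measure_pmf.expectation (chain k \<nu>) (\<lambda>s. weight t u n s * step_error t u h n (fst s))"
proof -
  have i: "integrable (measure_pmf (bind_pmf (chain k \<nu>) kern)) (\<lambda>s. weight t u n s * (1 + h (fst s) / of_nat n))"
    using corrected_weight_integrable[OF n, of "Suc k"] by (simp only: chain_Suc)
  have inner: "measure_pmf.expectation (kern s) (\<lambda>s. weight t u n s * (1 + h (fst s) / of_nat n)) =
      weight t u n s * step_error t u h n (fst s) + (1 + drift_mean t u / of_nat n) * (weight t u n s * (1 + h (fst s) / of_nat n))" for s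
  proof -
    have "measure_pmf.expectation (kern s) (\<lambda>s. weight t u n s * (1 + h (fst s) / of_nat n)) =
      measure_pmf.expectation (step (fst s)) (\<lambda>y. weight t u n (next_state s y) * (1 + h (fst (next_state s y)) / of_nat n))"
      unfolding kern_def by simp
    also have "\<dots> = measure_pmf.expectation (step (fst s)) (\<lambda>y. weight t u n s * (iexp (phase t u n (fst s) y) * (1 + h y / of_nat n)))"
      unfolding weight_next_state by (simp add: next_state_def mult.assoc)
    also have "\<dots> = weight t u n s * measure_pmf.expectation (step (fst s)) (\<lambda>y. iexp (phase t u n (fst s) y) * (1 + h y / of_nat n))"
      by (rule Bochner_Integration.integral_mult_right_zero)
    finally have "measure_pmf.expectation (kern s) (\<lambda>s. weight t u n s * (1 + h (fst s) / of_nat n)) = \<dots>" .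
    moreover have "F * E = F * (E - A * B) + A * (F * B)" for F E A B :: complex
      by (simp add: algebra_simps)
    ultimately show ?thesis unfolding step_error_def by metis
  qed
  have "integrable (measure_pmf (chain k \<nu>)) (\<lambda>s. measure_pmf.expectation (kern s) (\<lambda>s. weight t u n s * (1 + h (fst s) / of_nat n))
        - (1 + drift_mean t u / of_nat n) * (weight t u n s * (1 + h (fst s) / of_nat n)))"
    by (intro Bochner_Integration.integrable_diff integrable_bind_pmf_inner[OF i] integrable_mult_right corrected_weight_integrable n)
  then have e: "integrable (measure_pmf (chain k \<nu>)) (\<lambda>s. weight t u n s * step_error t u h n (fst s))"
    unfolding inner by simp
  have "corrected n (Suc k) = measure_pmf.expectation (chain k \<nu>) (\<lambda>s. measure_pmf.expectation (kern s) (\<lambda>s. weight t u n s * (1 + h (fst s) / of_nat n)))"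
    unfolding corrected_def chain_Suc by (rule integral_bind_pmf_complex[OF i])
  also have "\<dots> = measure_pmf.expectation (chain k \<nu>) (\<lambda>s. weight t u n s * step_error t u h n (fst s)) + (1 + drift_mean t u / of_nat n) * corrected n k"
    unfolding inner corrected_def using e corrected_weight_integrable[OF n, of k] by simp
  finally show ?thesis by simp
qed

text \<open>The finitely many states \<open>x \<le> K\<close> are handled by the pointwise limit,
  through the sum \<open>S n\<close>; those above \<open>K\<close> by the cubic bound and the tail
  of the dominating law. Neither part depends on \<open>k\<close>.\<close>

lemma step_error_uniform:
  assumes e: "e > 0"
  shows "\<forall>\<^sub>F n in sequentially. \<forall>k. real n * cmod (corrected n (Suc k) - (1 + drift_mean t u / of_nat n) * corrected n k) \<le> e"
proof -
  obtain C where C: "C \<ge> 0" "\<And>n x. n > 0 \<Longrightarrow> real n * cmod (step_error t u h n x) \<le> C * (1 + real x ^ 3)"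
    using step_error_bound[OF h P] by blast
  have "(\<lambda>K. C * measure_pmf.expectation dominating_law (cube_tail K)) \<longlonglongrightarrow> 0"
    by (rule tendsto_mult_right_zero[OF tail_limit])
  then obtain K where K: "C * measure_pmf.expectation dominating_law (cube_tail K) < e / 2"
    using order_tendstoD(2)[of _ 0 sequentially "e/2"] e unfolding eventually_sequentially by (metis half_gt_zero order_refl)
  define S where "S = (\<lambda>n. \<Sum>x\<le>K. real n * cmod (step_error t u h n x))"
  have "S \<longlonglongrightarrow> (\<Sum>x\<le>K. 0)"
    unfolding S_def
  proof (intro tendsto_sum)
    fix x
    show "(\<lambda>n. real n * cmod (step_error t u h n x)) \<longlonglongrightarrow> 0"
      using tendsto_norm_zero[OF step_error_limit[OF h_integrable P, of x]] by (simp add: norm_mult)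
  qed
  then have "\<forall>\<^sub>F n in sequentially. S n < e / 2" using order_tendstoD(2)[of S 0 sequentially "e/2"] e by simp
  then show ?thesis using eventually_gt_at_top[of 0]
  proof eventually_elim
    case (elim n)
    have S0: "S n \<ge> 0" unfolding S_def by (intro sum_nonneg) auto
    have pt: "real n * cmod (step_error t u h n x) \<le> S n + C * cube_tail K x" for x
    proof (cases "x \<le> K")
      case True
      then have "real n * cmod (step_error t u h n x) \<le> S n" unfolding S_def by (intro member_le_sum) auto
      then show ?thesis using cube_tail_nonneg[of K x] C(1) by (simp add: add_increasing2)
    next
      case False
      then show ?thesis using C(2)[of n x] elim S0 by (simp add: cube_tail_def)
    qed
    show ?case
    proof
      fix k
      have it: "integrable (measure_pmf (chain k \<nu>)) (\<lambda>s. cube_tail K (fst s))"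
        by (rule chain_dom[OF mono_cube_tail cube_tail_nonneg dominating_law_tail])
      have b: "cmod (of_nat n * (weight t u n s * step_error t u h n (fst s))) \<le> S n + C * cube_tail K (fst s)" for s
        using pt[of "fst s"] by (simp add: norm_mult)
      have i: "integrable (measure_pmf (chain k \<nu>)) (\<lambda>s. of_nat n * (weight t u n s * step_error t u h n (fst s)))"
      proof (rule Bochner_Integration.integrable_bound)
        show "integrable (measure_pmf (chain k \<nu>)) (\<lambda>s. S n + C * cube_tail K (fst s))" using it by simp
        show "AE s in measure_pmf (chain k \<nu>). cmod (of_nat n * (weight t u n s * step_error t u h n (fst s))) \<le> norm (S n + C * cube_tail K (fst s))"
          using b by (intro AE_I2) (metis abs_ge_self order_trans real_norm_def)
      qed auto
      have "real n * cmod (corrected n (Suc k) - (1 + drift_mean t u / of_nat n) * corrected n k) =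
        cmod (of_nat n * measure_pmf.expectation (chain k \<nu>) (\<lambda>s. weight t u n s * step_error t u h n (fst s)))"
        using elim by (simp add: corrected_Suc norm_mult)
      also have "of_nat n * measure_pmf.expectation (chain k \<nu>) (\<lambda>s. weight t u n s * step_error t u h n (fst s)) =
        measure_pmf.expectation (chain k \<nu>) (\<lambda>s. of_nat n * (weight t u n s * step_error t u h n (fst s)))"
        by (rule Bochner_Integration.integral_mult_right_zero[symmetric])
      also have "cmod \<dots> \<le> measure_pmf.expectation (chain k \<nu>) (\<lambda>s. S n + C * cube_tail K (fst s))"
        by (rule integral_norm_le_integral[OF i _ b]) (use it in simp)
      also have "\<dots> = S n + C * measure_pmf.expectation (chain k \<nu>) (\<lambda>s. cube_tail K (fst s))"
        using it by simp
      also have "\<dots> \<le> S n + C * measure_pmf.expectation dominating_law (cube_tail K)"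
        by (intro add_left_mono mult_left_mono chain_dom(2)[OF mono_cube_tail cube_tail_nonneg dominating_law_tail] C)
      also have "\<dots> \<le> e" using elim K by simp
      finally show "real n * cmod (corrected n (Suc k) - (1 + drift_mean t u / of_nat n) * corrected n k) \<le> e" .
    qed
  qed
qed

lemma norm_exp_drift_mean: "cmod (exp (drift_mean t u / of_nat n)) \<le> 1"
proof -
  have "Re (drift_mean t u / of_nat n) = - t\<^sup>2 / 2 * score_var / real n"
    by (simp add: drift_mean_def Re_divide_of_nat)
  then have "Re (drift_mean t u / of_nat n) \<le> 0" using score_var_pos by (simp add: divide_nonpos_nonneg)
  then show ?thesis by (simp add: norm_exp_eq_Re)
qed

text \<open>At most \<open>n\<close> steps with error \<open>o(1 / n)\<close> each are compared with
  the exact power of \<open>w n\<close>. The fixed delay \<open>N\<close> disappears because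
  \<open>(n - N) / n\<close> tends to 1.\<close>

lemma corrected_limit: "(\<lambda>n. corrected n (n - N)) \<longlonglongrightarrow> exp (drift_mean t u)"
proof -
  define w where "w = (\<lambda>n. exp (drift_mean t u / of_nat n))"
  define A where "A = (1 + cubic_bound) * measure_pmf.expectation dominating_law (\<lambda>y. 1 + real y ^ 3)"
  have A: "\<And>n k. n > 0 \<Longrightarrow> cmod (corrected n k) \<le> A" unfolding A_def by (rule corrected_bound)
  have "(\<lambda>n. of_nat n * (w n - 1) - drift_mean t u) \<longlonglongrightarrow> drift_mean t u - drift_mean t u"
    unfolding w_def by (intro tendsto_intros exp_over_n_limit)
  then have "(\<lambda>n. cmod (of_nat n * (w n - 1) - drift_mean t u) * A) \<longlonglongrightarrow> cmod 0 * A"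
    by (intro tendsto_intros) simp
  then have wA: "(\<lambda>n. cmod (of_nat n * (w n - 1) - drift_mean t u) * A) \<longlonglongrightarrow> 0" by simp
  have 1: "(\<lambda>n. corrected n (n - N) - w n ^ (n - N) * corrected n 0) \<longlonglongrightarrow> 0"
  proof (rule LIMSEQ_I)
    fix r :: real assume r: "r > 0"
    have "\<forall>\<^sub>F n in sequentially. cmod (of_nat n * (w n - 1) - drift_mean t u) * A < r / 3"
      using order_tendstoD(2)[OF wA, of "r/3"] r by simp
    moreover have "\<forall>\<^sub>F n in sequentially. \<forall>k. real n * cmod (corrected n (Suc k) - (1 + drift_mean t u / of_nat n) * corrected n k) \<le> r / 3"
      by (rule step_error_uniform) (use r in simp)
    ultimately have "\<forall>\<^sub>F n in sequentially. norm (corrected n (n - N) - w n ^ (n - N) * corrected n 0 - 0) < r"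
      using eventually_gt_at_top[of 0]
    proof eventually_elim
      case (elim n)
      \<comment> \<open>One third of \<open>r\<close> for the step error and one third for replacing
        \<open>1 + drift_mean t u / n\<close> by \<open>w n\<close>; the last third makes the final
        inequality strict.\<close>
      define \<delta> where "\<delta> = 2 * r / 3 / real n"
      have "cmod (corrected n (Suc k) - w n * corrected n k) \<le> \<delta>" for k
      proof -
        have eq: "of_nat n * (corrected n (Suc k) - w n * corrected n k) = of_nat n * (corrected n (Suc k) - (1 + drift_mean t u / of_nat n) * corrected n k)
           - (of_nat n * (w n - 1) - drift_mean t u) * corrected n k"
          using elim by (simp add: field_simps)
        have "real n * cmod (corrected n (Suc k) - w n * corrected n k) = cmod (of_nat n * (corrected n (Suc k) - w n * corrected n k))"
          by (simp add: norm_mult)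
        also have "\<dots> \<le> real n * cmod (corrected n (Suc k) - (1 + drift_mean t u / of_nat n) * corrected n k) + cmod (of_nat n * (w n - 1) - drift_mean t u) * cmod (corrected n k)"
          unfolding eq by (rule norm_triangle_le_diff) (simp add: norm_mult)
        also have "\<dots> \<le> r / 3 + cmod (of_nat n * (w n - 1) - drift_mean t u) * A"
          using elim A by (intro add_mono mult_left_mono) auto
        also have "\<dots> \<le> 2 * r / 3" using elim by simp
        finally show ?thesis using elim by (simp add: \<delta>_def field_simps)
      qed
      from approx_recursion[of "w n" "corrected n", OF _ this]
      have "cmod (corrected n (n - N) - w n ^ (n - N) * corrected n 0) \<le> real (n - N) * \<delta>"
        using norm_exp_drift_mean by (simp add: w_def)
      also have "\<dots> \<le> real n * \<delta>" using r by (intro mult_right_mono) (auto simp: \<delta>_def)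
      also have "\<dots> < r" using elim r by (simp add: \<delta>_def)
      finally show ?case by simp
    qed
    then show "\<exists>n0. \<forall>n\<ge>n0. norm (corrected n (n - N) - w n ^ (n - N) * corrected n 0 - 0) < r"
      unfolding eventually_sequentially .
  qed
  \<comment> \<open>The sums already present in the initial law are fixed while their scaling grows,
    so the initial law leaves no trace.\<close>
  have "(\<lambda>n. corrected n 0) \<longlonglongrightarrow> measure_pmf.expectation \<nu> (\<lambda>s. 1)"
    unfolding corrected_def chain_0
  proof (rule integral_dominated_convergence[where w = "\<lambda>s. 1 + (1 + cubic_bound) * (1 + real (fst s) ^ 3)"])
    show "integrable (measure_pmf \<nu>) (\<lambda>s. 1 + (1 + cubic_bound) * (1 + real (fst s) ^ 3))" using nu by simp
    show "AE s in measure_pmf \<nu>. (\<lambda>n. weight t u n s * (1 + h (fst s) / of_nat n)) \<longlonglongrightarrow> 1"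
    proof (intro AE_I2)
      fix s :: state
      have "(\<lambda>n. t * fst (snd s) / sqrt (real n) + u * snd (snd s) / real n) \<longlonglongrightarrow> 0" by real_asymp
      then have F: "(\<lambda>n. weight t u n s) \<longlonglongrightarrow> iexp 0" unfolding weight_def by (intro tendsto_intros)
      have "(\<lambda>n. h (fst s) / of_nat n) \<longlonglongrightarrow> 0"
        by (intro tendsto_divide_0[OF tendsto_const] tendsto_of_nat)
      from tendsto_mult[OF F tendsto_add[OF tendsto_const this, of 1]]
      show "(\<lambda>n. weight t u n s * (1 + h (fst s) / of_nat n)) \<longlonglongrightarrow> 1" by simp
    qed
    show "AE s in measure_pmf \<nu>. cmod (weight t u n s * (1 + h (fst s) / of_nat n)) \<le> 1 + (1 + cubic_bound) * (1 + real (fst s) ^ 3)" for n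
    proof (cases "n = 0")
      case True
      then show ?thesis by (auto simp: cubic_bound_def norm_mult)
    next
      case False
      then show ?thesis using corrected_weight_norm[of n] by (intro AE_I2) (smt (verit) not_gr0)
    qed
  qed auto
  then have a0: "(\<lambda>n. corrected n 0) \<longlonglongrightarrow> 1" by simp
  have "(\<lambda>n. w n ^ (n - N)) \<longlonglongrightarrow> exp (drift_mean t u)"
  proof (rule Lim_transform_eventually)
    have "(\<lambda>n. 1 - real N / real n) \<longlonglongrightarrow> 1" by real_asymp
    then have "(\<lambda>n. exp (complex_of_real (1 - real N / real n) * drift_mean t u)) \<longlonglongrightarrow> exp (complex_of_real 1 * drift_mean t u)"
      by (intro tendsto_intros)
    then show "(\<lambda>n. exp (complex_of_real (1 - real N / real n) * drift_mean t u)) \<longlonglongrightarrow> exp (drift_mean t u)" by simp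
    show "\<forall>\<^sub>F n in sequentially. exp (complex_of_real (1 - real N / real n) * drift_mean t u) = w n ^ (n - N)"
      using eventually_gt_at_top[of 0] eventually_ge_at_top[of N]
    proof eventually_elim
      case (elim n)
      have "w n ^ (n - N) = exp (of_nat (n - N) * (drift_mean t u / of_nat n))"
        unfolding w_def by (rule exp_of_nat_mult[symmetric])
      also have "of_nat (n - N) * (drift_mean t u / of_nat n) = complex_of_real (1 - real N / real n) * drift_mean t u"
        using elim by (simp add: of_nat_diff field_simps)
      finally show ?case by simp
    qed
  qed
  from tendsto_add[OF 1 tendsto_mult[OF this a0]] show ?thesis by simp
qed

text \<open>The corrector has done its work and is removed: its mean is bounded by \<open>B\<close>
  at all times, so it contributes at most \<open>B / n\<close>.\<close>

lemma weight_limit_aux: "(\<lambda>n. measure_pmf.expectation (chain (n - N) \<nu>) (weight t u n)) \<longlonglongrightarrow> exp (drift_mean t u)"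
proof -
  define B where "B = cubic_bound * measure_pmf.expectation dominating_law (\<lambda>y. 1 + real y ^ 3)"
  have ih: "integrable (measure_pmf (chain k \<nu>)) (\<lambda>s. weight t u n s * h (fst s))" for n k
  proof (rule Bochner_Integration.integrable_bound)
    show "integrable (measure_pmf (chain k \<nu>)) (\<lambda>s. cubic_bound * (1 + real (fst s) ^ 3))" using chain_cube(1)[of k] by simp
    show "AE s in measure_pmf (chain k \<nu>). cmod (weight t u n s * h (fst s)) \<le> norm (cubic_bound * (1 + real (fst s) ^ 3))"
      using h_bound by (intro AE_I2) (simp add: norm_mult, metis abs_ge_self order_trans)
  qed auto
  have iF: "integrable (measure_pmf (chain k \<nu>)) (weight t u n)" for n k
    by (rule integrable_pmf_bounded[where B = 1]) simp
  have eq: "corrected n k = measure_pmf.expectation (chain k \<nu>) (weight t u n)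
      + measure_pmf.expectation (chain k \<nu>) (\<lambda>s. weight t u n s * h (fst s)) / of_nat n" for n k
  proof -
    have "corrected n k = measure_pmf.expectation (chain k \<nu>) (\<lambda>s. weight t u n s + weight t u n s * h (fst s) / of_nat n)"
      unfolding corrected_def by (simp add: distrib_left)
    also have "\<dots> = measure_pmf.expectation (chain k \<nu>) (weight t u n)
      + measure_pmf.expectation (chain k \<nu>) (\<lambda>s. weight t u n s * h (fst s)) / of_nat n"
      using ih iF by simp
    finally show ?thesis .
  qed
  have bd: "cmod (measure_pmf.expectation (chain k \<nu>) (\<lambda>s. weight t u n s * h (fst s))) \<le> B" for n k
  proof -
    have "cmod (measure_pmf.expectation (chain k \<nu>) (\<lambda>s. weight t u n s * h (fst s))) \<le>
        measure_pmf.expectation (chain k \<nu>) (\<lambda>s. cubic_bound * (1 + real (fst s) ^ 3))"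
      by (rule integral_norm_le_integral[OF ih]) (use chain_cube(1)[of k] h_bound in \<open>auto simp: norm_mult\<close>)
    also have "\<dots> = cubic_bound * measure_pmf.expectation (chain k \<nu>) (\<lambda>s. 1 + real (fst s) ^ 3)"
      by (rule Bochner_Integration.integral_mult_right_zero)
    also have "\<dots> \<le> B" unfolding B_def by (intro mult_left_mono chain_cube(2)) (auto simp: cubic_bound_def)
    finally show ?thesis .
  qed
  have "(\<lambda>n. measure_pmf.expectation (chain (n - N) \<nu>) (\<lambda>s. weight t u n s * h (fst s)) / of_nat n) \<longlonglongrightarrow> 0"
  proof (rule Lim_null_comparison)
    show "(\<lambda>n. B / real n) \<longlonglongrightarrow> 0" by real_asymp
    show "\<forall>\<^sub>F n in sequentially. norm (measure_pmf.expectation (chain (n - N) \<nu>) (\<lambda>s. weight t u n s * h (fst s)) / of_nat n) \<le> B / real n"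
      using bd by (intro always_eventually allI) (simp add: norm_divide divide_right_mono)
  qed
  from tendsto_diff[OF corrected_limit[of N] this] show ?thesis unfolding eq by simp
qed

end

theorem weight_limit:
  assumes "integrable (measure_pmf \<nu>) (\<lambda>c. real (fst c) ^ 3)"
  shows "(\<lambda>n. measure_pmf.expectation (chain (n - N) \<nu>) (weight t u n)) \<longlonglongrightarrow> exp (drift_mean t u)"
proof -
  obtain a b c where "\<And>x. drift t u x = drift_mean t u + cubic a b c x - measure_pmf.expectation (step x) (cubic a b c)"
    using poisson by blast
  from weight_limit_aux[OF assms refl this] show ?thesis .
qed

end

section \<open>Normal limit of the ratio statistic\<close>

text \<open>Negative \<open>\<sigma>\<close> is allowed, so that the symmetry of the centered normal
  law is included.\<close>

lemma normal_distribution_eq_distr: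
  assumes "\<sigma> \<noteq> 0"
  shows "density lborel (normal_density 0 \<bar>\<sigma>\<bar>) = distr std_normal_distribution borel (\<lambda>z. \<sigma> * z)"
proof -
  interpret prob_space std_normal_distribution by (rule prob_space_normal_density) simp
  have "distributed std_normal_distribution lborel (\<lambda>x. x) std_normal_density"
    unfolding distributed_def by (auto simp: distr_id2)
  from normal_density_affine[OF this, of \<sigma> 0] assms
  have "distributed std_normal_distribution lborel (\<lambda>x. \<sigma> * x) (normal_density 0 \<bar>\<sigma>\<bar>)" by simp
  from distributed_distr_eq_density[OF this]
  have "distr std_normal_distribution lborel (\<lambda>x. \<sigma> * x) = density lborel (normal_density 0 \<bar>\<sigma>\<bar>)" by simp
  moreover have "distr std_normal_distribution lborel (\<lambda>x. \<sigma> * x) = distr std_normal_distribution borel (\<lambda>x. \<sigma> * x)"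
    by (rule distr_cong) auto
  ultimately show ?thesis by simp
qed

lemma std_normal_null: "measure std_normal_distribution {x} = 0"
proof -
  have "emeasure std_normal_distribution {x} = 0"
    by (subst emeasure_density) (auto simp: nn_integral_0_iff_AE AE_lborel_singleton[of x, THEN eventually_mono] indicator_def)
  then show ?thesis by (simp add: measure_def)
qed

lemma cdf_normal:
  assumes "\<sigma> > 0"
  shows "cdf (density lborel (normal_density 0 \<sigma>)) x = cdf std_normal_distribution (x / \<sigma>)"
proof -
  have "(\<lambda>z. \<sigma> * z) -` {..x} = {..x / \<sigma>}" using assms by (auto simp: field_simps)
  then show ?thesis
    using normal_distribution_eq_distr[of \<sigma>] assms by (simp add: cdf_def measure_distr)
qed

context inar_chain
begin

text \<open>For fixed \<open>x\<close> the characteristic function at \<open>s\<close> of the linear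
  combination is the mean of \<open>weight s (- s * x) n\<close>, so Levy's theorem gives the limit
  \<open>N(- x m2, score_var)\<close>. This law has no atom at 0, so the probabilities of being at
  most 0 converge, to the standard normal cdf at \<open>x m2 / sqrt score_var\<close>.\<close>

lemma ratio_limit:
  assumes nu: "integrable (measure_pmf \<nu>) (\<lambda>c. real (fst c) ^ 3)"
  shows "(\<lambda>n. measure_pmf.prob (chain (n - N) \<nu>) {c. fst (snd c) / sqrt (real n) - x * snd (snd c) / real n \<le> 0})
    \<longlonglongrightarrow> cdf (density lborel (normal_density 0 (sqrt (score_var / m2\<^sup>2)))) x"
proof -
  interpret std: real_distribution std_normal_distribution by (rule real_dist_normal_dist)
  define X where "X = (\<lambda>n (c::state). fst (snd c) / sqrt (real n) - x * snd (snd c) / real n)"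
  define \<mu> where "\<mu> = (\<lambda>n. distr (measure_pmf (chain (n - N) \<nu>)) borel (X n))"
  define L where "L = distr std_normal_distribution borel (\<lambda>z. sqrt score_var * z - x * m2)"
  have \<mu>: "real_distribution (\<mu> n)" for n
    unfolding \<mu>_def by (intro prob_space.real_distribution_distr measure_pmf.prob_space_axioms) simp
  have L: "real_distribution L"
    unfolding L_def by (intro std.real_distribution_distr) simp
  interpret L: real_distribution L by (rule L)
  have "char (\<mu> n) s = measure_pmf.expectation (chain (n - N) \<nu>) (weight s (- s * x) n)" for n s
  proof -
    have "weight s (- s * x) n = (\<lambda>c. iexp (s * X n c))"
      unfolding weight_def X_def by (rule ext, rule arg_cong[where f = iexp]) (simp add: algebra_simps)
    then show ?thesis unfolding char_def \<mu>_def by (subst integral_distr) auto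
  qed
  moreover have "char L s = exp (drift_mean s (- s * x))" for s
  proof -
    have "char L s = (\<integral>z. iexp (s * (sqrt score_var * z - x * m2)) \<partial>std_normal_distribution)"
      unfolding char_def L_def by (subst integral_distr) auto
    also have "\<dots> = (\<integral>z. iexp (- s * x * m2) * iexp ((s * sqrt score_var) * z) \<partial>std_normal_distribution)"
      by (intro Bochner_Integration.integral_cong) (auto simp: exp_add[symmetric] algebra_simps)
    also have "\<dots> = iexp (- s * x * m2) * char std_normal_distribution (s * sqrt score_var)"
      unfolding char_def by (rule Bochner_Integration.integral_mult_right_zero)
    also have "char std_normal_distribution (s * sqrt score_var) = complex_of_real (exp (- (s * sqrt score_var)\<^sup>2 / 2))"
      by (simp add: char_std_normal_distribution)
    also have "(s * sqrt score_var)\<^sup>2 = s\<^sup>2 * score_var" using score_var_pos by (simp add: power_mult_distrib)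
    also have "iexp (- s * x * m2) * complex_of_real (exp (- (s\<^sup>2 * score_var) / 2)) = exp (drift_mean s (- s * x))"
      unfolding drift_mean_def exp_of_real[symmetric] exp_add[symmetric] by (simp add: algebra_simps)
    finally show ?thesis .
  qed
  ultimately have "(\<lambda>n. char (\<mu> n) s) \<longlonglongrightarrow> char L s" for s
    using weight_limit[OF nu, of N s "- s * x"] by simp
  from levy_continuity[OF \<mu> L this] have "weak_conv_m \<mu> L" by auto
  moreover have "isCont (cdf L) 0"
  proof -
    have "(\<lambda>z. sqrt score_var * z - x * m2) -` {0} = {x * m2 / sqrt score_var}"
      using score_var_pos by (auto simp: field_simps)
    then have "measure L {0} = 0" unfolding L_def by (subst measure_distr) (auto simp: std_normal_null)
    then show ?thesis by (simp add: L.isCont_cdf)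
  qed
  ultimately have "(\<lambda>n. cdf (\<mu> n) 0) \<longlonglongrightarrow> cdf L 0"
    by (auto simp: weak_conv_m_def weak_conv_def)
  moreover have "cdf (\<mu> n) 0 = measure_pmf.prob (chain (n - N) \<nu>) {c. X n c \<le> 0}" for n
    unfolding cdf_def \<mu>_def by (subst measure_distr) (auto simp: vimage_def)
  moreover have "cdf L 0 = cdf (density lborel (normal_density 0 (sqrt (score_var / m2\<^sup>2)))) x"
  proof -
    have s: "sqrt (score_var / m2\<^sup>2) = sqrt score_var / m2" using m2_pos by (simp add: real_sqrt_divide)
    have "(\<lambda>z. sqrt score_var * z - x * m2) -` {..0} = {..x * m2 / sqrt score_var}"
      using score_var_pos by (auto simp: field_simps)
    then have "cdf L 0 = cdf std_normal_distribution (x * m2 / sqrt score_var)"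
      unfolding L_def cdf_def by (subst measure_distr) auto
    also have "\<dots> = cdf (density lborel (normal_density 0 (sqrt score_var / m2))) x"
      using score_var_pos m2_pos by (subst cdf_normal) auto
    finally show ?thesis unfolding s .
  qed
  ultimately show ?thesis unfolding X_def by simp
qed

end

section \<open>Histories of the outlier process\<close>

lemma countable_measure_pmf:
  fixes D :: "'b::countable measure"
  assumes "prob_space D" "sets D = UNIV"
  obtains q where "measure_pmf q = D"
proof -
  interpret D: prob_space D by fact
  have "AE x in D. measure D {x} \<noteq> 0"
    using D.AE_support_countable[OF assms(2)] by (auto intro!: exI[of _ UNIV] countableI_type)
  then have "measure_pmf (Abs_pmf D) = D"
    using assms by (intro Abs_pmf_inverse) auto
  then show ?thesis using that by blast
qed

text \<open>Makes the unconditional statement the case of conditioning on the whole space.\<close>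

lemma uniform_measure_whole: "prob_space M \<Longrightarrow> uniform_measure M (space M) = M"
  by (intro measure_eqI) (auto simp: prob_space.emeasure_space_1 divide_ennreal_def)

lemma measurable_add_nat:
  fixes f g :: "'a \<Rightarrow> nat"
  assumes [measurable]: "f \<in> measurable N (count_space UNIV)" "g \<in> measurable N (count_space UNIV)"
  shows "(\<lambda>\<omega>. f \<omega> + g \<omega>) \<in> measurable N (count_space UNIV)"
  by measurable

lemma measurable_sum_nat:
  fixes f :: "nat \<Rightarrow> 'a \<Rightarrow> nat"
  assumes "\<And>j. j \<in> S \<Longrightarrow> f j \<in> measurable N (count_space UNIV)"
  shows "(\<lambda>\<omega>. \<Sum>j\<in>S. f j \<omega>) \<in> measurable N (count_space UNIV)"
  using assms by (induction S rule: infinite_finite_induct) (auto intro: measurable_add_nat)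

locale inar_model = prob_space M + inar_chain \<alpha> epsd
  for M :: "'a measure" and \<alpha> :: real and epsd :: "nat pmf" +
  fixes eps :: "nat \<Rightarrow> 'a \<Rightarrow> nat" and xi :: "nat \<Rightarrow> nat \<Rightarrow> 'a \<Rightarrow> nat" and Y0 :: "'a \<Rightarrow> nat"
    and s1 s2 th1 th2 :: nat
  assumes indep: "indep_vars (\<lambda>_. count_space UNIV) (inar_family eps xi Y0) inar_index"
    and eps_law: "\<And>k. k \<ge> 1 \<Longrightarrow> distr M (count_space UNIV) (eps k) = measure_pmf epsd"
    and xi_law: "\<And>k j. k \<ge> 1 \<Longrightarrow> j \<ge> 1 \<Longrightarrow>
       distr M (count_space UNIV) (xi k j) = measure_pmf (map_pmf of_bool (bernoulli_pmf \<alpha>))"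
    and Y0_cube: "integrable M (\<lambda>\<omega>. real (Y0 \<omega>) ^ 3)"
begin

abbreviation X :: "inar_idx \<Rightarrow> 'a \<Rightarrow> nat" where "X \<equiv> inar_family eps xi Y0"

abbreviation Y :: "nat \<Rightarrow> 'a \<Rightarrow> nat" where "Y \<equiv> Yproc eps xi Y0 s1 s2 th1 th2"

definition restr :: "inar_idx set \<Rightarrow> 'a \<Rightarrow> inar_idx \<Rightarrow> nat" where
  "restr I \<omega> = restrict (\<lambda>i. X i \<omega>) I"

text \<open>The sigma-algebra generated by the variables with index in \<open>I\<close>, presented
  through their joint map so that independence of disjoint groups applies directly.\<close>

definition sub_sigma :: "inar_idx set \<Rightarrow> 'a measure" where
  "sub_sigma I = vimage_algebra (space M) (restr I) (PiM I (\<lambda>_. count_space UNIV))"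

lemma space_sub_sigma [simp]: "space (sub_sigma I) = space M"
  by (simp add: sub_sigma_def)

lemma restr_space: "restr I \<in> space M \<rightarrow> space (PiM I (\<lambda>_. count_space UNIV))"
  by (auto simp: restr_def space_PiM)

lemma sets_sub_sigma: "sets (sub_sigma I) = {restr I -` B \<inter> space M |B. B \<in> sets (PiM I (\<lambda>_. count_space UNIV))}"
  unfolding sub_sigma_def by (rule sets_vimage_algebra2[OF restr_space])

lemma X_sub_sigma: "i \<in> I \<Longrightarrow> X i \<in> measurable (sub_sigma I) (count_space UNIV)"
proof -
  assume i: "i \<in> I"
  have "restr I \<in> measurable (sub_sigma I) (PiM I (\<lambda>_. count_space UNIV))"
    unfolding sub_sigma_def by (rule measurable_vimage_algebra1[OF restr_space])
  from measurable_compose[OF this measurable_component_singleton[OF i]]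
  show ?thesis using i by (simp add: restr_def)
qed

lemma sub_sigma_mono: assumes "I \<subseteq> J" shows "sets (sub_sigma I) \<subseteq> sets (sub_sigma J)"
proof
  fix E assume "E \<in> sets (sub_sigma I)"
  then obtain B where B: "B \<in> sets (PiM I (\<lambda>_. count_space UNIV))" "E = restr I -` B \<inter> space M"
    unfolding sets_sub_sigma by blast
  have "restr I \<in> measurable (sub_sigma J) (PiM I (\<lambda>_. count_space UNIV))"
    unfolding restr_def by (rule measurable_restrict) (use assms X_sub_sigma in blast)
  from measurable_sets[OF this B(1)] show "E \<in> sets (sub_sigma J)" by (simp add: B(2))
qed

lemma X_rv: "i \<in> inar_index \<Longrightarrow> X i \<in> measurable M (count_space UNIV)"
  using indep by (auto simp: indep_vars_def)

lemma sub_sigma_events: assumes "I \<subseteq> inar_index" shows "sets (sub_sigma I) \<subseteq> events"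
proof
  fix E assume "E \<in> sets (sub_sigma I)"
  then obtain B where B: "B \<in> sets (PiM I (\<lambda>_. count_space UNIV))" "E = restr I -` B \<inter> space M"
    unfolding sets_sub_sigma by blast
  have "restr I \<in> measurable M (PiM I (\<lambda>_. count_space UNIV))"
    unfolding restr_def by (rule measurable_restrict) (use assms X_rv in blast)
  from measurable_sets[OF this B(1)] show "E \<in> events" by (simp add: B(2))
qed

lemma sub_sigma_measurable_M:
  assumes "I \<subseteq> inar_index" "f \<in> measurable (sub_sigma I) N" shows "f \<in> measurable M N"
  using assms(2) sub_sigma_events[OF assms(1)] unfolding measurable_def by auto

lemma sub_sigma_indep:
  assumes "I \<subseteq> inar_index" "i \<in> inar_index" "i \<notin> I" "E \<in> sets (sub_sigma I)"
  shows "prob (E \<inter> {\<omega> \<in> space M. X i \<omega> = a}) = prob E * prob {\<omega> \<in> space M. X i \<omega> = a}"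
proof -
  obtain B where B: "B \<in> sets (PiM I (\<lambda>_. count_space UNIV))" "E = restr I -` B \<inter> space M"
    using assms(4) unfolding sets_sub_sigma by blast
  let ?C = "{w \<in> space (PiM {i} (\<lambda>_. count_space UNIV)). w i = a}"
  have C: "?C \<in> sets (PiM {i} (\<lambda>_. count_space UNIV))"
    by measurable
  have iv: "indep_var (PiM I (\<lambda>_. count_space UNIV)) (restr I) (PiM {i} (\<lambda>_. count_space UNIV)) (restr {i})"
    unfolding restr_def by (rule indep_var_restrict[OF indep]) (use assms in auto)
  have eq: "restr {i} -` ?C \<inter> space M = {\<omega> \<in> space M. X i \<omega> = a}"
    by (auto simp: restr_def space_PiM)
  have "(\<lambda>x. (restr I x, restr {i} x)) -` (B \<times> ?C) \<inter> space M = E \<inter> {\<omega> \<in> space M. X i \<omega> = a}"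
    unfolding eq[symmetric] B(2) by auto
  with indep_varD[OF iv B(1) C] show ?thesis unfolding eq B(2) by simp
qed

text \<open>The step at time \<open>k\<close> from a deterministic population \<open>x\<close>,
  without outlier. On an event that fixes the history, the random number of summands becomes such an
  \<open>x\<close>.\<close>

definition Zsum :: "nat \<Rightarrow> nat \<Rightarrow> 'a \<Rightarrow> nat" where
  "Zsum k x \<omega> = (\<Sum>j = 1..x. xi k j \<omega>) + eps k \<omega>"

lemma eps_prob: "k \<ge> 1 \<Longrightarrow> prob {\<omega> \<in> space M. eps k \<omega> = a} = pmf epsd a"
proof -
  assume k: "k \<ge> 1"
  have m: "eps k \<in> measurable M (count_space UNIV)"
    using X_rv[of "Inl k"] k by (simp add: inar_index_def)
  have "pmf epsd a = measure (distr M (count_space UNIV) (eps k)) {a}"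
    by (simp add: eps_law[OF k] measure_pmf_single)
  also have "\<dots> = prob {\<omega> \<in> space M. eps k \<omega> = a}"
    by (subst measure_distr[OF m]) (auto intro!: arg_cong[where f = prob])
  finally show ?thesis by simp
qed

lemma xi_prob: "k \<ge> 1 \<Longrightarrow> j \<ge> 1 \<Longrightarrow> prob {\<omega> \<in> space M. xi k j \<omega> = a} = pmf (map_pmf of_bool (bernoulli_pmf \<alpha>)) a"
proof -
  assume k: "k \<ge> 1" "j \<ge> 1"
  have m: "xi k j \<in> measurable M (count_space UNIV)"
    using X_rv[of "Inr (Inl (k, j))"] k by (simp add: inar_index_def)
  have "pmf (map_pmf of_bool (bernoulli_pmf \<alpha>)) a = measure (distr M (count_space UNIV) (xi k j)) {a}"
    by (simp add: xi_law[OF k] measure_pmf_single)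
  also have "\<dots> = prob {\<omega> \<in> space M. xi k j \<omega> = a}"
    by (subst measure_distr[OF m]) (auto intro!: arg_cong[where f = prob])
  finally show ?thesis by simp
qed

text \<open>The splitting recursion as a convolution, in the form in which \<open>Zsum\<close>
  acquires one more survival indicator.\<close>

lemma pmf_step_Suc:
  "pmf (step (Suc x)) z = (\<Sum>b\<le>z. pmf (map_pmf of_bool (bernoulli_pmf \<alpha>)) b * pmf (step x) (z - b))"
proof -
  have "(\<lambda>y. of_bool True + y) -` {z} = (if z = 0 then {} else {z - 1})" by auto
  then have T: "pmf (map_pmf (\<lambda>y. of_bool True + y) (step x)) z = (if z = 0 then 0 else pmf (step x) (z - 1))"
    unfolding pmf_map by (cases "z = 0") (simp_all only: measure_pmf_single measure_empty if_True if_False simp_thms)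
  have "(\<lambda>y. of_bool False + y) -` {z} = {z}" by auto
  then have F: "pmf (map_pmf (\<lambda>y. of_bool False + y) (step x)) z = pmf (step x) z"
    unfolding pmf_map by (simp only: measure_pmf_single)
  have L: "pmf (step (Suc x)) z = \<alpha> * (if z = 0 then 0 else pmf (step x) (z - 1)) + (1 - \<alpha>) * pmf (step x) z"
    unfolding inar_step_Suc[OF \<alpha>_le] pmf_bind using \<alpha>_le
    by (simp only: integral_bernoulli_pmf[OF \<alpha>_le] T F mult.commute)
  have B: "pmf (map_pmf of_bool (bernoulli_pmf \<alpha>)) b = (if b = 0 then 1 - \<alpha> else if b = 1 then \<alpha> else 0)" for b :: nat
  proof -
    have v: "(of_bool :: bool \<Rightarrow> nat) -` {b} = (if b = 0 then {False} else if b = 1 then {True} else {})"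
      (is "?L = ?R")
    proof (rule set_eqI)
      fix c show "c \<in> ?L \<longleftrightarrow> c \<in> ?R" by (cases c) auto
    qed
    have "pmf (bernoulli_pmf \<alpha>) True = \<alpha>" "pmf (bernoulli_pmf \<alpha>) False = 1 - \<alpha>" using \<alpha>_le by auto
    then show ?thesis unfolding pmf_map v by (auto simp: measure_pmf_single)
  qed
  have "(\<Sum>b\<le>z. pmf (map_pmf of_bool (bernoulli_pmf \<alpha>)) b * pmf (step x) (z - b)) =
      (\<Sum>b\<in>(if z = 0 then {0} else {0, 1}). pmf (map_pmf of_bool (bernoulli_pmf \<alpha>)) b * pmf (step x) (z - b))"
    unfolding B by (rule sum.mono_neutral_right) (auto split: if_splits)
  also have "\<dots> = pmf (step (Suc x)) z" unfolding L B by (cases "z = 0") simp_all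
  finally show ?thesis by simp
qed

lemma Zsum_sub_sigma:
  assumes "Inl k \<in> I" "\<And>j. 1 \<le> j \<Longrightarrow> j \<le> x \<Longrightarrow> Inr (Inl (k, j)) \<in> I"
  shows "Zsum k x \<in> measurable (sub_sigma I) (count_space UNIV)"
  unfolding Zsum_def
proof (intro measurable_add_nat measurable_sum_nat)
  show "eps k \<in> measurable (sub_sigma I) (count_space UNIV)" using X_sub_sigma[OF assms(1)] by simp
  fix j assume "j \<in> {1..x}"
  then show "xi k j \<in> measurable (sub_sigma I) (count_space UNIV)" using X_sub_sigma[OF assms(2)[of j]] by simp
qed

text \<open>Individuals are added one at a time: the next \<open>xi\<close> is independent of
  \<open>E\<close> together with everything already used, and conditioning on its value gives the
  convolution of \<open>pmf_step_Suc\<close>.\<close>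

lemma Zsum_law:
  assumes k: "k \<ge> 1" and I: "I \<subseteq> inar_index" "Inl k \<notin> I" "\<And>j. Inr (Inl (k, j)) \<notin> I" and E: "E \<in> sets (sub_sigma I)"
  shows "prob (E \<inter> {\<omega> \<in> space M. Zsum k x \<omega> = z}) = prob E * pmf (step x) z"
proof (induction x arbitrary: z)
  case 0
  have "prob (E \<inter> {\<omega> \<in> space M. X (Inl k) \<omega> = z}) = prob E * prob {\<omega> \<in> space M. X (Inl k) \<omega> = z}"
    by (rule sub_sigma_indep[OF I(1) _ I(2) E]) (use k in \<open>auto simp: inar_index_def\<close>)
  then show ?case using eps_prob[OF k] by (simp add: Zsum_def inar_step_0 \<alpha>_le)
next
  case (Suc x)
  \<comment> \<open>\<open>I\<close> enlarged by the variables that enter \<open>Zsum k x\<close>;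
    the index \<open>?i\<close> of the next individual is still outside.\<close>
  define J where "J = I \<union> {Inl k} \<union> (\<lambda>j. Inr (Inl (k, j))) ` {1..x}"
  let ?i = "Inr (Inl (k, Suc x)) :: inar_idx"
  have J: "J \<subseteq> inar_index" "?i \<notin> J" "?i \<in> inar_index"
    using I k by (auto simp: J_def inar_index_def)
  have Zm: "Zsum k x \<in> measurable (sub_sigma J) (count_space UNIV)"
    by (rule Zsum_sub_sigma) (auto simp: J_def)
  define A where "A = (\<lambda>b. E \<inter> {\<omega> \<in> space M. Zsum k x \<omega> = z - b})"
  have A: "A b \<in> sets (sub_sigma J)" for b
  proof -
    have "E \<in> sets (sub_sigma J)" using sub_sigma_mono[of I J] E by (auto simp: J_def)
    moreover have "{\<omega> \<in> space M. Zsum k x \<omega> = z - b} \<in> sets (sub_sigma J)"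
      using measurable_sets[OF Zm, of "{z - b}"] by (simp add: vimage_def Int_def conj_commute)
    ultimately show ?thesis unfolding A_def by auto
  qed
  define C where "C = (\<lambda>b. A b \<inter> {\<omega> \<in> space M. X ?i \<omega> = b})"
  have C: "C b \<in> events" for b
  proof -
    have "{\<omega> \<in> space M. X ?i \<omega> = b} \<in> events"
      using measurable_sets[OF X_rv[OF J(3)], of "{b}"] by (simp add: vimage_def Int_def conj_commute)
    then show ?thesis unfolding C_def using A[of b] sub_sigma_events[OF J(1)] by auto
  qed
  have "E \<inter> {\<omega> \<in> space M. Zsum k (Suc x) \<omega> = z} = (\<Union>b\<in>{..z}. C b)"
    unfolding C_def A_def Zsum_def by auto
  then have "prob (E \<inter> {\<omega> \<in> space M. Zsum k (Suc x) \<omega> = z}) = prob (\<Union>b\<in>{..z}. C b)"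
    by simp
  also have "\<dots> = (\<Sum>b\<le>z. prob (C b))"
    by (rule finite_measure_finite_Union) (use C in \<open>auto simp: disjoint_family_on_def C_def\<close>)
  also have "\<dots> = (\<Sum>b\<le>z. prob E * (pmf (map_pmf of_bool (bernoulli_pmf \<alpha>)) b * pmf (step x) (z - b)))"
  proof (rule sum.cong)
    fix b
    have "prob (C b) = prob (A b) * prob {\<omega> \<in> space M. X ?i \<omega> = b}"
      unfolding C_def by (rule sub_sigma_indep[OF J(1) J(3) J(2) A])
    also have "prob (A b) = prob E * pmf (step x) (z - b)" unfolding A_def by (rule Suc)
    finally show "prob (C b) = prob E * (pmf (map_pmf of_bool (bernoulli_pmf \<alpha>)) b * pmf (step x) (z - b))"
      using xi_prob[OF k, of "Suc x"] by simp
  qed simp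
  finally show ?case unfolding pmf_step_Suc sum_distrib_left .
qed

definition past :: "nat \<Rightarrow> inar_idx set" where
  "past k = Inl ` {1..k} \<union> Inr ` Inl ` ({1..k} \<times> {1..}) \<union> {Inr (Inr ())}"

lemma past_index: "past k \<subseteq> inar_index"
  by (auto simp: past_def inar_index_def)

lemma Y_sub_sigma: "i \<le> k \<Longrightarrow> Y i \<in> measurable (sub_sigma (past k)) (count_space UNIV)"
proof (induction i)
  case 0
  then show ?case using X_sub_sigma[of "Inr (Inr ())" "past k"] by (simp add: past_def)
next
  case (Suc i)
  then have Yi: "Y i \<in> measurable (sub_sigma (past k)) (count_space UNIV)" by simp
  have Z: "Zsum (Suc i) x \<in> measurable (sub_sigma (past k)) (count_space UNIV)" for x
    by (rule Zsum_sub_sigma) (use Suc.prems in \<open>auto simp: past_def\<close>)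
  have "(\<lambda>\<omega>. Zsum (Suc i) (Y i \<omega>) \<omega>) \<in> measurable (sub_sigma (past k)) (count_space UNIV)"
    by (rule measurable_compose_countable[OF Z Yi])
  moreover have "Y (Suc i) = (\<lambda>\<omega>. Zsum (Suc i) (Y i \<omega>) \<omega> + ((if Suc i = s1 then th1 else 0) + (if Suc i = s2 then th2 else 0)))"
    by (auto simp: Zsum_def fun_eq_iff)
  ultimately show ?case by (auto intro!: measurable_add_nat)
qed

lemma Y_rv [measurable]: "Y k \<in> measurable M (count_space UNIV)"
  by (rule sub_sigma_measurable_M[OF past_index Y_sub_sigma[OF order_refl]])

text \<open>Whole histories are kept because the conditioning events concern past values. Lists of
  naturals form a countable type, so the laws of histories are pmfs.\<close>

definition hist :: "nat \<Rightarrow> 'a \<Rightarrow> nat list" where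
  "hist k \<omega> = map (\<lambda>i. Y i \<omega>) (rev [0..<Suc k])"

lemma hist_Suc: "hist (Suc k) \<omega> = Y (Suc k) \<omega> # hist k \<omega>"
  by (simp add: hist_def)

lemma length_hist [simp]: "length (hist k \<omega>) = Suc k"
  by (simp add: hist_def)

lemma hd_hist [simp]: "hd (hist k \<omega>) = Y k \<omega>"
  by (simp add: hist_def)

lemma hist_nth: "i \<le> k \<Longrightarrow> hist k \<omega> ! (k - i) = Y i \<omega>"
proof (induction k)
  case 0
  then show ?case by (simp add: hist_def)
next
  case (Suc k)
  then show ?case
    by (cases "i = Suc k") (simp_all add: hist_Suc Suc_diff_le del: Yproc.simps)
qed

lemma drop_hist: "drop j (hist (k + j) \<omega>) = hist k \<omega>"
  by (induction j) (auto simp: hist_Suc)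

lemma hist_sub_sigma: "k \<le> m \<Longrightarrow> hist k \<in> measurable (sub_sigma (past m)) (count_space UNIV)"
proof (induction k)
  case 0
  have "hist 0 = (\<lambda>\<omega>. [Y 0 \<omega>])" by (auto simp: hist_def)
  moreover have "(\<lambda>\<omega>. [Y 0 \<omega>]) \<in> measurable (sub_sigma (past m)) (count_space UNIV)"
    by (rule measurable_compose[OF Y_sub_sigma[of 0 m]]) auto
  ultimately show ?case by simp
next
  case (Suc k)
  have "(\<lambda>\<omega>. (\<lambda>y \<omega>. y # hist k \<omega>) (Y (Suc k) \<omega>) \<omega>) \<in> measurable (sub_sigma (past m)) (count_space UNIV)"
    by (rule measurable_compose_countable[OF measurable_compose[OF Suc.IH measurable_count_space] Y_sub_sigma]) (use Suc.prems in auto)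
  moreover have "hist (Suc k) = (\<lambda>\<omega>. Y (Suc k) \<omega> # hist k \<omega>)" by (rule ext) (rule hist_Suc)
  ultimately show ?case by (simp only:)
qed

lemma hist_rv [measurable]: "hist k \<in> measurable M (count_space UNIV)"
  by (rule sub_sigma_measurable_M[OF past_index hist_sub_sigma[OF order_refl]])

lemma hist_past_event: "{\<omega> \<in> space M. hist k \<omega> = l} \<in> sets (sub_sigma (past k))"
proof -
  have "hist k -` {l} \<inter> space (sub_sigma (past k)) \<in> sets (sub_sigma (past k))"
    by (rule measurable_sets[OF hist_sub_sigma[OF order_refl]]) simp
  moreover have "hist k -` {l} \<inter> space (sub_sigma (past k)) = {\<omega> \<in> space M. hist k \<omega> = l}"
    by (intro set_eqI) (simp only: vimage_def Int_iff mem_Collect_eq singleton_iff space_sub_sigma conj_commute)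
  ultimately show ?thesis by (simp only:)
qed

lemma hist_Suc_iff:
  assumes "Suc k \<noteq> s1" "Suc k \<noteq> s2"
  shows "hist (Suc k) \<omega> = z # l \<longleftrightarrow> hist k \<omega> = l \<and> Zsum (Suc k) (hd l) \<omega> = z"
proof -
  have Y: "Y (Suc k) \<omega> = Zsum (Suc k) (Y k \<omega>) \<omega>"
    unfolding Zsum_def Yproc.simps(2) if_not_P[OF assms(1)] if_not_P[OF assms(2)] add_0_right ..
  have "hist (Suc k) \<omega> = z # l \<longleftrightarrow> Zsum (Suc k) (Y k \<omega>) \<omega> = z \<and> hist k \<omega> = l"
    by (subst hist_Suc, subst list.inject, subst Y, rule refl)
  moreover have "hist k \<omega> = l \<Longrightarrow> hd l = Y k \<omega>" by (drule sym) (simp only: hd_hist)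
  ultimately show ?thesis by (cases "hist k \<omega> = l") (simp_all only: simp_thms)
qed

text \<open>Given the exact history, the population is the number \<open>hd l\<close> and the event
  lies in the past of time \<open>k\<close>, so the fresh variables of time \<open>Suc k\<close> act
  as in \<open>Zsum_law\<close>.\<close>

lemma hist_transition:
  assumes "Suc k \<noteq> s1" "Suc k \<noteq> s2"
  shows "prob {\<omega> \<in> space M. hist (Suc k) \<omega> = z # l} = prob {\<omega> \<in> space M. hist k \<omega> = l} * pmf (step (hd l)) z"
proof -
  have "{\<omega> \<in> space M. hist (Suc k) \<omega> = z # l} = {\<omega> \<in> space M. hist k \<omega> = l} \<inter> {\<omega> \<in> space M. Zsum (Suc k) (hd l) \<omega> = z}"
    unfolding hist_Suc_iff[OF assms] by blast
  moreover have "prob ({\<omega> \<in> space M. hist k \<omega> = l} \<inter> {\<omega> \<in> space M. Zsum (Suc k) (hd l) \<omega> = z}) = prob {\<omega> \<in> space M. hist k \<omega> = l} * pmf (step (hd l)) z"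
  proof (rule Zsum_law[where I = "past k"])
    show "past k \<subseteq> inar_index" by (rule past_index)
    show "{\<omega> \<in> space M. hist k \<omega> = l} \<in> sets (sub_sigma (past k))" by (rule hist_past_event)
  qed (simp_all add: past_def image_iff)
  ultimately show ?thesis by (simp only:)
qed

end

section \<open>The estimator under conditioning on the past\<close>

context inar_model
begin

lemma xi_le_1: "AE \<omega> in M. \<forall>k\<ge>1. \<forall>j\<ge>1. xi k j \<omega> \<le> 1"
proof -
  have "AE \<omega> in M. k \<ge> 1 \<longrightarrow> j \<ge> 1 \<longrightarrow> xi k j \<omega> \<le> 1" for k j
  proof (cases "k \<ge> 1 \<and> j \<ge> 1")
    case True
    then have m: "xi k j \<in> measurable M (count_space UNIV)"
      using X_rv[of "Inr (Inl (k, j))"] by (simp add: inar_index_def)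
    have "AE x in distr M (count_space UNIV) (xi k j). x \<le> 1"
      using True by (subst xi_law) (auto simp: AE_measure_pmf_iff)
    then have "AE \<omega> in M. xi k j \<omega> \<le> 1" by (subst (asm) AE_distr_iff[OF m]) auto
    then show ?thesis by auto
  qed auto
  then show ?thesis by (simp add: AE_all_countable)
qed

text \<open>Survivors never outnumber their parents. The resulting bound deteriorates with
  \<open>k\<close>, which is harmless: it is applied only at the fixed starting time
  \<open>N\<close>.\<close>

lemma Y_cube: "integrable M (\<lambda>\<omega>. real (Y k \<omega>) ^ 3)"
proof (induction k)
  case 0
  then show ?case using Y0_cube by simp
next
  case (Suc k)
  let ?d = "real th1 + real th2"
  have e: "integrable M (\<lambda>\<omega>. real (eps (Suc k) \<omega>) ^ 3)"
  proof -
    have m: "eps (Suc k) \<in> measurable M (count_space UNIV)"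
      using X_rv[of "Inl (Suc k)"] by (simp add: inar_index_def)
    have "integrable (distr M (count_space UNIV) (eps (Suc k))) (\<lambda>x. real x ^ 3)"
      using eps_cube by (subst eps_law) auto
    then show ?thesis by (subst (asm) integrable_distr_eq[OF m]) auto
  qed
  show ?case
  proof (rule Bochner_Integration.integrable_bound)
    \<comment> \<open>\<open>27 = 3 ^ 3\<close>, since a sum of three terms is at most three times
      their maximum.\<close>
    show "integrable M (\<lambda>\<omega>. 27 * (real (Y k \<omega>) ^ 3 + real (eps (Suc k) \<omega>) ^ 3 + ?d ^ 3))"
      using Suc e by simp
    show "(\<lambda>\<omega>. real (Y (Suc k) \<omega>) ^ 3) \<in> borel_measurable M"
      by (rule measurable_compose[OF Y_rv]) simp
    show "AE \<omega> in M. norm (real (Y (Suc k) \<omega>) ^ 3) \<le> norm (27 * (real (Y k \<omega>) ^ 3 + real (eps (Suc k) \<omega>) ^ 3 + ?d ^ 3))"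
      using xi_le_1
    proof eventually_elim
      case (elim \<omega>)
      have "(\<Sum>j = 1..Y k \<omega>. xi (Suc k) j \<omega>) \<le> (\<Sum>j = 1..Y k \<omega>. 1)"
        by (rule sum_mono) (use elim in auto)
      then have "(\<Sum>j = 1..Y k \<omega>. xi (Suc k) j \<omega>) \<le> Y k \<omega>" by simp
      moreover have "(if Suc k = s1 then th1 else 0) \<le> th1" "(if Suc k = s2 then th2 else 0) \<le> th2" by auto
      ultimately have "Y (Suc k) \<omega> \<le> Y k \<omega> + eps (Suc k) \<omega> + (th1 + th2)"
        unfolding Yproc.simps(2) by linarith
      then have "real (Y (Suc k) \<omega>) \<le> real (Y k \<omega>) + real (eps (Suc k) \<omega>) + ?d"
        by (simp only: of_nat_add[symmetric] of_nat_le_iff)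
      also have "\<dots> \<le> 3 * max (real (Y k \<omega>)) (max (real (eps (Suc k) \<omega>)) ?d)"
      proof -
        have "a + b + c \<le> 3 * max a (max b c)" for a b c :: real by (auto simp: max_def)
        then show ?thesis .
      qed
      finally have "real (Y (Suc k) \<omega>) ^ 3 \<le> (3 * max (real (Y k \<omega>)) (max (real (eps (Suc k) \<omega>)) ?d)) ^ 3"
        by (intro power_mono) (auto simp del: Yproc.simps)
      also have "\<dots> = 27 * max (real (Y k \<omega>)) (max (real (eps (Suc k) \<omega>)) ?d) ^ 3"
        by (simp add: power_mult_distrib)
      also have "\<dots> \<le> 27 * (real (Y k \<omega>) ^ 3 + real (eps (Suc k) \<omega>) ^ 3 + ?d ^ 3)"
      proof -
        have "max a (max b c) ^ 3 \<le> a ^ 3 + b ^ 3 + c ^ 3" if "a \<ge> 0" "b \<ge> 0" "c \<ge> 0" for a b c :: real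
          using that by (auto simp: max_def)
        from this[of "real (Y k \<omega>)" "real (eps (Suc k) \<omega>)" ?d] show ?thesis by simp
      qed
      finally show ?case by (simp del: Yproc.simps)
    qed
  qed
qed

definition score :: "nat \<Rightarrow> 'a \<Rightarrow> real" where
  "score n \<omega> = (\<Sum>k\<in>{1..n} - {s1, s2}. residual (Y (k - 1) \<omega>) (Y k \<omega>) * real (Y (k - 1) \<omega>))"

definition info :: "nat \<Rightarrow> 'a \<Rightarrow> real" where
  "info n \<omega> = (\<Sum>k\<in>{1..n} - {s1, s2}. (real (Y (k - 1) \<omega>))\<^sup>2)"

text \<open>Histories list the most recent value first, so \<open>length l\<close> is the time at which \<open>y\<close> is observed.\<close>

primrec state_of :: "nat list \<Rightarrow> state" where
  "state_of [] = (0, 0, 0)"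
| "state_of (y # l) = (if l = [] \<or> length l \<in> {s1, s2} then (y, snd (state_of l)) else next_state (state_of l) y)"

lemma fst_state_of: "l \<noteq> [] \<Longrightarrow> fst (state_of l) = hd l"
  by (cases l) (auto simp: next_state_def)

lemma state_of_hist: "state_of (hist n \<omega>) = (Y n \<omega>, score n \<omega>, info n \<omega>)"
proof (induction n)
  case 0
  then show ?case by (simp add: hist_def score_def info_def)
next
  case (Suc n)
  have ne: "hist n \<omega> \<noteq> []" by (simp add: hist_def)
  show ?case
  proof (cases "Suc n \<in> {s1, s2}")
    case True
    then have "{1..Suc n} - {s1, s2} = {1..n} - {s1, s2}" by (auto simp: atLeastAtMostSuc_conv)
    then have "score (Suc n) \<omega> = score n \<omega>" "info (Suc n) \<omega> = info n \<omega>" unfolding score_def info_def by simp_all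
    then show ?thesis using True Suc ne by (auto simp: hist_Suc simp del: Yproc.simps)
  next
    case False
    then have I: "{1..Suc n} - {s1, s2} = insert (Suc n) ({1..n} - {s1, s2})" by (auto simp: atLeastAtMostSuc_conv)
    have "score (Suc n) \<omega> = residual (Y n \<omega>) (Y (Suc n) \<omega>) * real (Y n \<omega>) + score n \<omega>"
      "info (Suc n) \<omega> = (real (Y n \<omega>))\<^sup>2 + info n \<omega>"
      unfolding score_def info_def I by (subst sum.insert; simp del: Yproc.simps)+
    then show ?thesis using False Suc ne by (simp add: hist_Suc next_state_def del: Yproc.simps)
  qed
qed

definition scaled_error :: "nat \<Rightarrow> 'a \<Rightarrow> real" where
  "scaled_error n \<omega> = sqrt (real n) * (alpha_tilde Y e1 s1 s2 n \<omega> - \<alpha>)"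

lemma alpha_tilde_eq: "alpha_tilde Y e1 s1 s2 n \<omega> = (if info n \<omega> > 0 then score n \<omega> / info n \<omega> + \<alpha> else 0)"
proof -
  have "(\<Sum>k\<in>{1..n} - {s1, s2}. (real (Y k \<omega>) - e1) * real (Y (k - 1) \<omega>)) = score n \<omega> + \<alpha> * info n \<omega>"
    unfolding score_def info_def sum_distrib_left sum.distrib[symmetric] residual_def
    by (rule sum.cong) (auto simp: algebra_simps power2_eq_square)
  then show ?thesis unfolding alpha_tilde_def Let_def info_def[symmetric] by (simp add: add_divide_distrib)
qed

lemma scaled_error_rv: "scaled_error n \<in> borel_measurable M"
proof -
  have [measurable]: "(\<lambda>\<omega>. real (Y k \<omega>)) \<in> borel_measurable M" for k
    by (rule measurable_compose[OF Y_rv]) simp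
  have [measurable]: "score n \<in> borel_measurable M" "info n \<in> borel_measurable M"
    unfolding score_def[abs_def] info_def[abs_def] residual_def by measurable
  show ?thesis unfolding scaled_error_def[abs_def] alpha_tilde_eq by measurable
qed

text \<open>When the denominator vanishes, so does the score; the right side then holds, while the
  estimator takes its default 0 and the scaled error is \<open>- \<alpha> sqrt n\<close>. The lower
  bound on \<open>x\<close> makes the two sides agree in this case as well.\<close>

lemma scaled_error_le_iff:
  assumes n: "n > 0" "- (\<alpha> * sqrt (real n)) \<le> x"
  shows "scaled_error n \<omega> \<le> x \<longleftrightarrow> score n \<omega> / sqrt (real n) - x * info n \<omega> / real n \<le> 0"
proof (cases "info n \<omega> > 0")
  case True
  have "scaled_error n \<omega> = sqrt (real n) * score n \<omega> / info n \<omega>" using True by (simp add: scaled_error_def alpha_tilde_eq)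
  also have "\<dots> \<le> x \<longleftrightarrow> sqrt (real n) * score n \<omega> \<le> x * info n \<omega>" using True by (simp add: field_simps)
  also have "\<dots> \<longleftrightarrow> sqrt (real n) * score n \<omega> / real n \<le> x * info n \<omega> / real n"
    using n by (simp add: divide_le_cancel)
  also have "sqrt (real n) * score n \<omega> / real n = score n \<omega> / sqrt (real n)"
    using n by (simp add: field_simps flip: real_sqrt_mult)
  finally show ?thesis by simp
next
  case False
  have "info n \<omega> \<ge> 0" unfolding info_def by (intro sum_nonneg) auto
  then have Q: "info n \<omega> = 0" using False by simp
  then have "\<forall>k\<in>{1..n} - {s1, s2}. (real (Y (k - 1) \<omega>))\<^sup>2 = 0"
    unfolding info_def by (subst (asm) sum_nonneg_eq_0_iff) auto
  then have "score n \<omega> = 0" unfolding score_def by (intro sum.neutral) auto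
  then show ?thesis using Q n by (simp add: scaled_error_def alpha_tilde_eq mult.commute)
qed

definition cond_measure :: "'a set \<Rightarrow> 'a measure" where
  "cond_measure A = uniform_measure M A"

section \<open>Conditioning on an event of the history up to a time \<open>N\<close> at or after
  both outliers\<close>

context
  fixes N :: nat and B :: "nat list set" and A :: "'a set"
  assumes N: "s1 \<le> N" "s2 \<le> N"
    and A: "A = {\<omega> \<in> space M. hist N \<omega> \<in> B}" and A_pos: "prob A > 0"
begin

abbreviation M' :: "'a measure" where "M' \<equiv> cond_measure A"

lemma A_events: "A \<in> events"
  using measurable_sets[OF hist_rv[of N], of B] by (simp add: A vimage_def Int_def conj_commute)

lemma emeasure_A: "emeasure M A \<noteq> 0" "emeasure M A \<noteq> \<infinity>"
  using A_pos by (auto simp: emeasure_eq_measure)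

lemma prob_space_M': "prob_space M'"
  unfolding cond_measure_def by (rule prob_space_uniform_measure) (use emeasure_A in auto)

lemma sets_M' [simp, measurable_cong]: "sets M' = sets M"
  by (simp add: cond_measure_def)

lemma space_M' [simp]: "space M' = space M"
  by (simp add: cond_measure_def)

lemma measure_M': "S \<in> events \<Longrightarrow> measure M' S = prob (A \<inter> S) / prob A"
  unfolding cond_measure_def using A_events emeasure_A by (intro measure_uniform_measure) auto

definition hist_law :: "nat \<Rightarrow> nat list pmf" where
  "hist_law k = (SOME p. measure_pmf p = distr M' (count_space UNIV) (hist k))"

lemma hist_law: "measure_pmf (hist_law k) = distr M' (count_space UNIV) (hist k)"
  unfolding hist_law_def
proof (rule someI_ex)
  interpret M': prob_space M' by (rule prob_space_M')
  have "prob_space (distr M' (count_space UNIV) (hist k))"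
    by (rule M'.prob_space_distr) measurable
  then obtain p where "measure_pmf p = distr M' (count_space UNIV) (hist k)"
    using countable_measure_pmf[of "distr M' (count_space UNIV) (hist k)"] by auto
  then show "\<exists>p. measure_pmf p = distr M' (count_space UNIV) (hist k)" ..
qed

lemma prob_hist_law: "measure_pmf.prob (hist_law k) S = measure M' {\<omega> \<in> space M. hist k \<omega> \<in> S}"
  unfolding hist_law by (subst measure_distr) (measurable, auto intro!: arg_cong[where f = "measure M'"])

lemma pmf_hist_law: "pmf (hist_law k) l = measure M' {\<omega> \<in> space M. hist k \<omega> = l}"
  using prob_hist_law[of k "{l}"] by (simp add: measure_pmf_single)

lemma hist_events: "{\<omega> \<in> space M. hist k \<omega> = l} \<in> events"
  using measurable_sets[OF hist_rv[of k], of "{l}"] by (simp add: vimage_def Int_def conj_commute)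

text \<open>Membership in \<open>A\<close> is decided by the oldest \<open>N + 1\<close> entries of
  the history, and dropping the \<open>j\<close> newest ones recovers these.\<close>

lemma pmf_hist_law_cond: "pmf (hist_law (N + j)) l = (if drop j l \<in> B then prob {\<omega> \<in> space M. hist (N + j) \<omega> = l} / prob A else 0)"
proof -
  have "A \<inter> {\<omega> \<in> space M. hist (N + j) \<omega> = l} = (if drop j l \<in> B then {\<omega> \<in> space M. hist (N + j) \<omega> = l} else {})"
    unfolding A by (auto simp: drop_hist)
  then show ?thesis unfolding pmf_hist_law by (subst measure_M'[OF hist_events]) simp
qed

lemma set_hist_law: "l \<in> set_pmf (hist_law k) \<Longrightarrow> length l = Suc k"
proof -
  assume "l \<in> set_pmf (hist_law k)"
  then have "measure M' {\<omega> \<in> space M. hist k \<omega> = l} \<noteq> 0" by (simp add: set_pmf_iff pmf_hist_law)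
  then have "{\<omega> \<in> space M. hist k \<omega> = l} \<noteq> {}" by (metis measure_empty)
  then show ?thesis by auto
qed

text \<open>Conditioning on \<open>A\<close> deletes some histories and rescales the others by one
  constant, so transitions after time \<open>N\<close> keep the law \<open>step\<close>; no outlier
  occurs there.\<close>

lemma hist_law_Suc: "hist_law (Suc (N + j)) = bind_pmf (hist_law (N + j)) (\<lambda>l. map_pmf (\<lambda>y. y # l) (step (hd l)))"
proof (rule pmf_eqI)
  fix l
  show "pmf (hist_law (Suc (N + j))) l = pmf (bind_pmf (hist_law (N + j)) (\<lambda>l. map_pmf (\<lambda>y. y # l) (step (hd l)))) l"
  proof (cases l)
    case Nil
    have "[] \<notin> set_pmf (hist_law (Suc (N + j)))" using set_hist_law by fastforce
    moreover have "[] \<notin> set_pmf (bind_pmf (hist_law (N + j)) (\<lambda>l. map_pmf (\<lambda>y. y # l) (step (hd l))))" by auto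
    ultimately show ?thesis unfolding Nil by (simp only: set_pmf_iff not_not)
  next
    case (Cons z l')
    have "pmf (map_pmf (\<lambda>y. y # k) (step (hd k))) (z # l') = pmf (step (hd l')) z * indicator {l'} k" for k
    proof -
      have "(\<lambda>y. y # k) -` {z # l'} = (if k = l' then {z} else {})" by auto
      then show ?thesis by (simp add: pmf_map measure_pmf_single)
    qed
    then have "pmf (bind_pmf (hist_law (N + j)) (\<lambda>l. map_pmf (\<lambda>y. y # l) (step (hd l)))) l = pmf (step (hd l')) z * pmf (hist_law (N + j)) l'"
      unfolding Cons by (simp add: pmf_bind measure_pmf_single)
    also have "\<dots> = pmf (hist_law (N + Suc j)) l"
      unfolding pmf_hist_law_cond Cons using hist_transition[of "N + j" z l'] N by simp
    finally show ?thesis by simp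
  qed
qed

lemma chain_hist_law: "map_pmf state_of (hist_law (N + j)) = chain j (map_pmf state_of (hist_law N))"
proof (induction j)
  case (Suc j)
  have "map_pmf state_of (hist_law (Suc (N + j))) = bind_pmf (hist_law (N + j)) (\<lambda>l. map_pmf (\<lambda>y. state_of (y # l)) (step (hd l)))"
    unfolding hist_law_Suc by (simp add: map_bind_pmf pmf.map_comp o_def)
  also have "\<dots> = bind_pmf (hist_law (N + j)) (\<lambda>l. kern (state_of l))"
  proof (rule bind_pmf_cong[OF refl])
    fix l assume "l \<in> set_pmf (hist_law (N + j))"
    then have l: "length l = Suc (N + j)" by (rule set_hist_law)
    then have "l \<noteq> []" by auto
    then show "map_pmf (\<lambda>y. state_of (y # l)) (step (hd l)) = kern (state_of l)"
      \<comment> \<open>The new value is observed at time \<open>N + j + 1\<close>, later than both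
        outliers, so \<open>state_of\<close> takes its \<open>next_state\<close> branch.\<close>
      unfolding kern_def fst_state_of[OF \<open>l \<noteq> []\<close>] using l N by simp
  qed
  also have "\<dots> = bind_pmf (map_pmf state_of (hist_law (N + j))) kern"
    by (simp add: bind_map_pmf)
  finally show ?case using Suc by (simp add: chain_Suc)
qed simp

lemma integrable_M':
  fixes f :: "'a \<Rightarrow> real"
  assumes "integrable M f" shows "integrable M' f"
proof -
  have [measurable]: "f \<in> borel_measurable M" using assms by auto
  have "(\<integral>\<^sup>+\<omega>. ennreal (norm (f \<omega>)) \<partial>M') = (\<integral>\<^sup>+\<omega>. ennreal (norm (f \<omega>)) * indicator A \<omega> \<partial>M) / emeasure M A"
    unfolding cond_measure_def using A_events by (subst nn_integral_uniform_measure) auto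
  also have "\<dots> \<le> (\<integral>\<^sup>+\<omega>. ennreal (norm (f \<omega>)) \<partial>M) / emeasure M A"
    by (intro divide_right_mono_ennreal nn_integral_mono) (auto simp: indicator_def)
  also have "\<dots> < \<infinity>"
    using assms emeasure_A by (auto simp: integrable_iff_bounded ennreal_divide_eq_top_iff less_top[symmetric])
  finally show ?thesis by (simp add: integrable_iff_bounded)
qed

lemma start_cube: "integrable (measure_pmf (map_pmf state_of (hist_law N))) (\<lambda>c. real (fst c) ^ 3)"
proof -
  have "integrable M' (\<lambda>\<omega>. real (fst (state_of (hist N \<omega>))) ^ 3)"
    using integrable_M'[OF Y_cube[of N]] by (simp add: state_of_hist)
  then have "integrable (measure_pmf (hist_law N)) (\<lambda>l. real (fst (state_of l)) ^ 3)"
    unfolding hist_law by (subst integrable_distr_eq) auto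
  then show ?thesis by simp
qed

lemma scaled_error_weak: "weak_conv_m (\<lambda>n. distr M' borel (scaled_error n)) (density lborel (normal_density 0 (sqrt (score_var / m2\<^sup>2))))"
  unfolding weak_conv_m_def weak_conv_def
proof (intro allI impI)
  fix x :: real
  let ?F = "cdf (density lborel (normal_density 0 (sqrt (score_var / m2\<^sup>2))))"
  let ?C = "\<lambda>n. {c::state. fst (snd c) / sqrt (real n) - x * snd (snd c) / real n \<le> 0}"
  \<comment> \<open>For fixed \<open>x\<close> the side condition of
    \<open>scaled_error_le_iff\<close> holds for all large \<open>n\<close>.\<close>
  have "filterlim (\<lambda>n. \<alpha> * sqrt (real n)) at_top sequentially"
    using \<alpha>_pos by real_asymp
  then have "\<forall>\<^sub>F n in sequentially. - x \<le> \<alpha> * sqrt (real n)" by (simp add: filterlim_at_top)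
  then have "\<forall>\<^sub>F n in sequentially. measure_pmf.prob (chain (n - N) (map_pmf state_of (hist_law N))) (?C n) = cdf (distr M' borel (scaled_error n)) x"
    using eventually_gt_at_top[of 0] eventually_ge_at_top[of N]
  proof eventually_elim
    case (elim n)
    have "cdf (distr M' borel (scaled_error n)) x = measure M' {\<omega> \<in> space M. scaled_error n \<omega> \<le> x}"
      unfolding cdf_def using scaled_error_rv[of n]
      by (subst measure_distr) (auto intro!: arg_cong[where f = "measure M'"] cong: measurable_cong_sets)
    also have "{\<omega> \<in> space M. scaled_error n \<omega> \<le> x} = {\<omega> \<in> space M. hist n \<omega> \<in> state_of -` ?C n}"
      using scaled_error_le_iff[of n x] elim by (auto simp: state_of_hist)
    also have "measure M' \<dots> = measure_pmf.prob (map_pmf state_of (hist_law n)) (?C n)"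
      unfolding prob_hist_law[symmetric] by simp
    also have "map_pmf state_of (hist_law n) = chain (n - N) (map_pmf state_of (hist_law N))"
      using chain_hist_law[of "n - N"] elim by simp
    finally show ?case by simp
  qed
  from Lim_transform_eventually[OF ratio_limit[OF start_cube, of N x] this]
  show "(\<lambda>n. cdf (distr M' borel (scaled_error n)) x) \<longlonglongrightarrow> ?F x" .
qed

end

end

lemma normal_distribution_scale:
  assumes "\<sigma> > 0"
  shows "density lborel (normal_density 0 \<sigma>) = distr std_normal_distribution borel (\<lambda>z. \<sigma> * z)"
    "density lborel (normal_density 0 \<sigma>) = distr std_normal_distribution borel (\<lambda>z. - \<sigma> * z)"
proof -
  have "\<sigma> \<noteq> 0" "- \<sigma> \<noteq> 0" using assms by auto
  then show "density lborel (normal_density 0 \<sigma>) = distr std_normal_distribution borel (\<lambda>z. \<sigma> * z)"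
    "density lborel (normal_density 0 \<sigma>) = distr std_normal_distribution borel (\<lambda>z. - \<sigma> * z)"
    using normal_distribution_eq_distr[of \<sigma>] normal_distribution_eq_distr[of "- \<sigma>"] assms by simp_all
qed

context inar_model
begin

lemma theta_tilde_diff:
  "sqrt (real n) * (theta_tilde Y e1 s1 s2 n s \<omega> - (real (Y s \<omega>) - \<alpha> * real (Y (s - 1) \<omega>) - e1))
    = - scaled_error n \<omega> * real (Y (s - 1) \<omega>)"
  unfolding theta_tilde_def scaled_error_def by (simp add: algebra_simps)

text \<open>On \<open>A\<close> the two lagged values are constants, so the vector is a fixed linear
  image of \<open>scaled_error\<close>. Testing with \<open>f\<close> amounts to testing the scalar
  limit with the bounded continuous function \<open>g\<close>.\<close>

lemma theta_weak:
  assumes N: "s1 \<le> N" "s2 \<le> N"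
    and A: "A = {\<omega> \<in> space M. hist N \<omega> \<in> B}" and A_pos: "prob A > 0"
    and Am: "\<And>\<omega>. \<omega> \<in> A \<Longrightarrow> Y (s1 - 1) \<omega> = k1 \<and> Y (s2 - 1) \<omega> = k2"
  shows "weak_conv2
    (\<lambda>n. distr (uniform_measure M A) borel
       (\<lambda>\<omega>. (sqrt (real n) * (theta_tilde Y e1 s1 s2 n s1 \<omega> - (real (Y s1 \<omega>) - \<alpha> * real (Y (s1 - 1) \<omega>) - e1)),
              sqrt (real n) * (theta_tilde Y e1 s1 s2 n s2 \<omega> - (real (Y s2 \<omega>) - \<alpha> * real (Y (s2 - 1) \<omega>) - e1)))))
    (normal2_rank1 (score_var / m2\<^sup>2) (real k1) (real k2))"
  unfolding weak_conv2_def theta_tilde_diff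
proof (intro allI impI)
  fix f :: "real \<times> real \<Rightarrow> real"
  assume f: "continuous_on UNIV f \<and> bounded (range f)"
  let ?M' = "cond_measure A"
  let ?\<sigma> = "sqrt (score_var / m2\<^sup>2)"
  have \<sigma>: "?\<sigma> > 0" using score_var_pos m2_pos by simp
  note TW = scaled_error_weak[OF N A A_pos]
  interpret M': prob_space "cond_measure A" by (rule prob_space_M'[OF N A A_pos])
  interpret std: real_distribution std_normal_distribution by (rule real_dist_normal_dist)
  have [measurable]: "f \<in> borel_measurable borel"
    using f by (intro borel_measurable_continuous_onI) auto
  have [measurable]: "scaled_error n \<in> borel_measurable ?M'" for n
    using scaled_error_rv[of n] by (simp add: cond_measure_def)
  have [measurable]: "(\<lambda>\<omega>. real (Y k \<omega>)) \<in> borel_measurable ?M'" for k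
    using measurable_compose[OF Y_rv, of real borel k] by (simp add: cond_measure_def)
  define g where "g = (\<lambda>t. f (- t * real k1, - t * real k2))"
  have gm [measurable]: "g \<in> borel_measurable borel" unfolding g_def by measurable
  have "bounded (range f)" using f by blast
  then obtain C where "\<forall>y\<in>range f. norm y \<le> C" unfolding bounded_iff by blast
  then have C: "norm (f x) \<le> C" for x by blast
  have fc: "continuous_on UNIV f" using f by blast
  have "continuous_on UNIV (\<lambda>t. (- t * real k1, - t * real k2))" by (intro continuous_intros)
  from continuous_on_compose2[OF fc this subset_UNIV] have "continuous_on UNIV g"
    unfolding g_def .
  then have g_cont: "isCont g x" for x by (simp add: continuous_on_eq_continuous_at)
  have nd: "real_distribution (density lborel (normal_density 0 ?\<sigma>))"
    using prob_space_normal_density[OF \<sigma>] by (auto simp: real_distribution_def real_distribution_axioms_def)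
  have "(\<lambda>n. integral\<^sup>L (distr ?M' borel (scaled_error n)) g) \<longlonglongrightarrow> integral\<^sup>L (density lborel (normal_density 0 ?\<sigma>)) g"
  proof (rule weak_conv_imp_integral_bdd_continuous_conv[OF _ nd TW g_cont])
    show "real_distribution (distr ?M' borel (scaled_error n))" for n
      by (rule M'.real_distribution_distr) measurable
    show "norm (g x) \<le> C" for x unfolding g_def by (rule C)
  qed
  moreover have "integral\<^sup>L (distr ?M' borel (scaled_error n)) g = integral\<^sup>L (distr (uniform_measure M A) borel
      (\<lambda>\<omega>. (- scaled_error n \<omega> * real (Y (s1 - 1) \<omega>), - scaled_error n \<omega> * real (Y (s2 - 1) \<omega>)))) f" for n
  proof -
    have "AE \<omega> in ?M'. \<omega> \<in> A"
      unfolding cond_measure_def using emeasure_A[OF N A A_pos] A_events[OF N A A_pos]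
      by (intro AE_uniform_measureI) auto
    then have ae: "AE \<omega> in ?M'. g (scaled_error n \<omega>) = f (- scaled_error n \<omega> * real (Y (s1 - 1) \<omega>), - scaled_error n \<omega> * real (Y (s2 - 1) \<omega>))"
      by eventually_elim (use Am in \<open>auto simp: g_def\<close>)
    have "integral\<^sup>L (distr ?M' borel (scaled_error n)) g = (\<integral>\<omega>. g (scaled_error n \<omega>) \<partial>?M')"
      by (rule integral_distr) measurable
    also have "\<dots> = (\<integral>\<omega>. f (- scaled_error n \<omega> * real (Y (s1 - 1) \<omega>), - scaled_error n \<omega> * real (Y (s2 - 1) \<omega>)) \<partial>?M')"
      by (intro integral_cong_AE ae) measurable
    also have "\<dots> = integral\<^sup>L (distr ?M' borel (\<lambda>\<omega>. (- scaled_error n \<omega> * real (Y (s1 - 1) \<omega>), - scaled_error n \<omega> * real (Y (s2 - 1) \<omega>)))) f"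
      by (rule integral_distr[symmetric]) measurable
    finally show ?thesis unfolding cond_measure_def .
  qed
  moreover have "integral\<^sup>L (density lborel (normal_density 0 ?\<sigma>)) g = integral\<^sup>L (normal2_rank1 (score_var / m2\<^sup>2) (real k1) (real k2)) f"
  proof -
    \<comment> \<open>Symmetry of the normal law: the form with \<open>- ?\<sigma>\<close> cancels
      the minus sign in \<open>g\<close>, and the form with \<open>?\<sigma>\<close> leads back to
      the law in \<open>normal2_rank1\<close>.\<close>
    have p: "density lborel (normal_density 0 ?\<sigma>) = distr std_normal_distribution borel (\<lambda>z. ?\<sigma> * z)"
      and m: "density lborel (normal_density 0 ?\<sigma>) = distr std_normal_distribution borel (\<lambda>z. - ?\<sigma> * z)"
      by (rule normal_distribution_scale[OF \<sigma>])+
    have "integral\<^sup>L (density lborel (normal_density 0 ?\<sigma>)) g = (\<integral>z. f (?\<sigma> * z * real k1, ?\<sigma> * z * real k2) \<partial>std_normal_distribution)"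
      unfolding m by (subst integral_distr) (auto simp: g_def)
    also have "\<dots> = (\<integral>z. f (real k1 * z, real k2 * z) \<partial>density lborel (normal_density 0 ?\<sigma>))"
      unfolding p by (subst integral_distr) (auto simp: mult_ac)
    also have "\<dots> = integral\<^sup>L (normal2_rank1 (score_var / m2\<^sup>2) (real k1) (real k2)) f"
      unfolding normal2_rank1_def by (subst integral_distr) auto
    finally show ?thesis .
  qed
  ultimately show "(\<lambda>n. integral\<^sup>L (distr (uniform_measure M A) borel
      (\<lambda>\<omega>. (- scaled_error n \<omega> * real (Y (s1 - 1) \<omega>), - scaled_error n \<omega> * real (Y (s2 - 1) \<omega>)))) f)
    \<longlonglongrightarrow> integral\<^sup>L (normal2_rank1 (score_var / m2\<^sup>2) (real k1) (real k2)) f" by simp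
qed

end

theorem theorem4p4p2:
  fixes M :: "'a measure" and \<alpha> :: real
    and eps :: "nat \<Rightarrow> 'a \<Rightarrow> nat" and epsd :: "nat pmf"
    and xi :: "nat \<Rightarrow> nat \<Rightarrow> 'a \<Rightarrow> nat" and Y0 :: "'a \<Rightarrow> nat"
    and s1 s2 th1 th2 :: nat
  defines "Y \<equiv> Yproc eps xi Y0 s1 s2 th1 th2"
    and "mu \<equiv> measure_pmf.expectation epsd real"
    and "sig2 \<equiv> sigma2_alpha_eps \<alpha> epsd"
  assumes M: "prob_space M"
    and alpha: "0 < \<alpha>" "\<alpha> < 1"
    and indep: "prob_space.indep_vars M (\<lambda>_. count_space UNIV) (inar_family eps xi Y0) inar_index"
    and eps_law: "\<And>k. k \<ge> 1 \<Longrightarrow> distr M (count_space UNIV) (eps k) = measure_pmf epsd"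
    and xi_law: "\<And>k j. k \<ge> 1 \<Longrightarrow> j \<ge> 1 \<Longrightarrow>
       distr M (count_space UNIV) (xi k j) = measure_pmf (map_pmf of_bool (bernoulli_pmf \<alpha>))"
    and eps_sq: "integrable (measure_pmf epsd) (\<lambda>x. real x ^ 2)"
    and eps_nondeg: "pmf epsd 0 < 1"
    and Y0_cube: "integrable M (\<lambda>\<omega>. real (Y0 \<omega>) ^ 3)"
    and eps_cube: "integrable (measure_pmf epsd) (\<lambda>x. real x ^ 3)"
    and s: "s1 \<ge> 1" "s2 \<ge> 1" "s1 \<noteq> s2"
    and th: "th1 \<ge> 1" "th2 \<ge> 1"
  shows "weak_conv_m (\<lambda>n. distr M borel (\<lambda>\<omega>. sqrt (real n) * (alpha_tilde Y mu s1 s2 n \<omega> - \<alpha>)))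
           (density lborel (normal_density 0 (sqrt sig2))) \<and>
    (\<forall>m1 m2. measure M {\<omega> \<in> space M. Y (s1 - 1) \<omega> = m1 \<and> Y (s2 - 1) \<omega> = m2} > 0 \<longrightarrow>
      weak_conv2
        (\<lambda>n. distr (uniform_measure M {\<omega> \<in> space M. Y (s1 - 1) \<omega> = m1 \<and> Y (s2 - 1) \<omega> = m2}) borel
           (\<lambda>\<omega>. (sqrt (real n) * (theta_tilde Y mu s1 s2 n s1 \<omega>
                     - (real (Y s1 \<omega>) - \<alpha> * real (Y (s1 - 1) \<omega>) - mu)),
                  sqrt (real n) * (theta_tilde Y mu s1 s2 n s2 \<omega>
                     - (real (Y s2 \<omega>) - \<alpha> * real (Y (s2 - 1) \<omega>) - mu)))))
        (normal2_rank1 sig2 (real m1) (real m2)))"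
proof -
  interpret inar_model M \<alpha> epsd eps xi Y0 s1 s2 th1 th2
    by (intro inar_model.intro inar_chain.intro inar_model_axioms.intro M alpha eps_cube eps_nondeg indep
        eps_law xi_law Y0_cube)
  have mu: "mu = e1" unfolding mu_def e1_def ..
  have sig2: "sig2 = score_var / m2\<^sup>2" unfolding sig2_def by (rule sigma2_eq)
  define N where "N = max s1 s2"
  have N: "s1 \<le> N" "s2 \<le> N" by (auto simp: N_def)
  show ?thesis
    unfolding mu sig2
  proof (intro conjI allI impI)
    \<comment> \<open>The unconditional limit is the conditional one for the trivial set of
      histories.\<close>
    have A: "space M = {\<omega> \<in> space M. hist N \<omega> \<in> UNIV}" by simp
    have "prob (space M) > 0" by (simp add: prob_space)
    from scaled_error_weak[OF N A this]
    show "weak_conv_m (\<lambda>n. distr M borel (\<lambda>\<omega>. sqrt (real n) * (alpha_tilde Y e1 s1 s2 n \<omega> - \<alpha>)))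
        (density lborel (normal_density 0 (sqrt (score_var / m2\<^sup>2))))"
      unfolding Y_def cond_measure_def uniform_measure_whole[OF M] scaled_error_def[abs_def] .
  next
    fix k1 k2 :: nat
    let ?A = "{\<omega> \<in> space M. Y (s1 - 1) \<omega> = k1 \<and> Y (s2 - 1) \<omega> = k2}"
    assume pos: "prob ?A > 0"
    \<comment> \<open>Histories run backwards in time, so the value at time \<open>i\<close> stands
      at position \<open>N - i\<close>; thus the conditioning event is one about
      \<open>hist N\<close>.\<close>
    have nth: "hist N \<omega> ! (N - (s1 - 1)) = Y (s1 - 1) \<omega>" "hist N \<omega> ! (N - (s2 - 1)) = Y (s2 - 1) \<omega>" for \<omega>
      unfolding Y_def by (rule hist_nth, use N in simp)+
    have A: "?A = {\<omega> \<in> space M. hist N \<omega> \<in> {l. l ! (N - (s1 - 1)) = k1 \<and> l ! (N - (s2 - 1)) = k2}}"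
      by (simp only: mem_Collect_eq nth)
    show "weak_conv2
       (\<lambda>n. distr (uniform_measure M ?A) borel
          (\<lambda>\<omega>. (sqrt (real n) * (theta_tilde Y e1 s1 s2 n s1 \<omega> - (real (Y s1 \<omega>) - \<alpha> * real (Y (s1 - 1) \<omega>) - e1)),
                 sqrt (real n) * (theta_tilde Y e1 s1 s2 n s2 \<omega> - (real (Y s2 \<omega>) - \<alpha> * real (Y (s2 - 1) \<omega>) - e1)))))
       (normal2_rank1 (score_var / m2\<^sup>2) (real k1) (real k2))"
      unfolding Y_def by (rule theta_weak[OF N A[unfolded Y_def] pos[unfolded Y_def]]) blast
  qed
qed

end
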